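(* Let $n\ge 4$ and let $U$ be uniformly distributed on $\Omega_n$. For almost every $(a,b)\in\mathbb{R}^2$ the density of $(p_3(U),p_4(U))$ is $$f_n(a,b)=\frac1{Z_n}\int_{\mathbb{R}^{n-4}}\frac{\mathbf 1\{(0,1,a,b,p_5,\dots,p_n)\in\mathcal P_n\}}{\mathrm{Disc}(P)^{1/2}}\,dp_5\cdots dp_n ,\qquad Z_n=\frac{\pi^{(n-1)/2}}{\sqrt n\,\Gamma\{(n-1)/2\}},$$ where $P$ is the monic degree-$n$ polynomial whose roots have power sums $(0,1,a,b,p_5,\dots,p_n)$, and where for $n=4$ the integral is read as evaluation of the integrand. The density of $(S_n,K_n)$ is $$h_n(s,k)=n^{-3/2}f_n(s/\sqrt n,\;k/n).$$
   Context: For $u\in\mathbb{R}^n$ write $p_r(u)=\sum_{i=1}^n u_i^r$. $\Omega_n=\{u\in\mathbb{R}^n:\ p_1(u)=0,\ p_2(u)=1\}$ is the unit sphere (of dimension $n-2$) in the hyperplane $\{\sum_i u_i=0\}$. A monic polynomial $P(z)=\prod_i(z-u_i)=\sum_{j=0}^n(-1)^je_jz^{n-j}$ (with $e_0=1$) is determined by the power sums $p=(p_1,\dots,p_n)$ of its roots through Newton's identities $p_r=\sum_{j=1}^{r-1}(-1)^{j-1}e_jp_{r-j}+(-1)^{r-1}re_r$; $\mathcal P_n\subset\mathbb{R}^n$ is the set of $p\in\mathbb{R}^n$ for which $P$ has $n$ real roots (counted with multiplicity), and $\mathrm{Disc}(P)=\prod_{i<j}(u_i-u_j)^2$. $S_n$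 and $K_n$ are the sample skewness and kurtosis of independent $N(\mu,\sigma^2)$ observations $X_1,\dots,X_n$ ($\sigma>0$): $m_r=n^{-1}\sum_i(X_i-\bar X)^r$, $S_n=m_3/m_2^{3/2}$, $K_n=m_4/m_2^2$; they satisfy $(S_n,K_n)=(\sqrt n\,p_3(U),\,n\,p_4(U))$ with $U=(X_i-\bar X)_i/\|(X_i-\bar X)_i\|$ uniform on $\Omega_n$. *)

theory Defs
  imports "HOL-Probability.Probability" "HOL-Computational_Algebra.Polynomial"
begin

definition psum :: "nat \<Rightarrow> real ^ 'n \<Rightarrow> real"
  where "psum r u = (\<Sum>i\<in>UNIV. (u $ i) ^ r)"

definition centred_hyperplane :: "(real ^ 'n) set"
  where "centred_hyperplane = {u. psum 1 u = 0}"

definition Omega :: "(real ^ 'n) set"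
  where "Omega = {u. psum 1 u = 0 \<and> psum 2 u = 1}"

(* The uniform distribution on Omega, the unit sphere of the Euclidean space
   centred_hyperplane, is the unique probability law on Omega that is invariant under
   the linear isometries of that space; each of these is the restriction of an
   orthogonal transformation of the ambient space which preserves the hyperplane. *)
definition uniform_on_Omega :: "'a measure \<Rightarrow> ('a \<Rightarrow> real ^ 'n) \<Rightarrow> bool"
  where "uniform_on_Omega M U \<longleftrightarrow>
    U \<in> borel_measurable M \<and>
    (AE \<omega> in M. U \<omega> \<in> Omega) \<and>
    (\<forall>Q. orthogonal_transformation Q \<and> Q ` centred_hyperplane \<subseteq> centred_hyperplane \<longrightarrow>
       distr M borel (\<lambda>\<omega>. Q (U \<omega>)) = distr M borel U)"

(* Elementary symmetric functions from power sums: Newton's identities solved for e_r;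
   see lemma newton_identity.  Only the values p 1, ..., p r matter for the r-th one. *)
fun newton_e :: "(nat \<Rightarrow> real) \<Rightarrow> nat \<Rightarrow> real"
  where
    "newton_e p 0 = 1"
  | "newton_e p (Suc m) =
       (-1) ^ m / real (Suc m) *
         (p (Suc m) - (\<Sum>j\<in>{1..m}. (-1) ^ (j - 1) * newton_e p j * p (Suc m - j)))"

lemma newton_identity:
  assumes "r \<ge> 1"
  shows "p r = (\<Sum>j\<in>{1..r-1}. (-1) ^ (j - 1) * newton_e p j * p (r - j))
                + (-1) ^ (r - 1) * real r * newton_e p r"
proof -
  obtain m where r: "r = Suc m"
    using assms by (cases r) auto
  define S where "S = (\<Sum>j\<in>{1..m}. (-1) ^ (j - 1) * newton_e p j * p (Suc m - j))"
  have e: "newton_e p (Suc m) = (-1) ^ m / real (Suc m) * (p (Suc m) - S)"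
    by (simp add: S_def)
  have "(-1) ^ m * real (Suc m) * newton_e p (Suc m)
      = ((-1) ^ m * (-1) ^ m) * (p (Suc m) - S)"
    unfolding e by (simp add: field_simps del: of_nat_Suc)
  also have "\<dots> = p (Suc m) - S"
    by (simp flip: power_mult_distrib)
  finally show ?thesis
    unfolding r by (simp add: S_def)
qed

definition newton_poly :: "nat \<Rightarrow> (nat \<Rightarrow> real) \<Rightarrow> real poly"
  where "newton_poly n p = (\<Sum>j\<le>n. monom ((-1) ^ j * newton_e p j) (n - j))"

(* Points of R^n are represented as extensional functions on {1..n}. *)
definition real_rooted_set :: "nat \<Rightarrow> (nat \<Rightarrow> real) set"
  where "real_rooted_set n = {p \<in> {1..n} \<rightarrow>\<^sub>E UNIV. size (proots (newton_poly n p)) = n}"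

(* The discriminant of a monic polynomial all of whose roots are real. *)
definition Disc :: "real poly \<Rightarrow> real"
  where "Disc P = (let u = sorted_list_of_multiset (proots P) in
    \<Prod>j<length u. \<Prod>i<j. (u ! i - u ! j)\<^sup>2)"

definition Z :: "nat \<Rightarrow> real"
  where "Z n = pi powr ((real n - 1) / 2) / (sqrt (real n) * Gamma ((real n - 1) / 2))"

definition f_integrand :: "nat \<Rightarrow> (nat \<Rightarrow> real) \<Rightarrow> ennreal"
  where "f_integrand n p =
    indicator (real_rooted_set n) p / ennreal (sqrt (Disc (newton_poly n p)))"

(* A nonnegative integral with values in [0, \<infinity>], taken over q = (p_5, ..., p_n).
   For n = 4 the domain is a one-point space of mass 1: see lemma f_density_4. *)
definition f_density :: "nat \<Rightarrow> real \<Rightarrow> real \<Rightarrow> ennreal"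
  where "f_density n a b =
    (\<integral>\<^sup>+ q. f_integrand n (q(1 := 0, 2 := 1, 3 := a, 4 := b)) \<partial>(\<Pi>\<^sub>M r\<in>{5..n}. lborel))
      / ennreal (Z n)"

lemma f_density_4:
  "f_density 4 a b =
     f_integrand 4 ((\<lambda>_. undefined)(1 := 0, 2 := 1, 3 := a, 4 := b)) / ennreal (Z 4)"
  by (simp add: f_density_def PiM_empty nn_integral_count_space_finite fun_upd_def)

definition h_density :: "nat \<Rightarrow> real \<Rightarrow> real \<Rightarrow> ennreal"
  where "h_density n s k =
    ennreal (real n powr (- 3 / 2)) * f_density n (s / sqrt (real n)) (k / real n)"

definition sample_mean :: "('n::finite \<Rightarrow> real) \<Rightarrow> real"
  where "sample_mean x = (\<Sum>i\<in>UNIV. x i) / real CARD('n)"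

definition central_moment :: "nat \<Rightarrow> ('n::finite \<Rightarrow> real) \<Rightarrow> real"
  where "central_moment r x = (\<Sum>i\<in>UNIV. (x i - sample_mean x) ^ r) / real CARD('n)"

definition skewness :: "('n::finite \<Rightarrow> real) \<Rightarrow> real"
  where "skewness x = central_moment 3 x / central_moment 2 x powr (3 / 2)"

definition kurtosis :: "('n::finite \<Rightarrow> real) \<Rightarrow> real"
  where "kurtosis x = central_moment 4 x / (central_moment 2 x)\<^sup>2"

end

theory Submission
  imports Defs "HOL-Computational_Algebra.Polynomial_FPS"
begin

text \<open>
  A uniform point of \<open>\<Omega>\<^sub>n\<close> can be realised as the direction \<open>v / \<parallel>v\<parallel>\<close>, where \<open>v\<close> arises from a
  standard Gaussian vector \<open>x\<close> in \<open>\<real>\<^sup>n\<close> by subtracting the mean.  The density then comes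
  from one change of variables for \<open>x\<close>.  The new coordinates are \<open>p\<^sub>1(x)\<close>, half of \<open>p\<^sub>2(v)\<close> and the
  scale-free power sums \<open>p\<^sub>r(v / \<parallel>v\<parallel>)\<close> for \<open>3 \<le> r \<le> n\<close>; the map to them is \<open>moment_map\<close>.

  On the chamber of increasing, nonconstant vectors this map is injective, because by Newton's identities power
  sums determine the polynomial and so its ordered roots (\<open>inj_on_moment_map\<close>); its range consists
  of the points with positive second coordinate whose last \<open>n - 2\<close> coordinates, preceded by 0 and 1, are the power sums of a
  real-rooted polynomial (\<open>moment_map_image\<close>).  Its Jacobian matrix is a lower triangular matrix
  times a Vandermonde matrix, and the determinant is \<open>(n! / 2) \<parallel>v\<parallel>\<^bsup>3-n\<^esup>\<close> times the Vandermonde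
  product of \<open>v / \<parallel>v\<parallel>\<close> (\<open>det_jacobian_direction\<close>).  That product is the square root of the
  discriminant, so in the new coordinates the Gaussian density is a function of the first two
  coordinates divided by \<open>Disc\<^bsup>1/2\<^esup>\<close>.  Summing over the \<open>n!\<close> orderings of the coordinates cancels the
  factorial (\<open>nn_integral_gauss_moments\<close>).  Integrating out the first two coordinates leaves a
  Gaussian and a Gamma integral, which make up the constant \<open>1 / Z\<^sub>n\<close>; integrating out
  \<open>p\<^sub>5, \<dots>, p\<^sub>n\<close> gives \<open>f\<^sub>n\<close> (\<open>nn_integral_gauss_direction\<close>).

  The hypothesis on \<open>U\<close> is invariance under the isometries of the hyperplane.  The direction of a
  Gaussian vector has this property, since such isometries commute with centring
  (\<open>invariant_law_gauss_direction\<close>), and only one law on the sphere has it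
  (\<open>invariant_law_unique\<close>): the mass of a ball centred on the sphere depends only on its radius,
  by Fubini it is the same for any two invariant laws, and small balls determine a measure.

  Finally, the standardised observations of a normal sample form a standard Gaussian vector, and the
  skewness and the kurtosis are \<open>\<surd>n p\<^sub>3\<close> and \<open>n p\<^sub>4\<close> of its direction; rescaling the plane turns \<open>f\<^sub>n\<close>
  into \<open>h\<^sub>n\<close>.
\<close>

section \<open>A well-ordered index type\<close>

text \<open>Coordinates are indexed by the numbers \<open>1, \<dots>, n\<close> themselves.  Their order gives a meaning to
  increasing vectors and to triangular matrices, and the rank of an index is the exponent of the
  power sum that is stored there.\<close>
typedef 'n idx = "{1..CARD('n::finite)}"
  morphisms rank Idx
  by (rule exI[of _ 1]) (simp add: Suc_le_eq)

lemma rank_bounds: "1 \<le> rank (i :: 'n::finite idx)" "rank i \<le> CARD('n)"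
  using rank[of i] by auto

lemma bij_betw_rank: "bij_betw rank (UNIV :: 'n::finite idx set) {1..CARD('n)}"
  by (rule bij_betw_byWitness[where f' = Idx]) (use rank_bounds in \<open>auto simp: Idx_inverse rank_inverse\<close>)

lemma bij_betw_Idx: "bij_betw Idx {1..CARD('n::finite)} (UNIV :: 'n idx set)"
  by (rule bij_betw_byWitness[where f' = rank]) (use rank_bounds in \<open>auto simp: Idx_inverse rank_inverse\<close>)

instance idx :: (finite) finite
proof
  show "finite (UNIV :: 'a idx set)"
    using bij_betw_finite[OF bij_betw_rank] by simp
qed

instantiation idx :: (finite) wellorder
begin

definition less_eq_idx :: "'a idx \<Rightarrow> 'a idx \<Rightarrow> bool"
  where "less_eq_idx i j \<longleftrightarrow> rank i \<le> rank j"

definition less_idx :: "'a idx \<Rightarrow> 'a idx \<Rightarrow> bool"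
  where "less_idx i j \<longleftrightarrow> rank i < rank j"

instance
proof
  fix P :: "'a idx \<Rightarrow> bool" and a
  assume step: "\<And>x. (\<And>y. y < x \<Longrightarrow> P y) \<Longrightarrow> P x"
  show "P a"
  proof (induction "rank a" arbitrary: a rule: less_induct)
    case less
    show ?case
      by (rule step, rule less) (simp add: less_idx_def)
  qed
next
  fix x y z :: "'a idx"
  show "x < y \<longleftrightarrow> x \<le> y \<and> \<not> y \<le> x"
    unfolding less_eq_idx_def less_idx_def by linarith
  show "x \<le> x"
    unfolding less_eq_idx_def by simp
  show "x \<le> y \<Longrightarrow> y \<le> z \<Longrightarrow> x \<le> z"
    unfolding less_eq_idx_def by linarith
  show "x \<le> y \<Longrightarrow> y \<le> x \<Longrightarrow> x = y"
    unfolding less_eq_idx_def by (simp add: rank_inject[symmetric])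
  show "x \<le> y \<or> y \<le> x"
    unfolding less_eq_idx_def by linarith
qed

end

lemma card_idx [simp]: "CARD('n::finite idx) = CARD('n)"
  using bij_betw_same_card[OF bij_betw_rank] by simp

lemma sum_rank: "(\<Sum>i\<in>(UNIV :: 'n::finite idx set). f (rank i)) = sum f {1..CARD('n)}"
  by (rule sum.reindex_bij_betw[OF bij_betw_rank])

lemma prod_rank: "(\<Prod>i\<in>(UNIV :: 'n::finite idx set). f (rank i)) = prod f {1..CARD('n)}"
  by (rule prod.reindex_bij_betw[OF bij_betw_rank])

section \<open>Newton's identities\<close>

definition root_poly :: "real ^ 'm \<Rightarrow> real poly"
  where "root_poly u = (\<Prod>i\<in>UNIV. [:- (u $ i), 1:])"

lemma lead_coeff_root_poly: "lead_coeff (root_poly u) = 1"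
  by (simp add: root_poly_def lead_coeff_prod)

lemma degree_root_poly: "degree (root_poly (u :: real ^ 'm)) = CARD('m)"
  by (simp add: root_poly_def degree_prod_sum_eq)

lemma proots_root_poly: "proots (root_poly u) = image_mset (($) u) (mset_set UNIV)"
proof -
  have "(\<Sum>i\<in>A. {#u $ i#}) = image_mset (($) u) (mset_set A)" if "finite A" for A
    using that by induction auto
  then show ?thesis
    unfolding root_poly_def by (subst proots_prod) auto
qed

definition elem_sym :: "real ^ 'm \<Rightarrow> nat \<Rightarrow> real"
  where "elem_sym u j = (-1) ^ j * coeff (root_poly u) (CARD('m) - j)"

text \<open>Newton's identities compare coefficients in the logarithmic derivative of
  \<open>\<Prod>i. (1 - u\<^sub>i X)\<close>: each factor contributes a geometric series whose coefficients are
  the powers of \<open>u\<^sub>i\<close>.\<close>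
lemma newton_identity_roots:
  fixes u :: "real ^ 'm"
  assumes "1 \<le> r" "r \<le> CARD('m)"
  shows "psum r u = (\<Sum>j\<in>{1..r-1}. (-1) ^ (j - 1) * elem_sym u j * psum (r - j) u)
                + (-1) ^ (r - 1) * real r * elem_sym u r"
proof -
  define E where "E = fps_of_poly (reflect_poly (root_poly u))"
  (* E is the generating function of the signed elementary symmetric functions, and G i is the
     inverse of its i-th linear factor. *)
  define G where "G i = Abs_fps (\<lambda>r. (u $ i) ^ r)" for i
  define F where "F i = 1 - fps_const (u $ i) * fps_X" for i
  have F: "fps_of_poly [:1, - (u $ i):] = F i" for i
  proof (rule fps_ext)
    fix k
    have "coeff [:1, - (u $ i):] k = (if k = 0 then 1 else 0) - u $ i * (if k = 1 then 1 else 0)"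
    proof (cases k)
      case (Suc j)
      then show ?thesis
        unfolding Suc coeff_pCons_Suc by (cases j) simp_all
    qed simp
    then show "fps_nth (fps_of_poly [:1, - (u $ i):]) k = fps_nth (F i) k"
      unfolding F_def fps_of_poly_nth fps_sub_nth fps_one_nth fps_mult_left_const_nth fps_X_nth .
  qed
  have FG: "F i * G i = 1" for i
  proof (rule fps_ext)
    fix k
    have "F i * G i = G i - fps_const (u $ i) * (fps_X * G i)"
      by (simp only: F_def left_diff_distrib mult.assoc mult_1_left)
    then show "fps_nth (F i * G i) k = fps_nth 1 k"
      by (cases k) (simp_all add: G_def)
  qed
  have reflect: "reflect_poly [:- (u $ i), 1:] = [:1, - (u $ i):]" for i
    by (cases "u $ i = 0") (simp_all add: reflect_poly_def)
  have E_prod: "E = (\<Prod>i\<in>UNIV. F i)"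
    by (simp add: E_def root_poly_def reflect_poly_prod fps_of_poly_prod reflect F)
  have deriv: "fps_deriv (\<Prod>i\<in>A. F i) = - (\<Prod>i\<in>A. F i) * (\<Sum>i\<in>A. fps_const (u $ i) * G i)"
    if "finite A" for A
    using that
  proof induction
    case (insert k A)
    have "fps_deriv (F k) = - fps_const (u $ k)"
      unfolding F_def by simp
    also have "\<dots> = - fps_const (u $ k) * (F k * G k)"
      by (simp only: FG mult_1_right)
    also have "\<dots> = - F k * (fps_const (u $ k) * G k)"
      by (simp only: mult_minus_left mult_minus_right mult_ac)
    finally have Fk: "fps_deriv (F k) = - F k * (fps_const (u $ k) * G k)" .
    have "fps_deriv (\<Prod>i\<in>insert k A. F i)
        = F k * fps_deriv (\<Prod>i\<in>A. F i) + fps_deriv (F k) * (\<Prod>i\<in>A. F i)"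
      using insert by simp
    also have "\<dots> = - (F k * (\<Prod>i\<in>A. F i)) *
        (fps_const (u $ k) * G k + (\<Sum>i\<in>A. fps_const (u $ i) * G i))"
      unfolding insert.IH Fk
      by (simp only: mult_minus_left mult_minus_right distrib_left minus_add_distrib mult_ac add_ac)
    finally show ?case
      using insert by simp
  qed simp
  have coeffE: "fps_nth E j = (-1) ^ j * elem_sym u j" if "j \<le> CARD('m)" for j
    using that by (simp add: E_def elem_sym_def coeff_reflect_poly degree_root_poly
        flip: mult.assoc power_mult_distrib)
  have G_sum: "fps_nth (\<Sum>i\<in>UNIV. fps_const (u $ i) * G i) k = psum (Suc k) u" for k
    by (simp add: fps_sum_nth G_def psum_def)
  obtain m where r: "r = Suc m"
    using assms by (cases r) auto
  have "fps_nth (fps_deriv E) m = real r * fps_nth E r"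
    by (simp add: r)
  then have "real r * ((-1) ^ r * elem_sym u r) = fps_nth (fps_deriv E) m"
    using assms by (simp add: coeffE)
  also have "\<dots> = - (\<Sum>j=0..m. fps_nth E j * psum (Suc (m - j)) u)"
    unfolding E_prod deriv[OF finite]
    by (simp add: fps_mult_nth G_sum flip: E_prod)
  also have "(\<Sum>j=0..m. fps_nth E j * psum (Suc (m - j)) u)
      = (\<Sum>j=0..m. (-1) ^ j * elem_sym u j * psum (r - j) u)"
    using assms by (intro sum.cong) (auto simp: coeffE r Suc_diff_le)
  also have "\<dots> = psum r u + (\<Sum>j=1..m. (-1) ^ j * elem_sym u j * psum (r - j) u)"
    using lead_coeff_root_poly[of u]
    by (subst sum.atLeast_Suc_atMost) (auto simp: elem_sym_def degree_root_poly)
  also have "(\<Sum>j=1..m. (-1) ^ j * elem_sym u j * psum (r - j) u)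
      = - (\<Sum>j=1..m. (-1) ^ (j - 1) * elem_sym u j * psum (r - j) u)"
    unfolding sum_negf[symmetric]
  proof (intro sum.cong refl)
    fix j assume "j \<in> {1..m}"
    then show "(-1) ^ j * elem_sym u j * psum (r - j) u
        = - ((-1) ^ (j - 1) * elem_sym u j * psum (r - j) u)"
      by (cases j) simp_all
  qed
  finally show ?thesis
    by (simp add: r algebra_simps)
qed

lemma newton_e_psum:
  fixes u :: "real ^ 'm"
  assumes p: "\<And>r. 1 \<le> r \<Longrightarrow> r \<le> CARD('m) \<Longrightarrow> p r = psum r u"
  shows "j \<le> CARD('m) \<Longrightarrow> newton_e p j = elem_sym u j"
proof (induction j rule: less_induct)
  case (less j)
  show ?case
  proof (cases "j = 0")
    case True
    then show ?thesis
      using lead_coeff_root_poly[of u] by (simp add: elem_sym_def degree_root_poly)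
  next
    case False
    then have j: "1 \<le> j" by simp
    have "(\<Sum>i\<in>{1..j-1}. (-1) ^ (i - 1) * newton_e p i * p (j - i))
        = (\<Sum>i\<in>{1..j-1}. (-1) ^ (i - 1) * elem_sym u i * psum (j - i) u)"
      using less by (intro sum.cong) (auto simp: p)
    with newton_identity[OF j, of p] newton_identity_roots[OF j, of u] less.prems
    have "(-1) ^ (j - 1) * real j * newton_e p j = (-1) ^ (j - 1) * real j * elem_sym u j"
      using p[OF j] by auto
    with j show ?thesis by simp
  qed
qed

lemma newton_poly_coeff:
  assumes "j \<le> n"
  shows "coeff (newton_poly n p) (n - j) = (-1) ^ j * newton_e p j"
proof -
  have "coeff (newton_poly n p) (n - j)
      = (\<Sum>i\<le>n. if i = j then (-1) ^ i * newton_e p i else 0)"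
    unfolding newton_poly_def coeff_sum
    using assms by (intro sum.cong) auto
  with assms show ?thesis by simp
qed

lemma degree_newton_poly_le: "degree (newton_poly n p) \<le> n"
  unfolding newton_poly_def by (intro degree_sum_le) (auto intro: order_trans[OF degree_monom_le])

text \<open>Newton's identities can be solved both for the elementary symmetric functions and for the
  power sums, so the polynomial and the first \<open>n\<close> power sums of its roots determine each other.\<close>
lemma newton_poly_eq_root_poly_iff:
  fixes u :: "real ^ 'm"
  shows "newton_poly CARD('m) p = root_poly u \<longleftrightarrow> (\<forall>r\<in>{1..CARD('m)}. p r = psum r u)"
proof
  assume p: "\<forall>r\<in>{1..CARD('m)}. p r = psum r u"
  show "newton_poly CARD('m) p = root_poly u"
  proof (rule poly_eqI)
    fix k
    show "coeff (newton_poly CARD('m) p) k = coeff (root_poly u) k"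
    proof (cases "k \<le> CARD('m)")
      case True
      have "newton_e p (CARD('m) - k) = elem_sym u (CARD('m) - k)"
        using p by (intro newton_e_psum) auto
      with newton_poly_coeff[of "CARD('m) - k" "CARD('m)" p] True show ?thesis
        by (simp add: elem_sym_def flip: mult.assoc power_mult_distrib)
    next
      case False
      then show ?thesis
        using degree_newton_poly_le[of "CARD('m)" p] degree_root_poly[of u]
        by (simp add: coeff_eq_0)
    qed
  qed
next
  assume eq: "newton_poly CARD('m) p = root_poly u"
  have e: "newton_e p j = elem_sym u j" if "j \<le> CARD('m)" for j
    using newton_poly_coeff[OF that, of p]
    by (simp add: eq elem_sym_def flip: mult.assoc power_mult_distrib)
  have "1 \<le> r \<Longrightarrow> r \<le> CARD('m) \<Longrightarrow> p r = psum r u" for r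
  proof (induction r rule: less_induct)
    case (less r)
    have "(\<Sum>i\<in>{1..r-1}. (-1) ^ (i - 1) * newton_e p i * p (r - i))
        = (\<Sum>i\<in>{1..r-1}. (-1) ^ (i - 1) * elem_sym u i * psum (r - i) u)"
      using less by (intro sum.cong) (auto simp: e)
    with newton_identity[of r p] newton_identity_roots[of r u] less.prems show ?case
      by (simp add: e)
  qed
  then show "\<forall>r\<in>{1..CARD('m)}. p r = psum r u" by auto
qed

lemma split_off_roots:
  fixes p :: "real poly"
  assumes "p \<noteq> 0"
  shows "(\<Prod>x\<in>#proots p. [:- x, 1:]) dvd p"
  using assms
proof (induction p rule: poly_root_order_induct)
  case (no_roots p)
  then have "proots p = {#}"
    by (intro multiset_eqI) (simp add: order_root)
  then show ?case by simp
next
  case (root p x n)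
  then have "p \<noteq> 0" by auto
  have image_repeat: "(\<Prod>y\<in>#repeat_mset n {#x#}. [:- y, 1:]) = [:- x, 1:] ^ n"
    by simp
  from \<open>p \<noteq> 0\<close> root show ?case
    by (simp add: proots_mult proots_power mult_dvd_mono image_repeat)
qed simp

lemma monic_split:
  fixes p :: "real poly"
  assumes "lead_coeff p = 1" "size (proots p) = degree p"
  shows "p = (\<Prod>x\<in>#proots p. [:- x, 1:])"
proof -
  let ?q = "\<Prod>x\<in>#proots p. [:- x, 1:]"
  have "p \<noteq> 0" using assms by auto
  obtain c where c: "p = ?q * c"
    using split_off_roots[OF \<open>p \<noteq> 0\<close>] by (elim dvdE)
  have q: "degree (\<Prod>x\<in>#M. [:- x, 1:]) = size M" "(\<Prod>x\<in>#M. [:- x, 1:]) \<noteq> 0"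
    for M :: "real multiset"
    by (induction M) (auto simp: degree_mult_eq simp del: mult_pCons_left)
  have lead: "lead_coeff (\<Prod>x\<in>#M. [:- x, 1:]) = 1" for M :: "real multiset"
    by (induction M) (simp_all add: lead_coeff_mult del: mult_pCons_left)
  have "c \<noteq> 0" using c \<open>p \<noteq> 0\<close> by auto
  then have "degree p = degree ?q + degree c"
    by (subst c) (rule degree_mult_eq[OF q(2) \<open>c \<noteq> 0\<close>])
  then have "degree c = 0"
    using assms(2) q(1) by simp
  moreover have "lead_coeff c = 1"
    using arg_cong[OF c, of lead_coeff] assms(1) lead[of "proots p"] by (simp add: lead_coeff_mult)
  ultimately have "c = 1"
    by (metis coeff_pCons_0 degree_eq_zeroE one_pCons)
  with c show ?thesis by simp
qed

section \<open>Real-rooted polynomials and ordered roots\<close>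

definition psums :: "real ^ 'n::finite idx \<Rightarrow> real ^ 'n idx"
  where "psums u = (\<chi> i. psum (rank i) u)"

definition coords :: "real ^ 'n::finite idx \<Rightarrow> nat \<Rightarrow> real"
  where "coords y = (\<lambda>r\<in>{1..CARD('n)}. y $ Idx r)"

text \<open>A real-rooted polynomial is represented by its vector of roots in increasing order.\<close>
definition chamber :: "(real ^ 'n::finite idx) set"
  where "chamber = {u. \<forall>i j. i \<le> j \<longrightarrow> u $ i \<le> u $ j}"

text \<open>The Vandermonde product.  On the chamber all its factors are nonnegative, and it is the square
  root of the discriminant.\<close>
definition vdm :: "real ^ 'n::finite idx \<Rightarrow> real"
  where "vdm u = (\<Prod>j\<in>UNIV. \<Prod>i\<in>{..<j}. (u $ j - u $ i))"

lemma rank_Idx: "1 \<le> r \<Longrightarrow> r \<le> CARD('n) \<Longrightarrow> rank (Idx r :: 'n::finite idx) = r"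
  by (simp add: Idx_inverse)

lemma rank_pos [simp]: "0 < rank i"
  using rank_bounds(1)[of i] by simp

lemma pred_rank_less [simp]: "rank (i :: 'n::finite idx) - Suc 0 < CARD('n)"
  using rank_bounds[of i] by linarith

lemma newton_poly_coords_eq_iff:
  fixes u y :: "real ^ 'n::finite idx"
  shows "newton_poly CARD('n) (coords y) = root_poly u \<longleftrightarrow> y = psums u"
proof -
  have "newton_poly CARD('n) (coords y) = root_poly u
      \<longleftrightarrow> (\<forall>r\<in>{1..CARD('n)}. y $ Idx r = psum r u)"
    using newton_poly_eq_root_poly_iff[of "coords y" u] by (simp add: coords_def)
  also have "\<dots> \<longleftrightarrow> (\<forall>i. y $ i = psum (rank i) u)"
    using rank_bounds rank_inverse by (metis atLeastAtMost_iff rank_Idx)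
  finally show ?thesis
    by (simp add: psums_def vec_eq_iff)
qed

lemma newton_poly_coords_psums [simp]:
  "newton_poly CARD('n) (coords (psums (u :: real ^ 'n::finite idx))) = root_poly u"
  by (simp add: newton_poly_coords_eq_iff)

lemma sorted_roots:
  fixes u :: "real ^ 'n::finite idx"
  assumes "u \<in> chamber"
  shows "sorted_list_of_multiset (proots (root_poly u)) = map (\<lambda>r. u $ Idx r) [1..<Suc CARD('n)]"
    (is "_ = ?l")
proof -
  have "image_mset Idx (mset_set {1..CARD('n)}) = mset_set (UNIV :: 'n idx set)"
    using bij_betw_Idx[where 'n = 'n] unfolding bij_betw_def
    by (metis image_mset_mset_set)
  then have "proots (root_poly u) = image_mset (($) u) (image_mset Idx (mset_set {1..CARD('n)}))"
    by (simp add: proots_root_poly)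
  also have "\<dots> = mset ?l"
    by (simp add: multiset.map_comp comp_def atLeastLessThanSuc_atLeastAtMost mset_upt del: upt_Suc)
  finally have "sorted_list_of_multiset (proots (root_poly u)) = sort ?l"
    by (simp only: sorted_list_of_multiset_mset)
  also have "sort ?l = ?l"
  proof (rule sorted_sort_id)
    show "sorted ?l"
      using assms unfolding sorted_iff_nth_mono
      by (auto simp: chamber_def less_eq_idx_def rank_Idx simp del: upt_Suc)
  qed
  finally show ?thesis .
qed

text \<open>Power sums determine the polynomial, hence the multiset of its roots, hence the ordered roots.\<close>
lemma inj_on_psums: "inj_on psums (chamber :: (real ^ 'n::finite idx) set)"
proof (rule inj_onI)
  fix u v :: "real ^ 'n idx"
  assume u: "u \<in> chamber" and v: "v \<in> chamber" and eq: "psums u = psums v"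
  have "root_poly u = root_poly v"
    using newton_poly_coords_psums[of u] newton_poly_coords_psums[of v] eq by simp
  then have "map (\<lambda>r. u $ Idx r) [1..<Suc CARD('n)] = map (\<lambda>r. v $ Idx r) [1..<Suc CARD('n)]"
    using sorted_roots[OF u] sorted_roots[OF v] by simp
  then have *: "u $ Idx r = v $ Idx r" if "r \<in> {1..CARD('n)}" for r
    using that by (simp add: map_eq_conv del: upt_Suc)
  have "u $ i = v $ i" for i
    using *[of "rank i"] rank[of i] by (simp add: rank_inverse)
  then show "u = v"
    by (simp add: vec_eq_iff)
qed

text \<open>This describes the admissible power sums as a continuous image of a closed set, so
  they form a Borel set.\<close>
lemma real_rooted_iff:
  fixes y :: "real ^ 'n::finite idx"
  shows "coords y \<in> real_rooted_set CARD('n) \<longleftrightarrow> y \<in> psums ` chamber"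
proof
  assume "coords y \<in> real_rooted_set CARD('n)"
  let ?P = "newton_poly CARD('n) (coords y)"
  define l where "l = sorted_list_of_multiset (proots ?P)"
  have size: "size (proots ?P) = CARD('n)"
    using \<open>coords y \<in> real_rooted_set CARD('n)\<close> by (simp add: real_rooted_set_def)
  have len: "length l = CARD('n)"
    unfolding l_def by (metis mset_sorted_list_of_multiset size size_mset)
  have deg: "degree ?P = CARD('n)"
    using size_proots_le[of ?P] degree_newton_poly_le[of "CARD('n)" "coords y"] size by simp
  then have "lead_coeff ?P = 1"
    using newton_poly_coeff[of 0 "CARD('n)" "coords y"] by simp
  then have P: "?P = (\<Prod>x\<in>#proots ?P. [:- x, 1:])"
    by (rule monic_split) (simp add: size deg)
  define u :: "real ^ 'n idx" where "u = (\<chi> i. l ! (rank i - 1))"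
  have "u \<in> chamber"
  proof -
    have "rank j - 1 < length l" for j :: "'n idx"
      using rank_bounds[of j] len by simp
    then show ?thesis
      unfolding chamber_def u_def l_def
      by (auto simp: less_eq_idx_def intro!: sorted_nth_mono)
  qed
  have "root_poly u = (\<Prod>r\<in>{1..CARD('n)}. [:- (l ! (r - 1)), 1:])"
    unfolding root_poly_def u_def 
    by (simp only: vec_lambda_beta prod_rank[of "\<lambda>r. [:- (l ! (r - 1)), 1:]"])
  also have "\<dots> = (\<Prod>k<CARD('n). [:- (l ! k), 1:])"
    by (rule prod.reindex_bij_witness[of _ Suc "\<lambda>r. r - 1"]) auto
  also have "\<dots> = prod_list (map (\<lambda>x. [:- x, 1:]) l)"
    by (simp add: prod.list_conv_set_nth len lessThan_atLeast0)
  also have "\<dots> = ?P"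
    by (subst P) (simp add: l_def flip: prod_mset_prod_list)
  finally have "y = psums u"
    using newton_poly_coords_eq_iff[of y u] by simp
  with \<open>u \<in> chamber\<close> show "y \<in> psums ` chamber" by blast
next
  assume "y \<in> psums ` chamber"
  then obtain u where "y = psums u" by blast
  moreover have "coords y \<in> {1..CARD('n)} \<rightarrow>\<^sub>E UNIV"
    by (simp add: coords_def)
  ultimately show "coords y \<in> real_rooted_set CARD('n)"
    by (simp add: real_rooted_set_def proots_root_poly)
qed

lemma vdm_reindex:
  fixes u :: "real ^ 'n::finite idx"
  shows "vdm u = (\<Prod>j<CARD('n). \<Prod>i<j. (u $ Idx (Suc j) - u $ Idx (Suc i)))"
proof -
  have bij: "bij_betw (\<lambda>k. Idx (Suc k)) {..<CARD('n)} (UNIV :: 'n idx set)"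
    by (rule bij_betw_byWitness[where f' = "\<lambda>i. rank i - 1"])
      (auto simp: rank_Idx rank_inverse Suc_le_eq)
  have "(\<Prod>i\<in>{..<Idx (Suc j)}. (u $ Idx (Suc j) - u $ i)) =
      (\<Prod>i<j. (u $ Idx (Suc j) - u $ Idx (Suc i)))" if "j < CARD('n)" for j
  proof (rule prod.reindex_bij_betw[symmetric])
    show "bij_betw (\<lambda>k. Idx (Suc k)) {..<j} {..<Idx (Suc j) :: 'n idx}"
      by (rule bij_betw_byWitness[where f' = "\<lambda>i. rank i - 1"])
        (use that in \<open>auto simp: rank_Idx rank_inverse less_idx_def Suc_le_eq less_diff_conv2\<close>)
  qed
  then show ?thesis
    unfolding vdm_def by (subst prod.reindex_bij_betw[OF bij, symmetric]) simp
qed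

lemma vdm_nonneg: "u \<in> chamber \<Longrightarrow> 0 \<le> vdm u"
  unfolding vdm_def chamber_def by (intro prod_nonneg ballI) auto

lemma sqrt_Disc_root_poly:
  fixes u :: "real ^ 'n::finite idx"
  assumes "u \<in> chamber"
  shows "sqrt (Disc (root_poly u)) = vdm u"
proof -
  have "Disc (root_poly u) = (\<Prod>j<CARD('n). \<Prod>i<j. (u $ Idx (Suc i) - u $ Idx (Suc j))\<^sup>2)"
    unfolding Disc_def sorted_roots[OF assms] Let_def
    by (simp add: nth_append del: upt_Suc)
  also have "\<dots> = (vdm u)\<^sup>2"
    by (simp add: vdm_reindex power2_commute flip: prod_power_distrib)
  finally show ?thesis
    using vdm_nonneg[OF assms] by simp
qed

lemma f_integrand_psums:
  fixes u :: "real ^ 'n::finite idx"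
  assumes "u \<in> chamber"
  shows "f_integrand CARD('n) (coords (psums u)) = 1 / ennreal (vdm u)"
  using assms real_rooted_iff[of "psums u"] by (simp add: f_integrand_def sqrt_Disc_root_poly)

lemma f_integrand_eq_0:
  fixes y :: "real ^ 'n::finite idx"
  assumes "y \<notin> psums ` chamber"
  shows "f_integrand CARD('n) (coords y) = 0"
  using assms real_rooted_iff[of y] by (simp add: f_integrand_def)

lemma continuous_on_psum [continuous_intros]: "continuous_on S (psum r)"
  unfolding psum_def by (intro continuous_intros)

lemma continuous_on_psums: "continuous_on S psums"
  unfolding psums_def by (intro continuous_intros)

lemma continuous_on_vdm: "continuous_on S vdm"
  unfolding vdm_def by (intro continuous_intros)

lemma closed_chamber: "closed (chamber :: (real ^ 'n::finite idx) set)"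
proof -
  have "chamber = (\<Inter>i. \<Inter>j\<in>{i..}. {u :: real ^ 'n idx. u $ i \<le> u $ j})"
    by (auto simp: chamber_def)
  also have "closed \<dots>"
    by (intro closed_INT ballI closed_Collect_le continuous_intros)
  finally show ?thesis .
qed

text \<open>A closed set is a countable union of compact sets, and continuous maps preserve
  compactness.\<close>
lemma continuous_image_closed_borel:
  fixes f :: "'a::euclidean_space \<Rightarrow> 'b::euclidean_space"
  assumes "closed F" "continuous_on F f"
  shows "f ` F \<in> sets borel"
proof -
  have "F = (\<Union>k::nat. F \<inter> cball 0 (real k))"
    using real_arch_simple by (auto simp: dist_norm)
  then have "f ` F = (\<Union>k::nat. f ` (F \<inter> cball 0 (real k)))"
    by (metis image_UN)
  also have "\<dots> \<in> sets borel"
  proof (rule sets.countable_UN, rule image_subsetI)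
    fix k :: nat
    have "compact (F \<inter> cball 0 (real k))"
      using assms(1) by (simp add: closed_Int_compact)
    then have "compact (f ` (F \<inter> cball 0 (real k)))"
      using assms(2) by (intro compact_continuous_image) (auto intro: continuous_on_subset)
    then show "f ` (F \<inter> cball 0 (real k)) \<in> sets borel"
      by (intro borel_closed compact_imp_closed)
  qed
  finally show ?thesis .
qed

text \<open>For positive \<open>a\<close> the set where the square root of the discriminant is at least \<open>a\<close> is the
  image of the closed set of those ordered root vectors whose Vandermonde product is at least \<open>a\<close>.\<close>
lemma borel_measurable_f_integrand:
  "(\<lambda>y :: real ^ 'n::finite idx. f_integrand CARD('n) (coords y)) \<in> borel_measurable borel"
proof -
  let ?R = "psums ` (chamber :: (real ^ 'n idx) set)"
  define D where "D y = (if y \<in> ?R then sqrt (Disc (newton_poly CARD('n) (coords y))) else 0)"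
    for y :: "real ^ 'n idx"
  have D: "D (psums u) = vdm u" if "u \<in> chamber" for u
    using that by (simp add: D_def sqrt_Disc_root_poly)
  have R: "?R \<in> sets borel"
    by (intro continuous_image_closed_borel closed_chamber continuous_on_psums)
  have [measurable]: "D \<in> borel_measurable borel"
    unfolding borel_measurable_iff_ge
  proof
    fix a
    show "{y \<in> space borel. a \<le> D y} \<in> sets borel"
    proof (cases "a \<le> 0")
      case True
      have "0 \<le> D y" for y
        using D vdm_nonneg by (cases "y \<in> ?R") (auto simp: D_def simp del: real_sqrt_ge_0_iff)
      with True have "{y \<in> space borel. a \<le> D y} = UNIV"
        by (auto intro: order_trans)
      then show ?thesis by simp
    next
      case False
      then have "y \<in> ?R" if "a \<le> D y" for y
        using that by (auto simp: D_def split: if_splits)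
      then have "{y \<in> space borel. a \<le> D y} = psums ` (chamber \<inter> {u. a \<le> vdm u})"
        using D by fastforce
      also have "\<dots> \<in> sets borel"
        by (intro continuous_image_closed_borel closed_Int closed_chamber continuous_on_psums
            closed_Collect_le continuous_on_vdm continuous_on_const)
      finally show ?thesis .
    qed
  qed
  have "f_integrand CARD('n) (coords y) = indicator ?R y / ennreal (D y)" for y :: "real ^ 'n idx"
    using real_rooted_iff[of y] by (cases "y \<in> ?R") (simp_all add: f_integrand_def D_def)
  then show ?thesis
    using R by simp
qed

section \<open>Change of variables for nonnegative integrands\<close>

lemma borel_measurable_vec_lambda [measurable (raw)]:
  fixes f :: "'i::finite \<Rightarrow> 'a \<Rightarrow> real"
  assumes "\<And>i. f i \<in> borel_measurable M"
  shows "(\<lambda>x. \<chi> i. f i x) \<in> borel_measurable M"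
proof (subst borel_measurable_euclidean_space, rule ballI)
  fix b :: "real ^ 'i"
  assume "b \<in> Basis"
  then obtain i where "b = axis i 1"
    by (auto simp: Basis_vec_def)
  then show "(\<lambda>x. (\<chi> i. f i x) \<bullet> b) \<in> borel_measurable M"
    using assms by (simp add: inner_axis)
qed

lemma borel_measurable_vec_nth [measurable]:
  "(\<lambda>x :: real ^ 'i. x $ i) \<in> borel_measurable borel"
  by (intro borel_measurable_continuous_onI continuous_intros)

lemma absolutely_integrable_iff_nn_integral:
  fixes h :: "'a::euclidean_space \<Rightarrow> real"
  assumes h: "(\<lambda>x. indicator S x * h x) \<in> borel_measurable borel"
    and nonneg: "\<And>x. x \<in> S \<Longrightarrow> 0 \<le> h x" and "0 \<le> b"
  shows "h absolutely_integrable_on S \<and> integral S h = b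
    \<longleftrightarrow> (\<integral>\<^sup>+x. ennreal (indicator S x * h x) \<partial>lborel) = ennreal b"
proof
  assume "h absolutely_integrable_on S \<and> integral S h = b"
  then have "(h has_integral b) S"
    by (auto simp: has_integral_iff set_lebesgue_integral_eq_integral(1))
  from nn_integral_has_integral_lebesgue[OF nonneg this]
  show "(\<integral>\<^sup>+x. ennreal (indicator S x * h x) \<partial>lborel) = ennreal b" by simp
next
  assume "(\<integral>\<^sup>+x. ennreal (indicator S x * h x) \<partial>lborel) = ennreal b"
  then have "((\<lambda>x. indicator S x * h x) has_integral b) UNIV"
    using nonneg \<open>0 \<le> b\<close> by (intro nn_integral_has_integral h) (auto simp: indicator_def)
  then have "((\<lambda>x. if x \<in> S then h x else 0) has_integral b) UNIV"
    by (rule has_integral_eq[rotated]) (simp add: indicator_def)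
  then have "(h has_integral b) S"
    by (simp add: has_integral_restrict_UNIV)
  then show "h absolutely_integrable_on S \<and> integral S h = b"
    using nonneg by (auto simp: has_integral_iff intro: nonnegative_absolutely_integrable_1)
qed

text \<open>For nonnegative integrands no integrability is required: if one side is finite, then the
  version for integrable functions makes the other side equal to it, and otherwise both sides are
  infinite.\<close>
lemma nn_integral_change_of_variables:
  fixes g :: "real ^ 'm::{finite,wellorder} \<Rightarrow> real ^ 'm::_" and f :: "real ^ 'm::_ \<Rightarrow> real"
  assumes S: "S \<in> sets borel" and gS: "g ` S \<in> sets borel"
    and der: "\<And>x. x \<in> S \<Longrightarrow> (g has_derivative g' x) (at x within S)"
    and inj: "inj_on g S"
    and f [measurable]: "f \<in> borel_measurable borel" and nonneg: "\<And>y. 0 \<le> f y"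
    and D: "(\<lambda>x. indicator S x * (\<bar>det (matrix (g' x))\<bar> * f (g x))) \<in> borel_measurable borel"
  shows "(\<integral>\<^sup>+x. ennreal (indicator S x * (\<bar>det (matrix (g' x))\<bar> * f (g x))) \<partial>lborel)
    = (\<integral>\<^sup>+y. ennreal (indicator (g ` S) y * f y) \<partial>lborel)" (is "?L = ?R")
proof -
  have S': "S \<in> sets lebesgue"
    using S by (auto intro: sets_completionI_sets)
  have gS_f: "(\<lambda>y. indicator (g ` S) y * f y) \<in> borel_measurable borel"
    using gS by measurable
  have iff: "?L = ennreal b \<longleftrightarrow> ?R = ennreal b" if "0 \<le> b" for b
  proof -
    have "?L = ennreal b \<longleftrightarrow> (\<lambda>x. \<bar>det (matrix (g' x))\<bar> * f (g x)) absolutely_integrable_on S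
        \<and> integral S (\<lambda>x. \<bar>det (matrix (g' x))\<bar> * f (g x)) = b"
      by (rule absolutely_integrable_iff_nn_integral[OF D _ that, symmetric]) (simp add: nonneg)
    also have "\<dots> \<longleftrightarrow> f absolutely_integrable_on g ` S \<and> integral (g ` S) f = b"
      using has_absolute_integral_change_of_variables[OF S' der inj,
          of "\<lambda>y. vec (f y) :: real ^ 1" "vec b"]
      by (simp add: absolutely_integrable_on_1_iff integral_on_1_eq vec_eq_iff)
    also have "\<dots> \<longleftrightarrow> ?R = ennreal b"
      by (rule absolutely_integrable_iff_nn_integral[OF gS_f _ that]) (simp add: nonneg)
    finally show ?thesis .
  qed
  show ?thesis
  proof (cases ?L)
    case (real b)
    with iff[of b] show ?thesis by simp
  next
    case top
    have "?R \<noteq> ennreal b" if "0 \<le> b" for b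
      using iff[OF that] top by simp
    with top show ?thesis
      by (cases ?R) auto
  qed
qed

section \<open>Centred power sums as coordinates\<close>

definition centre :: "real ^ 'm \<Rightarrow> real ^ 'm"
  where "centre x = (\<chi> i. x $ i - psum 1 x / real CARD('m))"

definition csum :: "nat \<Rightarrow> real ^ 'm \<Rightarrow> real"
  where "csum r x = psum r (centre x)"

text \<open>The second coordinate is half of the squared length because the radial part of the Gaussian
  density then becomes \<open>exp (- t)\<close>.\<close>
definition moment_map :: "real ^ 'n::finite idx \<Rightarrow> real ^ 'n idx"
  where "moment_map x = (\<chi> i.
    if rank i = 1 then psum 1 x
    else if rank i = 2 then csum 2 x / 2
    else csum (rank i) x * csum 2 x powr (- real (rank i) / 2))"

text \<open>The rows are the gradients of the coordinates of \<open>moment_map\<close>.  From the third row on, the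
  middle term comes from differentiating the mean and the last one from the factor that
  normalises the length.\<close>
definition jacobian :: "real ^ 'n::finite idx \<Rightarrow> real ^ 'n idx ^ 'n idx"
  where "jacobian x = (\<chi> i k.
    if rank i = 1 then 1
    else if rank i = 2 then centre x $ k
    else real (rank i) * csum 2 x powr (- real (rank i) / 2) *
      (centre x $ k ^ (rank i - 1) - csum (rank i - 1) x / real CARD('n)
        - csum (rank i) x / csum 2 x * centre x $ k))"

text \<open>Centring subtracts from the increment \<open>h\<close> its mean; moved from \<open>h\<close> to its coefficients, this
  subtracts the mean of the powers \<open>(centre x $ k) ^ (r - 1)\<close>.\<close>
lemma has_derivative_csum [derivative_intros]:
  fixes x :: "real ^ 'm"
  shows "(csum r has_derivative
    (\<lambda>h. \<Sum>k\<in>UNIV. real r * (centre x $ k ^ (r - 1) - csum (r - 1) x / real CARD('m)) * h $ k)) (at x)"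
proof -
  have "((\<lambda>x. \<Sum>i\<in>UNIV. (x $ i - (\<Sum>j\<in>UNIV. x $ j) / real CARD('m)) ^ r) has_derivative
      (\<lambda>h. \<Sum>i\<in>UNIV. real r * (h $ i - (\<Sum>j\<in>UNIV. h $ j) / real CARD('m)) *
        (x $ i - (\<Sum>j\<in>UNIV. x $ j) / real CARD('m)) ^ (r - 1))) (at x)"
    by (auto intro!: derivative_eq_intros bounded_linear_imp_has_derivative bounded_linear_vec_nth
        simp: mult_ac)
  moreover have "(\<lambda>x :: real ^ 'm. \<Sum>i\<in>UNIV. (x $ i - (\<Sum>j\<in>UNIV. x $ j) / real CARD('m)) ^ r) = csum r"
    by (simp add: fun_eq_iff csum_def psum_def centre_def)
  moreover have "(\<Sum>i\<in>UNIV. real r * (h $ i - (\<Sum>j\<in>UNIV. h $ j) / real CARD('m)) *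
        (x $ i - (\<Sum>j\<in>UNIV. x $ j) / real CARD('m)) ^ (r - 1))
    = (\<Sum>k\<in>UNIV. real r * (centre x $ k ^ (r - 1) - csum (r - 1) x / real CARD('m)) * h $ k)" for h
  proof -
    have "(\<Sum>i\<in>UNIV. real r * (h $ i - H) * (x $ i - m) ^ (r - 1))
        = real r * (\<Sum>i\<in>UNIV. (x $ i - m) ^ (r - 1) * h $ i) - real r * H * (\<Sum>i\<in>UNIV. (x $ i - m) ^ (r - 1))" 
      for H m :: real
      by (simp add: algebra_simps sum_subtractf sum_distrib_left)
    moreover have "(\<Sum>k\<in>UNIV. real r * ((x $ k - m) ^ (r - 1) - s) * h $ k)
        = real r * (\<Sum>i\<in>UNIV. (x $ i - m) ^ (r - 1) * h $ i) - real r * s * (\<Sum>k\<in>UNIV. h $ k)" 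
      for s m :: real
      by (simp add: algebra_simps sum_subtractf sum_distrib_left)
    ultimately show ?thesis
      by (simp add: csum_def psum_def centre_def)
  qed
  ultimately show ?thesis by simp
qed

lemma has_derivative_vec_lambda:
  fixes f :: "'a::real_normed_vector \<Rightarrow> real ^ 'm"
  assumes "\<And>i. ((\<lambda>x. f x $ i) has_derivative (\<lambda>h. f' h $ i)) (at x within S)"
  shows "(f has_derivative f') (at x within S)"
  unfolding has_derivative_componentwise_within[of f]
  using assms by (auto simp: Basis_vec_def inner_axis)

lemma csum_1 [simp]: "csum (Suc 0) x = 0"
  by (simp add: csum_def centre_def psum_def sum_subtractf)

lemma has_derivative_moment_map:
  fixes x :: "real ^ 'n::finite idx"
  assumes "0 < csum 2 x"
  shows "(moment_map has_derivative (\<lambda>h. jacobian x *v h)) (at x)"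
proof (rule has_derivative_vec_lambda)
  fix i :: "'n idx"
  let ?c = "csum 2 x" and ?r = "rank i"
  have d2: "(csum 2 has_derivative (\<lambda>h. 2 * (\<Sum>k\<in>UNIV. centre x $ k * h $ k))) (at x)"
    using has_derivative_csum[of 2 x]
    by (simp add: sum_distrib_left mult_ac)
  consider "?r = 1" | "?r = 2" | "3 \<le> ?r"
    using rank_pos[of i] by linarith
  then show "((\<lambda>x. moment_map x $ i) has_derivative (\<lambda>h. (jacobian x *v h) $ i)) (at x)"
  proof cases
    case 1
    then have "(\<lambda>x. moment_map x $ i) = (\<lambda>x. \<Sum>j\<in>UNIV. x $ j)"
      "(\<lambda>h. (jacobian x *v h) $ i) = (\<lambda>h. \<Sum>j\<in>UNIV. h $ j)"
      by (simp_all add: moment_map_def psum_def jacobian_def matrix_vector_mult_def)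
    then show ?thesis
      by (simp only:) (intro has_derivative_sum bounded_linear_imp_has_derivative bounded_linear_vec_nth)
  next
    case 2
    then have eq: "(\<lambda>x. moment_map x $ i) = (\<lambda>x. csum 2 x / 2)"
      "(\<lambda>h. (jacobian x *v h) $ i) = (\<lambda>h. \<Sum>k\<in>UNIV. centre x $ k * h $ k)"
      by (simp_all add: moment_map_def jacobian_def matrix_vector_mult_def)
    show ?thesis
      unfolding eq using has_derivative_mult_right[OF d2, of "1 / 2"] by simp
  next
    case 3
    let ?e = "- real ?r / 2"
    let ?g = "\<lambda>k. centre x $ k ^ (?r - 1) - csum (?r - 1) x / real CARD('n)"
    have eq: "(\<lambda>x. moment_map x $ i) = (\<lambda>x. csum ?r x * csum 2 x powr ?e)"
      using 3 by (simp add: moment_map_def)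
    have dr: "(csum ?r has_derivative (\<lambda>h. \<Sum>k\<in>UNIV. real ?r * ?g k * h $ k)) (at x)"
      using has_derivative_csum[of ?r x] by simp
    have d2e: "((\<lambda>x. csum 2 x powr ?e) has_derivative
        (\<lambda>h. ?c powr ?e * (2 * (\<Sum>k\<in>UNIV. centre x $ k * h $ k) * ?e / ?c))) (at x)"
      using has_derivative_powr[OF d2 has_derivative_const assms UNIV_I, of ?e] by simp
    have "(\<lambda>h. (jacobian x *v h) $ i) = (\<lambda>h. csum ?r x *
        (?c powr ?e * (2 * (\<Sum>k\<in>UNIV. centre x $ k * h $ k) * ?e / ?c)) +
        (\<Sum>k\<in>UNIV. real ?r * ?g k * h $ k) * ?c powr ?e)"
    proof
      fix h
      have "(jacobian x *v h) $ i = (\<Sum>k\<in>UNIV. real ?r * ?c powr ?e * (?g k - csum ?r x / ?c * centre x $ k) * h $ k)"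
        using 3 by (simp add: jacobian_def matrix_vector_mult_def)
      also have "\<dots> = (\<Sum>k\<in>UNIV. real ?r * ?g k * h $ k) * ?c powr ?e
          - real ?r * ?c powr ?e * csum ?r x / ?c * (\<Sum>k\<in>UNIV. centre x $ k * h $ k)"
        by (simp add: sum_distrib_left sum_distrib_right sum_divide_distrib sum_subtractf sum.distrib
            algebra_simps)
      finally show "(jacobian x *v h) $ i = csum ?r x *
        (?c powr ?e * (2 * (\<Sum>k\<in>UNIV. centre x $ k * h $ k) * ?e / ?c)) +
        (\<Sum>k\<in>UNIV. real ?r * ?g k * h $ k) * ?c powr ?e"
        by simp
    qed
    then show ?thesis
      unfolding eq using has_derivative_mult[OF dr d2e] by simp
  qed
qed

section \<open>The Jacobian determinant\<close>

lemma sum_rank_delta: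
  assumes "1 \<le> m" "m \<le> CARD('n)"
  shows "(\<Sum>j\<in>(UNIV :: 'n::finite idx set). if rank j = m then f j else 0) = f (Idx m :: 'n idx)"
proof -
  have "rank j = m \<longleftrightarrow> j = Idx m" for j :: "'n idx"
    using assms rank_inverse[of j] rank_Idx[where 'n = 'n, of m] by auto
  then show ?thesis by simp
qed

lemma card_lessThan_idx: "card {..<i} = rank i - 1" for i :: "'n::finite idx"
proof -
  have "bij_betw rank {..<i} {1..<rank i}"
    by (rule bij_betw_byWitness[where f' = Idx])
      (use rank_bounds[of i] in \<open>auto simp: rank_inverse less_idx_def rank_Idx Suc_le_eq\<close>)
  then show ?thesis
    using bij_betw_same_card by fastforce
qed

text \<open>The coefficients of the polynomials \<open>\<Prod>j<i. (X - v\<^sub>j)\<close> form a lower triangular matrix with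
  unit diagonal, and its product with the Vandermonde matrix contains the values of these
  polynomials at the \<open>v\<^sub>k\<close>, which is an upper triangular matrix.\<close>
lemma det_vandermonde:
  fixes v :: "real ^ 'n::finite idx"
  shows "det (\<chi> i k. v $ k ^ (rank i - 1)) = vdm v"
proof -
  define q where "q i = (\<Prod>j\<in>{..<i}. [:- (v $ j), 1:])" for i
  let ?V = "(\<chi> i k. v $ k ^ (rank i - 1)) :: real ^ 'n idx ^ 'n idx"
  let ?W = "(\<chi> i k. coeff (q i) (rank k - 1)) :: real ^ 'n idx ^ 'n idx"
  have deg: "degree (q i) = rank i - 1" for i
    by (simp add: q_def degree_prod_sum_eq card_lessThan_idx)
  have "lead_coeff (q i) = 1" for i
    by (simp add: q_def lead_coeff_prod)
  then have lead: "coeff (q i) (rank i - 1) = 1" for i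
    by (simp add: deg)
  have poly_q: "poly (q i) x = (\<Prod>j\<in>{..<i}. (x - v $ j))" for i x
    by (simp add: q_def poly_prod)
  have entries: "(?W ** ?V) $ i $ k = (\<Prod>j\<in>{..<i}. (v $ k - v $ j))" for i k
  proof -
    have "(?W ** ?V) $ i $ k = (\<Sum>r\<in>{1..CARD('n)}. coeff (q i) (r - 1) * v $ k ^ (r - 1))"
      using sum_rank[of "\<lambda>r. coeff (q i) (r - 1) * v $ k ^ (r - 1)"]
      by (simp add: matrix_matrix_mult_def)
    also have "\<dots> = (\<Sum>m<CARD('n). coeff (q i) m * v $ k ^ m)"
      by (rule sum.reindex_bij_witness[of _ Suc "\<lambda>r. r - 1"]) auto
    also have "\<dots> = (\<Sum>m\<le>degree (q i). coeff (q i) m * v $ k ^ m)"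
      by (rule sum.mono_neutral_right) (auto simp: deg coeff_eq_0 intro: le_less_trans[OF _ pred_rank_less])
    also have "\<dots> = (\<Prod>j\<in>{..<i}. (v $ k - v $ j))"
      by (simp add: poly_altdef flip: poly_q)
    finally show ?thesis .
  qed
  have "det ?W = 1"
  proof (subst det_lowerdiagonal)
    fix i j :: "'n idx"
    assume "i < j"
    then show "?W $ i $ j = 0"
      by (auto simp: less_idx_def deg intro!: coeff_eq_0 diff_less_mono Suc_leI)
  qed (simp only: vec_lambda_beta lead prod.neutral_const)
  moreover have "det (?W ** ?V) = vdm v"
  proof (subst det_upperdiagonal)
    fix i j :: "'n idx"
    assume "j < i"
    then show "(?W ** ?V) $ i $ j = 0"
      unfolding entries by (intro prod_zero) auto
  qed (simp only: entries vdm_def)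
  ultimately show ?thesis
    by (simp add: det_mul)
qed

lemma vdm_centre: "vdm (centre x) = vdm x"
  by (simp add: vdm_def centre_def)

text \<open>Each row of the Jacobian matrix is a multiple of the Vandermonde row of the same index, up to
  multiples of the first two Vandermonde rows.\<close>
lemma det_jacobian:
  fixes x :: "real ^ 'n::finite idx"
  assumes n: "2 \<le> CARD('n)"
  shows "det (jacobian x) = (\<Prod>r=3..CARD('n). real r * csum 2 x powr (- real r / 2)) * vdm x"
proof -
  let ?c = "csum 2 x"
  define s where "s i = (if rank i \<le> 2 then 1 else real (rank i) * ?c powr (- real (rank i) / 2))" for i :: "'n idx"
  (* The two corrections only affect the first two columns and start in the third row, so L is lower
     triangular with diagonal s. *)
  define L :: "real ^ 'n idx ^ 'n idx" where
    "L = (\<chi> i j. s i * ((if j = i then 1 else 0) -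
      (if 3 \<le> rank i then (if rank j = 1 then csum (rank i - 1) x / real CARD('n) else 0)
        + (if rank j = 2 then csum (rank i) x / ?c else 0) else 0)))"
  let ?V = "(\<chi> i k. centre x $ k ^ (rank i - 1)) :: real ^ 'n idx ^ 'n idx"
  have "(L ** ?V) $ i $ k = jacobian x $ i $ k" for i k
  proof -
    let ?v = "\<lambda>j :: 'n idx. centre x $ k ^ (rank j - 1)"
    have split: "L $ i $ j * ?v j = s i * ((if j = i then ?v j else 0) -
        (if 3 \<le> rank i then (if rank j = 1 then csum (rank i - 1) x / real CARD('n) * ?v j else 0)
        + (if rank j = 2 then csum (rank i) x / ?c * ?v j else 0) else 0))" for j
      unfolding L_def by simp
    have "(L ** ?V) $ i $ k = s i * (?v i - (if 3 \<le> rank i then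
        csum (rank i - 1) x / real CARD('n) * ?v (Idx 1) + csum (rank i) x / ?c * ?v (Idx 2) else 0))"
      unfolding matrix_matrix_mult_def vec_lambda_beta split sum_distrib_left[symmetric] sum_subtractf
      using n by (simp add: sum.distrib sum_rank_delta)
    also have "\<dots> = jacobian x $ i $ k"
    proof -
      consider "rank i = 1" | "rank i = 2" | "3 \<le> rank i"
        using rank_pos[of i] by linarith
      then show ?thesis
        using n by cases (simp_all add: s_def jacobian_def rank_Idx)
    qed
    finally show ?thesis .
  qed
  then have "jacobian x = L ** ?V"
    by (simp add: vec_eq_iff)
  moreover have "det L = (\<Prod>i\<in>UNIV. s i)"
  proof (subst det_lowerdiagonal)
    fix i j :: "'n idx"
    assume "i < j"
    then show "L $ i $ j = 0"
      by (auto simp: L_def less_idx_def)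
  next
    have "L $ i $ i = s i" for i
      by (simp add: L_def)
    then show "(\<Prod>i\<in>UNIV. L $ i $ i) = (\<Prod>i\<in>UNIV. s i)" by simp
  qed
  moreover have "(\<Prod>i\<in>UNIV. s i) = (\<Prod>r=3..CARD('n). real r * ?c powr (- real r / 2))"
    unfolding s_def prod_rank[of "\<lambda>r. if r \<le> 2 then 1 else real r * ?c powr (- real r / 2)"]
    by (rule prod.mono_neutral_cong_right) auto
  ultimately show ?thesis
    by (simp only: det_mul det_vandermonde vdm_centre)
qed

section \<open>Directions of centred vectors\<close>

definition direction :: "real ^ 'm \<Rightarrow> real ^ 'm"
  where "direction x = centre x /\<^sub>R norm (centre x)"

text \<open>The power sums of the direction in terms of the coordinates of \<open>moment_map\<close>: the first two
  are 0 and 1 by construction.\<close>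
definition unit_slice :: "real ^ 'n::finite idx \<Rightarrow> real ^ 'n idx"
  where "unit_slice y = (\<chi> i. if rank i = 1 then 0 else if rank i = 2 then 1 else y $ i)"

lemma psum_scaleR: "psum r (c *\<^sub>R x) = c ^ r * psum r x"
  by (simp add: psum_def power_mult_distrib sum_distrib_left)

lemma psum_2_eq_norm: "psum 2 x = (norm x)\<^sup>2"
  by (simp add: psum_def power2_norm_eq_inner inner_vec_def flip: power2_eq_square)

lemma csum_2_eq_norm: "csum 2 x = (norm (centre x))\<^sup>2"
  by (simp add: csum_def psum_2_eq_norm)

lemma psum_1_centre [simp]: "psum (Suc 0) (centre x) = 0"
  using csum_1 by (simp add: csum_def)

lemma psum_direction: "psum r (direction x) = csum r x / norm (centre x) ^ r"
  by (simp add: direction_def psum_scaleR csum_def field_simps)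

lemma csum_2_powr:
  assumes "0 < csum 2 x"
  shows "csum 2 x powr (- real r / 2) = 1 / norm (centre x) ^ r"
proof -
  let ?N = "norm (centre x)"
  have N: "0 < ?N"
    using assms by (simp add: csum_2_eq_norm)
  then have "?N\<^sup>2 = ?N powr 2" by simp
  then have "csum 2 x powr (- real r / 2) = ?N powr (2 * (- real r / 2))"
    by (simp only: csum_2_eq_norm powr_powr)
  also have "\<dots> = 1 / ?N ^ r"
    using N by (simp add: powr_minus_divide powr_realpow)
  finally show ?thesis .
qed

lemma psums_direction:
  fixes x :: "real ^ 'n::finite idx"
  assumes "0 < csum 2 x"
  shows "psums (direction x) = unit_slice (moment_map x)"
proof -
  have "norm (centre x) \<noteq> 0"
    using assms by (auto simp: csum_2_eq_norm)
  moreover have "csum (rank i) x * csum 2 x powr (- real (rank i) / 2)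
      = csum (rank i) x / norm (centre x) ^ rank i" for i :: "'n idx"
    using csum_2_powr[OF assms] by simp
  ultimately show ?thesis
    unfolding vec_eq_iff psums_def unit_slice_def moment_map_def psum_direction
    by (auto simp: csum_2_eq_norm)
qed

lemma direction_in_chamber: "x \<in> chamber \<Longrightarrow> direction x \<in> chamber"
  unfolding chamber_def direction_def centre_def by (auto intro!: mult_left_mono)

lemma centre_affine:
  fixes u :: "real ^ 'm"
  assumes "psum 1 u = 0"
  shows "centre (\<chi> i. m + s * u $ i) = s *\<^sub>R u" "psum 1 (\<chi> i. m + s * u $ i) = real CARD('m) * m"
proof -
  show *: "psum 1 (\<chi> i. m + s * u $ i) = real CARD('m) * m"
    using assms by (simp add: psum_def sum.distrib flip: sum_distrib_left)
  show "centre (\<chi> i. m + s * u $ i) = s *\<^sub>R u"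
    using * by (simp add: vec_eq_iff centre_def)
qed

lemma recover_from_direction:
  fixes x :: "real ^ 'm"
  assumes "centre x \<noteq> 0"
  shows "x = (\<chi> i. psum 1 x / real CARD('m) + norm (centre x) * direction x $ i)"
proof (rule vec_eq_iff[THEN iffD2], rule allI)
  fix i
  have "norm (centre x) * direction x $ i = centre x $ i"
    using assms by (simp add: direction_def)
  then show "x $ i = (\<chi> i. psum 1 x / real CARD('m) + norm (centre x) * direction x $ i) $ i"
    by (simp add: centre_def)
qed

lemma inj_on_moment_map:
  assumes n: "2 \<le> CARD('n)"
  shows "inj_on moment_map {x :: real ^ 'n::finite idx. x \<in> chamber \<and> 0 < csum 2 x}"
proof (rule inj_onI, clarify)
  fix x y :: "real ^ 'n idx"
  assume x: "x \<in> chamber" "0 < csum 2 x" and y: "y \<in> chamber" "0 < csum 2 y"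
    and eq: "moment_map x = moment_map y"
  have "psums (direction x) = psums (direction y)"
    using eq by (simp add: psums_direction x y)
  then have dir: "direction x = direction y"
    using inj_onD[OF inj_on_psums] x y direction_in_chamber by blast
  have "psum 1 x = psum 1 y"
    using arg_cong[OF eq, of "\<lambda>v. v $ Idx 1"] n by (simp add: moment_map_def rank_Idx)
  moreover have "csum 2 x = csum 2 y"
    using arg_cong[OF eq, of "\<lambda>v. v $ Idx 2"] n by (simp add: moment_map_def rank_Idx)
  then have "norm (centre x) = norm (centre y)"
    by (simp add: csum_2_eq_norm)
  moreover have "centre x \<noteq> 0" "centre y \<noteq> 0"
    using x y by (auto simp: csum_2_eq_norm)
  ultimately show "x = y"
    using dir recover_from_direction[of x] recover_from_direction[of y] by metis
qed

text \<open>A preimage is obtained from the ordered roots by scaling to the prescribed length and shifting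
  to the prescribed mean.\<close>
lemma moment_map_image:
  assumes n: "2 \<le> CARD('n)"
  shows "moment_map ` {x :: real ^ 'n::finite idx. x \<in> chamber \<and> 0 < csum 2 x}
    = {y. 0 < y $ Idx 2 \<and> unit_slice y \<in> psums ` chamber}" (is "?A = ?B")
proof
  show "?A \<subseteq> ?B"
  proof clarify
    fix x :: "real ^ 'n idx"
    assume x: "x \<in> chamber" "0 < csum 2 x"
    have "moment_map x $ Idx 2 = csum 2 x / 2"
      using n by (simp add: moment_map_def rank_Idx)
    moreover have "unit_slice (moment_map x) \<in> psums ` chamber"
      using psums_direction[OF x(2)] direction_in_chamber[OF x(1)] by (metis imageI)
    ultimately show "0 < moment_map x $ Idx 2 \<and> unit_slice (moment_map x) \<in> psums ` chamber"
      using x by simp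
  qed
  show "?B \<subseteq> ?A"
  proof clarify
    fix y u :: "real ^ 'n idx"
    assume y: "0 < y $ Idx 2" and u: "u \<in> chamber" and eq: "unit_slice y = psums u"
    define s where "s = sqrt (2 * y $ Idx 2)"
    define x where "x = (\<chi> i. y $ Idx 1 / real CARD('n) + s * u $ i)"
    have s: "0 < s" "s\<^sup>2 = 2 * y $ Idx 2"
      using y by (simp_all add: s_def)
    have u_psum: "psum (rank i) u = unit_slice y $ i" for i
      by (simp add: eq psums_def)
    have u1: "psum 1 u = 0" and u2: "psum 2 u = 1"
      using u_psum[of "Idx 1"] u_psum[of "Idx 2"] n by (simp_all add: unit_slice_def rank_Idx)
    have x1: "psum 1 x = y $ Idx 1" and cx: "centre x = s *\<^sub>R u"
      using centre_affine[OF u1, of "y $ Idx 1 / real CARD('n)" s] by (simp_all add: x_def)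
    have csum: "csum r x = s ^ r * psum r u" for r
      by (simp add: csum_def cx psum_scaleR)
    have c2: "csum 2 x = 2 * y $ Idx 2"
      by (simp add: csum u2 s)
    have "norm u = 1"
      using u2 norm_ge_zero[of u] by (auto simp: psum_2_eq_norm power2_eq_1_iff)
    then have N: "norm (centre x) = s"
      using s by (simp add: cx)
    have pos: "0 < csum 2 x"
      using c2 y by simp
    have "x \<in> chamber"
      using u s by (auto simp: chamber_def x_def)
    moreover have "moment_map x = y"
    proof -
      have "moment_map x $ i = y $ i" for i
      proof -
        consider "rank i = 1" | "rank i = 2" | "3 \<le> rank i"
          using rank_pos[of i] by linarith
        then show ?thesis
        proof cases
          case 1
          then have "i = Idx 1" by (metis rank_inverse)
          then show ?thesis
            using 1 x1 by (simp add: moment_map_def)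
        next
          case 2
          then have "i = Idx 2" by (metis rank_inverse)
          then show ?thesis
            using 2 c2 by (simp add: moment_map_def)
        next
          case 3
          then have "moment_map x $ i = psum (rank i) u"
            using s csum_2_powr[OF pos, of "rank i"] by (simp add: moment_map_def csum N)
          also have "\<dots> = y $ i"
            using 3 by (simp add: u_psum unit_slice_def)
          finally show ?thesis .
        qed
      qed
      then show ?thesis by (simp add: vec_eq_iff)
    qed
    ultimately show "y \<in> ?A"
      using pos by blast
  qed
qed

section \<open>The Gaussian density in moment coordinates\<close>

definition gauss :: "real ^ 'm \<Rightarrow> real"
  where "gauss x = (\<Prod>i\<in>UNIV. std_normal_density (x $ i))"

lemma gauss_eq_norm: "gauss x = (1 / sqrt (2 * pi)) ^ CARD('m) * exp (- (norm x)\<^sup>2 / 2)"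
  for x :: "real ^ 'm"
proof -
  have "gauss x = (1 / sqrt (2 * pi)) ^ CARD('m) * exp (\<Sum>i\<in>UNIV. - (x $ i)\<^sup>2 / 2)"
    by (simp add: gauss_def std_normal_density_def exp_sum prod_dividef power_divide)
  also have "(\<Sum>i\<in>UNIV. - (x $ i)\<^sup>2 / 2) = - psum 2 x / 2"
    by (simp add: psum_def sum_negf flip: sum_divide_distrib)
  finally show ?thesis
    by (simp add: psum_2_eq_norm)
qed

lemma psum_2_decompose: "psum 2 x = csum 2 x + (psum 1 x)\<^sup>2 / real CARD('m)"
  for x :: "real ^ 'm"
proof -
  have "csum 2 x = (\<Sum>i\<in>UNIV. (x $ i)\<^sup>2 - 2 * (psum 1 x / real CARD('m)) * x $ i + (psum 1 x / real CARD('m))\<^sup>2)"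
    unfolding csum_def psum_def[of 2] centre_def
    by (intro sum.cong) (simp_all add: power2_diff)
  also have "\<dots> = psum 2 x - 2 * (psum 1 x / real CARD('m)) * psum 1 x
      + real CARD('m) * (psum 1 x / real CARD('m))\<^sup>2"
    by (simp add: sum.distrib sum_subtractf psum_def sum_distrib_left)
  finally show ?thesis
    by (simp add: power2_eq_square)
qed

text \<open>The Gaussian density in the new coordinates, times the power of the length that remains from
  the Jacobian determinant.\<close>
definition moment_weight :: "real ^ 'n::finite idx \<Rightarrow> real"
  where "moment_weight y = (1 / sqrt (2 * pi)) ^ CARD('n) *
    (exp (- (y $ Idx 1)\<^sup>2 / (2 * real CARD('n))) *
    (exp (- (y $ Idx 2)) * sqrt (2 * y $ Idx 2) ^ (CARD('n) - 3)))"

lemma gauss_eq_moment_weight: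
  fixes x :: "real ^ 'n::finite idx"
  assumes n: "2 \<le> CARD('n)"
  shows "moment_weight (moment_map x) = gauss x * norm (centre x) ^ (CARD('n) - 3)"
proof -
  have "moment_map x $ Idx 1 = psum 1 x" "2 * moment_map x $ Idx 2 = (norm (centre x))\<^sup>2"
    "moment_map x $ Idx 2 = csum 2 x / 2"
    using n by (simp_all add: moment_map_def rank_Idx csum_2_eq_norm)
  moreover have "gauss x = (1 / sqrt (2 * pi)) ^ CARD('n) *
      (exp (- (psum 1 x)\<^sup>2 / (2 * real CARD('n))) * exp (- (csum 2 x / 2)))"
    unfolding gauss_eq_norm psum_2_eq_norm[symmetric] psum_2_decompose
    by (simp add: add_divide_distrib flip: exp_add)
  ultimately show ?thesis
    unfolding moment_weight_def by (simp add: mult_ac)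
qed

lemma vdm_scaleR:
  fixes x :: "real ^ 'n::finite idx"
  shows "vdm (s *\<^sub>R x) = s ^ (\<Sum>r=1..CARD('n). r - 1) * vdm x"
proof -
  have "vdm (s *\<^sub>R x) = (\<Prod>j\<in>UNIV. s ^ (rank j - 1) * (\<Prod>i\<in>{..<j}. (x $ j - x $ i)))"
    unfolding vdm_def
    by (intro prod.cong refl)
      (simp add: right_diff_distrib[symmetric] prod.distrib card_lessThan_idx)
  also have "\<dots> = s ^ (\<Sum>j\<in>(UNIV :: 'n idx set). rank j - 1) * vdm x"
    by (simp add: prod.distrib vdm_def power_sum)
  also have "(\<Sum>j\<in>(UNIV :: 'n idx set). rank j - 1) = (\<Sum>r=1..CARD('n). r - 1)"
    by (rule sum_rank)
  finally show ?thesis .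
qed

text \<open>The Vandermonde product is homogeneous of degree \<open>\<Sum>r\<le>n. r - 1\<close> and the triangular factor
  contributes the exponents \<open>- r\<close> for \<open>3 \<le> r \<le> n\<close>; together they leave \<open>3 - n\<close>.\<close>
lemma det_jacobian_direction:
  fixes x :: "real ^ 'n::finite idx"
  assumes n: "3 \<le> CARD('n)" and pos: "0 < csum 2 x"
  shows "det (jacobian x) * norm (centre x) ^ (CARD('n) - 3) = fact CARD('n) / 2 * vdm (direction x)"
proof -
  let ?N = "norm (centre x)" and ?n = "CARD('n)"
  have N: "?N \<noteq> 0"
    using pos by (auto simp: csum_2_eq_norm)
  have exponents: "(\<Sum>r=1..m. r - 1) + (m - 3) = (\<Sum>r=3..m. r)" if "3 \<le> m" for m :: nat
    using that
  proof (induction m rule: dec_induct)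
    case base
    have "{1..3::nat} = {1, 2, 3}" by auto
    then show ?case by simp
  next
    case (step m)
    then show ?case by simp
  qed
  have facts: "(\<Prod>r=3..m. real r) = fact m / 2" if "3 \<le> m" for m :: nat
    using that
  proof (induction m rule: dec_induct)
    case base
    then show ?case by (simp add: fact_numeral)
  next
    case (step m)
    then show ?case by simp
  qed
  have "vdm x = ?N ^ (\<Sum>r=1..?n. r - 1) * vdm (direction x)"
    using N vdm_scaleR[of ?N "direction x"] by (simp add: direction_def vdm_centre)
  then have "det (jacobian x) * ?N ^ (?n - 3)
      = (\<Prod>r=3..?n. real r * (1 / ?N ^ r)) * ?N ^ ((\<Sum>r=1..?n. r - 1) + (?n - 3)) * vdm (direction x)"
    using n unfolding csum_2_powr[OF pos] power_add
    by (subst det_jacobian) (simp_all only: csum_2_powr[OF pos] mult_ac)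
  also have "(\<Prod>r=3..?n. real r * (1 / ?N ^ r)) = fact ?n / 2 / ?N ^ (\<Sum>r=3..?n. r)"
    using n by (simp add: facts prod_dividef power_sum)
  finally show ?thesis
    unfolding exponents[OF n] using N by simp
qed

definition strict_chamber :: "(real ^ 'n::finite idx) set"
  where "strict_chamber = {u. \<forall>i j. i < j \<longrightarrow> u $ i < u $ j}"

lemma strict_chamber_iff: "u \<in> strict_chamber \<longleftrightarrow> u \<in> chamber \<and> vdm u \<noteq> 0"
proof -
  have "vdm u \<noteq> 0 \<longleftrightarrow> (\<forall>j i. i < j \<longrightarrow> u $ j \<noteq> u $ i)"
    by (simp add: vdm_def Ball_def)
  then show ?thesis
    unfolding strict_chamber_def chamber_def
    by (simp add: less_le) (metis order_refl)
qed

lemma strict_chamber_csum_pos: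
  fixes x :: "real ^ 'n::finite idx"
  assumes "x \<in> strict_chamber" and n: "2 \<le> CARD('n)"
  shows "0 < csum 2 x"
proof -
  have "(Idx 1 :: 'n idx) < Idx 2"
    using n by (simp add: less_idx_def rank_Idx)
  then have "x $ Idx 1 < x $ Idx 2"
    using assms(1) unfolding strict_chamber_def by blast
  moreover have "x $ Idx 1 = x $ Idx 2" if "centre x = 0"
    using that by (simp add: centre_def vec_eq_iff)
  ultimately have "centre x \<noteq> 0" by auto
  then show ?thesis
    by (simp add: csum_2_eq_norm)
qed

text \<open>At points with repeated coordinates the integrand is infinite and the determinant vanishes;
  both sides are then 0, as \<open>enn2real\<close> sends infinity to 0.\<close>
lemma jacobian_cancels_density:
  fixes x :: "real ^ 'n::finite idx"
  assumes n: "3 \<le> CARD('n)" and x: "x \<in> chamber" and pos: "0 < csum 2 x"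
  shows "\<bar>det (jacobian x)\<bar> * (moment_weight (moment_map x) *
      enn2real (f_integrand CARD('n) (coords (unit_slice (moment_map x)))))
    = indicator strict_chamber x * (fact CARD('n) / 2 * gauss x)"
proof -
  let ?N = "norm (centre x)" and ?d = "direction x"
  have d: "?d \<in> chamber"
    by (rule direction_in_chamber[OF x])
  have "vdm x = ?N ^ (\<Sum>r=1..CARD('n). r - 1) * vdm ?d"
    using pos vdm_scaleR[of ?N ?d] by (simp add: direction_def vdm_centre csum_2_eq_norm)
  then have strict: "x \<in> strict_chamber \<longleftrightarrow> vdm ?d \<noteq> 0"
    using pos x by (auto simp: strict_chamber_iff csum_2_eq_norm)
  have f: "f_integrand CARD('n) (coords (unit_slice (moment_map x))) = 1 / ennreal (vdm ?d)"
    using f_integrand_psums[OF d] psums_direction[OF pos] by simp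
  have det: "\<bar>det (jacobian x)\<bar> * ?N ^ (CARD('n) - 3) = fact CARD('n) / 2 * vdm ?d"
    using arg_cong[OF det_jacobian_direction[OF n pos], of abs] vdm_nonneg[OF d]
    by (simp add: abs_mult)
  have weight: "\<bar>det (jacobian x)\<bar> * (moment_weight (moment_map x) * z)
      = fact CARD('n) / 2 * vdm ?d * (gauss x * z)" for z
    unfolding det[symmetric] using n by (simp add: gauss_eq_moment_weight mult_ac)
  have "enn2real (1 / ennreal (vdm ?d)) = 1 / vdm ?d" if "vdm ?d \<noteq> 0"
  proof -
    have "0 < vdm ?d"
      using that vdm_nonneg[OF d] by simp
    then have "1 / ennreal (vdm ?d) = ennreal (1 / vdm ?d)"
      using divide_ennreal[of 1 "vdm ?d"] by simp
    then show ?thesis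
      using \<open>0 < vdm ?d\<close> by simp
  qed
  then show ?thesis
    unfolding f weight using strict by (cases "vdm ?d = 0") auto
qed

section \<open>The law of the moments under the Gaussian density\<close>

lemma borel_measurable_psum [measurable]: "psum r \<in> borel_measurable borel"
  by (intro borel_measurable_continuous_onI continuous_on_psum)

lemma borel_measurable_centre [measurable]: "centre \<in> borel_measurable borel"
  unfolding centre_def by measurable

lemma borel_measurable_csum [measurable]: "csum r \<in> borel_measurable borel"
  unfolding csum_def by measurable

lemma borel_measurable_direction [measurable]: "direction \<in> borel_measurable borel"
  unfolding direction_def by measurable

lemma borel_measurable_gauss [measurable]: "gauss \<in> borel_measurable borel"
  unfolding gauss_def by measurable

lemma borel_measurable_moment_map [measurable]: "moment_map \<in> borel_measurable borel"
  unfolding moment_map_def by measurable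

lemma borel_measurable_moment_weight [measurable]: "moment_weight \<in> borel_measurable borel"
  unfolding moment_weight_def by measurable

lemma borel_measurable_unit_slice [measurable]: "unit_slice \<in> borel_measurable borel"
  unfolding unit_slice_def by measurable

lemma borel_measurable_vdm [measurable]: "vdm \<in> borel_measurable borel"
  by (intro borel_measurable_continuous_onI continuous_on_vdm)

lemma sets_chamber [measurable]: "chamber \<in> sets borel"
  by (intro borel_closed closed_chamber)

lemma sets_strict_chamber [measurable]: "strict_chamber \<in> sets borel"
proof -
  have "strict_chamber = {x. x \<in> chamber \<and> vdm x \<noteq> 0}"
    by (auto simp: strict_chamber_iff)
  also have "\<dots> \<in> sets borel" by measurable
  finally show ?thesis .
qed

lemma gauss_nonneg [simp]: "0 \<le> gauss x"
  by (simp add: gauss_def prod_nonneg)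

lemma moment_weight_nonneg: "0 \<le> y $ Idx 2 \<Longrightarrow> 0 \<le> moment_weight y"
  by (simp add: moment_weight_def)

text \<open>The change of variables is carried out on the closed chamber.  The points where the integrand
  is infinite are images of points where the determinant vanishes, so the same change of variables
  shows that they form a null set.\<close>
lemma nn_integral_strict_chamber:
  fixes G :: "real ^ 'n::finite idx \<Rightarrow> real"
  assumes n: "3 \<le> CARD('n)" and G [measurable]: "G \<in> borel_measurable borel" and G_nonneg: "\<And>y. 0 \<le> G y"
  shows "(\<integral>\<^sup>+x. ennreal (indicator strict_chamber x * (fact CARD('n) / 2 * gauss x) * G (moment_map x)) \<partial>lborel)
    = (\<integral>\<^sup>+y. indicator {y. 0 < y $ Idx 2} y * ennreal (moment_weight y * G y) *
        f_integrand CARD('n) (coords (unit_slice y)) \<partial>lborel)"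
proof -
  let ?S = "{x :: real ^ 'n idx. x \<in> chamber \<and> 0 < csum 2 x}"
  define \<phi> where "\<phi> y = f_integrand CARD('n) (coords (unit_slice y))" for y :: "real ^ 'n idx"
  have [measurable]: "\<phi> \<in> borel_measurable borel"
    unfolding \<phi>_def by (rule measurable_compose[OF borel_measurable_unit_slice borel_measurable_f_integrand])
  have n2: "2 \<le> CARD('n)" using n by simp
  have S: "?S \<in> sets borel" by measurable
  have [measurable]: "psums ` (chamber :: (real ^ 'n idx) set) \<in> sets borel"
    by (intro continuous_image_closed_borel closed_chamber continuous_on_psums)
  have image: "moment_map ` ?S \<in> sets borel"
    unfolding moment_map_image[OF n2] by measurable
  have cov: "(\<integral>\<^sup>+x. ennreal (indicator ?S x * (\<bar>det (jacobian x)\<bar> * f (moment_map x))) \<partial>lborel)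
      = (\<integral>\<^sup>+y. ennreal (indicator (moment_map ` ?S) y * f y) \<partial>lborel)"
    if f [measurable]: "f \<in> borel_measurable borel" and nonneg: "\<And>y. 0 \<le> f y" for f
  proof -
    have meas: "(\<lambda>x. indicator ?S x * (\<bar>det (matrix ((*v) (jacobian x)))\<bar> * f (moment_map x))) \<in> borel_measurable borel"
      unfolding matrix_of_matrix_vector_mul det_jacobian[OF n2] using S by measurable
    have der: "(moment_map has_derivative (*v) (jacobian x)) (at x within ?S)" if "x \<in> ?S" for x
      using that by (intro has_derivative_at_withinI[OF has_derivative_moment_map]) simp
    show ?thesis
      by (rule nn_integral_change_of_variables[OF S image der inj_on_moment_map[OF n2] f nonneg meas,
          unfolded matrix_of_matrix_vector_mul])
  qed
  define f where "f y = (if 0 < y $ Idx 2 then moment_weight y * enn2real (\<phi> y) * G y else 0)" for y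
  have f_meas: "f \<in> borel_measurable borel"
    unfolding f_def by measurable
  have f_nonneg: "0 \<le> f y" for y
    by (simp add: f_def moment_weight_nonneg G_nonneg)
  have slice: "unit_slice y \<in> psums ` chamber" if "\<phi> y \<noteq> 0" for y
    using that f_integrand_eq_0[of "unit_slice y"] by (auto simp: \<phi>_def)
  (* The change of variables requires a real-valued integrand; f agrees with the extended one off
     this null set. *)
  have "AE y in lborel. 0 < y $ Idx 2 \<longrightarrow> \<phi> y \<noteq> \<infinity>"
  proof -
    let ?Z = "{y. 0 < y $ Idx 2 \<and> \<phi> y = \<infinity>}"
    have "\<bar>det (jacobian x)\<bar> * indicator ?Z (moment_map x) = 0" if x: "x \<in> ?S" for x
    proof (cases "\<phi> (moment_map x) = \<infinity>")
      case True
      then have "1 / ennreal (vdm (direction x)) = \<infinity>"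
        using x f_integrand_psums[OF direction_in_chamber, of x] by (simp add: \<phi>_def flip: psums_direction)
      then have "vdm (direction x) = 0"
        using x vdm_nonneg[OF direction_in_chamber, of x]
        by (auto simp: ennreal_divide_eq_top_iff ennreal_eq_0_iff)
      then have "det (jacobian x) * norm (centre x) ^ (CARD('n) - 3) = 0"
        using x det_jacobian_direction[OF n, of x] by simp
      then show ?thesis
        using x by (auto simp: csum_2_eq_norm)
    qed (simp add: indicator_def)
    then have zero: "indicator ?S x * (\<bar>det (jacobian x)\<bar> * indicator ?Z (moment_map x)) = 0" for x
      by (cases "x \<in> ?S") auto
    have "(\<integral>\<^sup>+y. ennreal (indicator (moment_map ` ?S) y * indicator ?Z y) \<partial>lborel)
        = (\<integral>\<^sup>+x. ennreal (indicator ?S x * (\<bar>det (jacobian x)\<bar> * indicator ?Z (moment_map x))) \<partial>lborel)"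
      by (rule cov[symmetric]) simp_all
    also have "\<dots> = 0"
      unfolding zero by simp
    finally have "(\<integral>\<^sup>+y. ennreal (indicator (moment_map ` ?S) y * indicator ?Z y) \<partial>lborel) = 0" .
    also have "(\<lambda>y. ennreal (indicator (moment_map ` ?S) y * indicator ?Z y)) = indicator ?Z"
      using slice unfolding moment_map_image[OF n2] by (auto simp: fun_eq_iff indicator_def)
    finally have "?Z \<in> null_sets lborel"
      by (simp add: null_sets_def)
    then show ?thesis
      by (rule AE_I') auto
  qed
  then have AE: "AE y in lborel. ennreal (indicator (moment_map ` ?S) y * f y)
    = indicator {y. 0 < y $ Idx 2} y * ennreal (moment_weight y * G y) * \<phi> y"
  proof eventually_elim
    case (elim y)
    show ?case
    proof (cases "0 < y $ Idx 2 \<and> \<phi> y \<noteq> 0")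
      case True
      then have "ennreal (moment_weight y * enn2real (\<phi> y) * G y)
          = ennreal (moment_weight y * G y) * ennreal (enn2real (\<phi> y))"
        using moment_weight_nonneg[of y] G_nonneg[of y]
        by (subst ennreal_mult[symmetric]) (auto simp: mult_ac)
      also have "ennreal (enn2real (\<phi> y)) = \<phi> y"
        using True elim by (simp add: ennreal_enn2real less_top)
      finally show ?thesis
        using True slice unfolding moment_map_image[OF n2] f_def by simp
    qed (auto simp: f_def)
  qed
  have "(\<integral>\<^sup>+x. ennreal (indicator strict_chamber x * (fact CARD('n) / 2 * gauss x) * G (moment_map x)) \<partial>lborel)
    = (\<integral>\<^sup>+x. ennreal (indicator ?S x * (\<bar>det (jacobian x)\<bar> * f (moment_map x))) \<partial>lborel)"
  proof (intro nn_integral_cong arg_cong[where f = ennreal])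
    fix x :: "real ^ 'n idx"
    show "indicator strict_chamber x * (fact CARD('n) / 2 * gauss x) * G (moment_map x) = indicator ?S x * (\<bar>det (jacobian x)\<bar> * f (moment_map x))"
    proof (cases "x \<in> ?S")
      case True
      then have "0 < moment_map x $ Idx 2"
        using n by (simp add: moment_map_def rank_Idx)
      then have f: "f (moment_map x) = moment_weight (moment_map x) * enn2real (\<phi> (moment_map x)) * G (moment_map x)"
        by (simp only: f_def if_True)
      have "\<bar>det (jacobian x)\<bar> * (moment_weight (moment_map x) * enn2real (\<phi> (moment_map x)))
          = indicator strict_chamber x * (fact CARD('n) / 2 * gauss x)"
        unfolding \<phi>_def using True by (intro jacobian_cancels_density[OF n]) simp_all
      then have "indicator strict_chamber x * (fact CARD('n) / 2 * gauss x) * G (moment_map x)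
          = \<bar>det (jacobian x)\<bar> * f (moment_map x)"
        unfolding f by (simp only: mult.assoc[symmetric])
      then show ?thesis
        by (simp only: indicator_simps(1)[OF True] mult_1_left)
    next
      case False
      have "x \<in> ?S" if "x \<in> strict_chamber"
        using that strict_chamber_csum_pos[OF that n2] by (simp add: strict_chamber_iff)
      with False have "x \<notin> strict_chamber" by blast
      with False show ?thesis
        by (simp only: indicator_simps(2) mult_zero_left not_False_eq_True)
    qed
  qed
  also have "\<dots> = (\<integral>\<^sup>+y. ennreal (indicator (moment_map ` ?S) y * f y) \<partial>lborel)"
    by (rule cov[OF f_meas f_nonneg])
  also have "\<dots> = (\<integral>\<^sup>+y. indicator {y. 0 < y $ Idx 2} y * ennreal (moment_weight y * G y) * \<phi> y \<partial>lborel)"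
    by (rule nn_integral_cong_AE[OF AE])
  finally show ?thesis
    unfolding \<phi>_def .
qed

section \<open>Invariance of Lebesgue measure under rotations\<close>

lemma emeasure_lebesgue_borel:
  assumes "A \<in> sets borel"
  shows "emeasure lebesgue A = emeasure lborel A"
proof -
  have A: "A \<in> sets lborel"
    using assms by (simp only: sets_lborel)
  have "split_completion lborel A = (\<lambda>p. p = (A, {}))"
    unfolding split_completion_def[abs_def] if_P[OF A] ..
  then have main: "main_part lborel A = A"
    unfolding main_part_def by simp
  show ?thesis
    unfolding emeasure_completion[OF sets_completionI_sets[OF A]] main ..
qed

lemma emeasure_lborel_orthogonal_image:
  fixes Q :: "real ^ 'm::{finite,wellorder} \<Rightarrow> real ^ 'm::_"
  assumes Q: "orthogonal_transformation Q" and B: "B \<in> lmeasurable" "B \<in> sets borel" "Q ` B \<in> sets borel"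
  shows "emeasure lborel (Q ` B) = emeasure lborel B"
proof -
  have 1: "Q ` B \<in> lmeasurable" by (rule measurable_orthogonal_image[OF Q B(1)])
  have 2: "measure lebesgue (Q ` B) = measure lebesgue B" by (rule measure_orthogonal_image[OF Q B(1)])
  have "emeasure lebesgue (Q ` B) = emeasure lebesgue B"
    unfolding emeasure_eq_measure2[OF 1] emeasure_eq_measure2[OF B(1)] 2 by (rule refl)
  then show ?thesis
    unfolding emeasure_lebesgue_borel[OF B(2)] emeasure_lebesgue_borel[OF B(3)] .
qed

lemma distr_lborel_orthogonal:
  fixes Q :: "real ^ 'm::{finite,wellorder} \<Rightarrow> real ^ 'm::_"
  assumes Q: "orthogonal_transformation Q"
  shows "distr lborel borel Q = lborel"
proof (rule lborel_eqI[symmetric])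
  have Q_meas: "Q \<in> borel_measurable borel"
    using orthogonal_transformation_linear[OF Q]
    by (intro borel_measurable_continuous_onI linear_continuous_on) (simp only: linear_conv_bounded_linear)
  fix l u :: "real ^ 'm::_"
  assume le: "\<And>b. b \<in> Basis \<Longrightarrow> l \<bullet> b \<le> u \<bullet> b"
  let ?B = "box l u"
  have vimage: "Q -` ?B = inv Q ` ?B"
    by (rule bij_vimage_eq_inv_image[OF orthogonal_transformation_bij[OF Q]])
  have "Q -` ?B \<in> sets borel"
    by (rule measurable_sets_borel[OF Q_meas borel_open[OF open_box]])
  then have borel: "inv Q ` ?B \<in> sets borel"
    unfolding vimage .
  have "emeasure (distr lborel borel Q) ?B = emeasure lborel (inv Q ` ?B)"
    using Q_meas by (subst emeasure_distr) (simp_all add: vimage)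
  moreover have "emeasure lborel (inv Q ` ?B) = emeasure lborel ?B"
    by (rule emeasure_lborel_orthogonal_image[OF orthogonal_transformation_inv[OF Q] lmeasurable_box _ borel]) simp
  moreover have "emeasure lborel ?B = (\<Prod>b\<in>Basis. (u - l) \<bullet> b)"
    by (rule emeasure_lborel_box[OF le])
  ultimately show "emeasure (distr lborel borel Q) ?B = (\<Prod>b\<in>Basis. (u - l) \<bullet> b)"
    by (simp only:)
qed simp

section \<open>Symmetry under permutations of the coordinates\<close>

definition permute :: "('m \<Rightarrow> 'm) \<Rightarrow> real ^ 'm \<Rightarrow> real ^ 'm"
  where "permute \<sigma> x = (\<chi> i. x $ \<sigma> i)"

lemma orthogonal_transformation_permute:
  assumes "\<sigma> permutes UNIV"
  shows "orthogonal_transformation (permute \<sigma> :: real ^ 'm \<Rightarrow> _)"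
proof -
  have "permute \<sigma> v \<bullet> permute \<sigma> w = v \<bullet> w" for v w :: "real ^ 'm"
    unfolding inner_vec_def permute_def vec_lambda_beta
    by (rule sum.permute[OF assms, symmetric, unfolded comp_def])
  moreover have "linear (permute \<sigma>)"
    by (rule linearI) (simp_all add: permute_def vec_eq_iff)
  ultimately show ?thesis
    by (simp add: orthogonal_transformation_def)
qed

lemma psum_permute:
  assumes "\<sigma> permutes UNIV"
  shows "psum r (permute \<sigma> x) = psum r x"
  unfolding psum_def permute_def vec_lambda_beta
  by (rule sum.permute[OF assms, symmetric, unfolded comp_def])

lemma csum_permute:
  assumes "\<sigma> permutes UNIV"
  shows "csum r (permute \<sigma> x) = csum r x"
proof -
  have "centre (permute \<sigma> x) = permute \<sigma> (centre x)"
    unfolding centre_def psum_permute[OF assms] by (simp add: permute_def vec_eq_iff)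
  then show ?thesis
    by (simp add: csum_def psum_permute[OF assms])
qed

lemma moment_map_permute: "\<sigma> permutes UNIV \<Longrightarrow> moment_map (permute \<sigma> x) = moment_map x"
  by (simp only: moment_map_def csum_permute psum_permute)

lemma gauss_permute: "\<sigma> permutes UNIV \<Longrightarrow> gauss (permute \<sigma> x) = gauss x"
  by (simp add: gauss_eq_norm psum_permute flip: psum_2_eq_norm)

text \<open>Existence is sorting.  Two permutations that both sort \<open>x\<close> give the same vector, because the
  power sums are symmetric and determine an increasing vector.\<close>
lemma unique_ordering_permutation:
  fixes x :: "real ^ 'n::finite idx"
  assumes "inj (($) x)"
  shows "\<exists>!\<sigma>. \<sigma> permutes UNIV \<and> permute \<sigma> x \<in> strict_chamber"
proof (rule ex_ex1I)
  define l where "l = sorted_list_of_set (range (($) x))"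
  have len: "length l = CARD('n)"
    using card_image[OF assms] by (simp add: l_def)
  have set: "set l = range (($) x)"
    by (simp add: l_def)
  have strict: "sorted_wrt (<) l"
    by (simp add: l_def)
  (* The i-th smallest coordinate of x sits at position \<sigma> i. *)
  define \<sigma> where "\<sigma> i = inv (($) x) (l ! (rank i - 1))" for i :: "'n idx"
  have \<sigma>: "x $ \<sigma> i = l ! (rank i - 1)" for i
  proof -
    have "l ! (rank i - 1) \<in> range (($) x)"
      using pred_rank_less[of i] len by (simp flip: set)
    then show ?thesis
      unfolding \<sigma>_def by (rule f_inv_into_f)
  qed
  have mem: "permute \<sigma> x \<in> strict_chamber"
  proof -
    have "l ! (rank i - 1) < l ! (rank j - 1)" if "i < j" for i j :: "'n idx"
    proof (rule sorted_wrt_nth_less[OF strict])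
      show "rank i - 1 < rank j - 1"
        using that rank_pos[of i] unfolding less_idx_def by linarith
      show "rank j - 1 < length l"
        using pred_rank_less[of j] len by simp
    qed
    then show ?thesis
      unfolding strict_chamber_def permute_def mem_Collect_eq vec_lambda_beta \<sigma> by blast
  qed
  have "inj \<sigma>"
  proof (rule injI, rule ccontr)
    fix i j
    assume eq: "\<sigma> i = \<sigma> j" and "i \<noteq> j"
    then have "i < j \<or> j < i" by (simp add: neq_iff)
    with mem have "x $ \<sigma> i \<noteq> x $ \<sigma> j"
      unfolding strict_chamber_def permute_def mem_Collect_eq vec_lambda_beta by fastforce
    with eq show False by simp
  qed
  then have "\<sigma> permutes UNIV"
    by (intro bij_imp_permutes) (auto simp: bij_def finite_UNIV_inj_surj)
  with mem show "\<exists>\<sigma>. \<sigma> permutes UNIV \<and> permute \<sigma> x \<in> strict_chamber"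
    by blast
next
  fix \<sigma> \<tau> :: "'n idx \<Rightarrow> 'n idx"
  assume \<sigma>: "\<sigma> permutes UNIV \<and> permute \<sigma> x \<in> strict_chamber"
    and \<tau>: "\<tau> permutes UNIV \<and> permute \<tau> x \<in> strict_chamber"
  have "psums (permute \<sigma> x) = psums (permute \<tau> x)"
    using \<sigma> \<tau> by (simp add: psums_def psum_permute)
  moreover have "permute \<sigma> x \<in> chamber" "permute \<tau> x \<in> chamber"
    using \<sigma> \<tau> by (simp_all add: strict_chamber_iff)
  ultimately have "permute \<sigma> x = permute \<tau> x"
    by (rule inj_onD[OF inj_on_psums])
  then have "x $ \<sigma> i = x $ \<tau> i" for i
    by (simp add: permute_def vec_eq_iff)
  then show "\<sigma> = \<tau>"
    using assms by (intro ext) (simp add: inj_eq)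
qed

lemma AE_inj_coordinates: "AE x in lborel. inj (($) (x :: real ^ 'm))"
proof -
  have hyperplane: "AE x :: real ^ 'm in lborel. x $ i \<noteq> x $ j" if "i \<noteq> j" for i j :: 'm
  proof -
    let ?H = "{x :: real ^ 'm. (axis i 1 - axis j 1) \<bullet> x = 0}"
    have "(axis i 1 - axis j 1 :: real ^ 'm) \<noteq> 0"
      using that by (simp add: axis_eq_axis)
    then have "negligible ?H"
      by (intro negligible_hyperplane) simp
    moreover have "?H \<in> sets lborel"
      by (simp add: closed_hyperplane borel_closed)
    ultimately have "?H \<in> null_sets lborel"
      by (simp add: negligible_iff_null_sets null_sets_completion_iff)
    then show ?thesis
      by (rule AE_I') (auto simp: inner_diff_left inner_axis')
  qed
  have "AE x :: real ^ 'm in lborel. \<forall>i j :: 'm. i \<noteq> j \<longrightarrow> x $ i \<noteq> x $ j"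
    using hyperplane by (auto simp: AE_all_countable)
  then show ?thesis
    by eventually_elim (auto simp: inj_def)
qed

text \<open>Almost every point has distinct coordinates and is therefore moved into the open chamber by
  exactly one of the \<open>n!\<close> permutations.\<close>
lemma nn_integral_symmetrize:
  fixes H :: "real ^ 'n::finite idx \<Rightarrow> ennreal"
  assumes H [measurable]: "H \<in> borel_measurable borel"
    and sym: "\<And>\<sigma> x. \<sigma> permutes UNIV \<Longrightarrow> H (permute \<sigma> x) = H x"
  shows "(\<integral>\<^sup>+x. H x \<partial>lborel) = fact CARD('n) * (\<integral>\<^sup>+x. indicator strict_chamber x * H x \<partial>lborel)"
proof -
  let ?P = "{\<sigma> :: 'n idx \<Rightarrow> 'n idx. \<sigma> permutes UNIV}"
  let ?F = "\<lambda>x. indicator strict_chamber x * H x"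
  have fin: "finite ?P"
    by (simp add: finite_permutations)
  have meas: "permute \<sigma> \<in> borel_measurable borel" for \<sigma> :: "'n idx \<Rightarrow> 'n idx"
    unfolding permute_def by measurable
  have F [measurable]: "?F \<in> borel_measurable borel" by measurable
  have "AE x in lborel. H x = (\<Sum>\<sigma>\<in>?P. ?F (permute \<sigma> x))"
    using AE_inj_coordinates
  proof eventually_elim
    case (elim x)
    obtain \<sigma> where \<sigma>: "\<sigma> \<in> ?P" "permute \<sigma> x \<in> strict_chamber"
      and uniq: "\<And>\<tau>. \<tau> \<in> ?P \<Longrightarrow> permute \<tau> x \<in> strict_chamber \<Longrightarrow> \<tau> = \<sigma>"
      using unique_ordering_permutation[OF elim] by blast
    have "(\<Sum>\<tau>\<in>?P. ?F (permute \<tau> x)) = (\<Sum>\<tau>\<in>?P. if \<tau> = \<sigma> then H x else 0)"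
    proof (rule sum.cong)
      fix \<tau> assume \<tau>: "\<tau> \<in> ?P"
      show "?F (permute \<tau> x) = (if \<tau> = \<sigma> then H x else 0)"
      proof (cases "\<tau> = \<sigma>")
        case True
        have "H (permute \<sigma> x) = H x"
          using \<sigma>(1) by (intro sym) blast
        with True show ?thesis
          by (simp add: \<sigma>(2))
      next
        case False
        with uniq[OF \<tau>] have "permute \<tau> x \<notin> strict_chamber" by blast
        then show ?thesis
          by (simp only: False indicator_simps(2) mult_zero_left if_False not_False_eq_True)
      qed
    qed simp
    also have "\<dots> = H x"
      using \<sigma>(1) fin by simp
    finally show ?case by simp
  qed
  then have "(\<integral>\<^sup>+x. H x \<partial>lborel) = (\<integral>\<^sup>+x. (\<Sum>\<sigma>\<in>?P. ?F (permute \<sigma> x)) \<partial>lborel)"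
    by (rule nn_integral_cong_AE)
  also have "\<dots> = (\<Sum>\<sigma>\<in>?P. \<integral>\<^sup>+x. ?F (permute \<sigma> x) \<partial>lborel)"
  proof (rule nn_integral_sum)
    fix \<sigma>
    show "(\<lambda>x. ?F (permute \<sigma> x)) \<in> borel_measurable lborel"
      using measurable_compose[OF meas F] by simp
  qed
  also have "\<dots> = (\<Sum>\<sigma>\<in>?P. \<integral>\<^sup>+x. ?F x \<partial>lborel)"
  proof (rule sum.cong[OF refl])
    fix \<sigma> :: "'n idx \<Rightarrow> 'n idx" assume "\<sigma> \<in> ?P"
    then have distr: "distr lborel borel (permute \<sigma>) = (lborel :: (real ^ 'n idx) measure)"
      by (intro distr_lborel_orthogonal orthogonal_transformation_permute) simp
    have "(\<integral>\<^sup>+x. ?F (permute \<sigma> x) \<partial>lborel) = (\<integral>\<^sup>+x. ?F x \<partial>distr lborel borel (permute \<sigma>))"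
      by (rule nn_integral_distr[symmetric]) (use meas F in simp_all)
    then show "(\<integral>\<^sup>+x. ?F (permute \<sigma> x) \<partial>lborel) = (\<integral>\<^sup>+x. ?F x \<partial>lborel)"
      unfolding distr .
  qed
  also have "\<dots> = fact CARD('n) * (\<integral>\<^sup>+x. ?F x \<partial>lborel)"
    using card_permutations[of "UNIV :: 'n idx set" "CARD('n)"] by simp
  finally show ?thesis .
qed

lemma nn_integral_gauss_moments:
  fixes G :: "real ^ 'n::finite idx \<Rightarrow> real"
  assumes n: "3 \<le> CARD('n)" and G [measurable]: "G \<in> borel_measurable borel" and G_nonneg: "\<And>y. 0 \<le> G y"
  shows "(\<integral>\<^sup>+x. ennreal (gauss x * G (moment_map x)) \<partial>lborel)
    = 2 * (\<integral>\<^sup>+y. indicator {y. 0 < y $ Idx 2} y * ennreal (moment_weight y * G y) *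
        f_integrand CARD('n) (coords (unit_slice y)) \<partial>lborel)"
proof -
  let ?H = "\<lambda>x :: real ^ 'n idx. ennreal (gauss x * G (moment_map x))"
  let ?I = "\<integral>\<^sup>+x. indicator strict_chamber x * ?H x \<partial>lborel"
  have c: "(0 :: real) \<le> fact CARD('n) / 2" by simp
  have "(\<integral>\<^sup>+x. ennreal (indicator strict_chamber x * (fact CARD('n) / 2 * gauss x) * G (moment_map x)) \<partial>lborel)
      = (\<integral>\<^sup>+x. ennreal (fact CARD('n) / 2) * (indicator strict_chamber x * ?H x) \<partial>lborel)"
  proof (rule nn_integral_cong)
    fix x :: "real ^ 'n idx"
    have "indicator strict_chamber x * (fact CARD('n) / 2 * gauss x) * G (moment_map x)
        = fact CARD('n) / 2 * (indicator strict_chamber x * (gauss x * G (moment_map x)))"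
      by simp
    also have "ennreal \<dots> = ennreal (fact CARD('n) / 2) * (ennreal (indicator strict_chamber x) * ?H x)"
      using G_nonneg by (simp only: ennreal_mult'[OF c] ennreal_mult'[OF indicator_pos_le])
    finally show "ennreal (indicator strict_chamber x * (fact CARD('n) / 2 * gauss x) * G (moment_map x))
        = ennreal (fact CARD('n) / 2) * (indicator strict_chamber x * ?H x)"
      by (simp add: ennreal_indicator)
  qed
  also have "\<dots> = ennreal (fact CARD('n) / 2) * ?I"
    by (rule nn_integral_cmult) measurable
  finally have I: "ennreal (fact CARD('n) / 2) * ?I = (\<integral>\<^sup>+y. indicator {y. 0 < y $ Idx 2} y *
      ennreal (moment_weight y * G y) * f_integrand CARD('n) (coords (unit_slice y)) \<partial>lborel)"
    by (simp only: nn_integral_strict_chamber[OF n G G_nonneg])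
  have "(\<integral>\<^sup>+x. ?H x \<partial>lborel) = fact CARD('n) * ?I"
    by (rule nn_integral_symmetrize) (measurable, simp add: moment_map_permute gauss_permute)
  also have "(fact CARD('n) :: ennreal) = 2 * ennreal (fact CARD('n) / 2)"
  proof -
    have "2 * ennreal (fact CARD('n) / 2) = ennreal (2 * (fact CARD('n) / 2))"
      by (subst ennreal_mult) simp_all
    also have "\<dots> = ennreal (real (fact CARD('n)))"
      by simp
    also have "\<dots> = of_nat (fact CARD('n))"
      by (rule ennreal_of_nat_eq_real_of_nat[symmetric])
    finally show ?thesis by simp
  qed
  finally show ?thesis
    unfolding I[symmetric] by (simp only: mult.assoc)
qed

section \<open>Iterated integrals and the normalising constant\<close>

text \<open>The general index set allows both the splitting into the coordinates \<open>1, \<dots>, n\<close> and the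
  comparison with samples indexed by another type.\<close>
lemma lborel_vec_eq_PiM:
  assumes e: "bij_betw e (UNIV :: 'i::finite set) I"
  shows "(lborel :: (real ^ 'i) measure) = distr (Pi\<^sub>M I (\<lambda>_. lborel)) borel (\<lambda>f. \<chi> i. f (e i))"
proof (rule lborel_eqI)
  interpret product_sigma_finite "\<lambda>_ :: 'b. lborel :: real measure" ..
  have fin: "finite I"
    using bij_betw_finite[OF e] by simp
  have eI: "e i \<in> I" for i
    using e by (auto simp: bij_betw_def)
  have meas: "(\<lambda>f. \<chi> i. f (e i)) \<in> Pi\<^sub>M I (\<lambda>_. lborel) \<rightarrow>\<^sub>M (borel :: (real ^ 'i) measure)"
    using eI by (intro borel_measurable_vec_lambda) (simp add: measurable_component_singleton)
  define d where "d = inv_into UNIV e"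
  have de: "d (e i) = i" for i
    using e by (simp add: d_def bij_betw_def inv_into_f_f)
  have ed: "e (d k) = k" if "k \<in> I" for k
    using e that by (simp add: d_def bij_betw_def f_inv_into_f)
  fix l u :: "real ^ 'i"
  assume le: "\<And>b. b \<in> Basis \<Longrightarrow> l \<bullet> b \<le> u \<bullet> b"
  have le': "l $ i \<le> u $ i" for i
    using le[of "axis i 1"] by (simp add: inner_axis axis_in_Basis_iff)
  have vimage: "(\<lambda>f. \<chi> i. f (e i)) -` box l u \<inter> space (Pi\<^sub>M I (\<lambda>_. lborel)) = (\<Pi>\<^sub>E k\<in>I. {l $ d k <..< u $ d k})"
    (is "?L = ?R")
  proof (intro set_eqI iffI)
    fix f assume "f \<in> ?L"
    then have f: "f \<in> extensional I" "\<And>i. l $ i < f (e i) \<and> f (e i) < u $ i"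
      by (auto simp: space_PiM PiE_def mem_box_cart)
    have "l $ d k < f k \<and> f k < u $ d k" if "k \<in> I" for k
      using f(2)[of "d k"] ed[OF that] by simp
    with f(1) show "f \<in> ?R"
      by (simp add: PiE_iff)
  next
    fix f assume f: "f \<in> ?R"
    then show "f \<in> ?L"
    proof -
      have "l $ i < f (e i) \<and> f (e i) < u $ i" for i
        using f eI[of i] de[of i] by (auto simp: PiE_iff)
      with f show ?thesis
        by (simp add: space_PiM PiE_iff mem_box_cart)
    qed
  qed
  have "emeasure (distr (Pi\<^sub>M I (\<lambda>_. lborel)) borel (\<lambda>f. \<chi> i. f (e i))) (box l u)
      = emeasure (Pi\<^sub>M I (\<lambda>_. lborel)) (\<Pi>\<^sub>E k\<in>I. {l $ d k <..< u $ d k})"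
    by (subst emeasure_distr[OF meas]) (simp_all add: vimage)
  also have "\<dots> = (\<Prod>k\<in>I. emeasure lborel {l $ d k <..< u $ d k})"
    by (rule emeasure_PiM[OF fin]) simp
  also have "\<dots> = (\<Prod>i\<in>UNIV. emeasure lborel {l $ i <..< u $ i})"
    by (subst prod.reindex_bij_betw[OF e, symmetric]) (simp add: de)
  also have "\<dots> = (\<Prod>i\<in>UNIV. ennreal (u $ i - l $ i))"
    using le' by simp
  also have "\<dots> = ennreal (\<Prod>i\<in>UNIV. u $ i - l $ i)"
    using le' by (intro prod_ennreal) simp
  also have "(\<Prod>i\<in>UNIV. u $ i - l $ i) = (\<Prod>b\<in>Basis. (u - l) \<bullet> b)"
  proof -
    have bij: "bij_betw (\<lambda>i. axis i 1) (UNIV :: 'i set) (Basis :: (real ^ 'i) set)"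
      by (auto simp: bij_betw_def inj_on_def axis_eq_axis Basis_vec_def)
    have "(\<Prod>i\<in>UNIV. (u - l) \<bullet> axis i 1) = (\<Prod>b\<in>Basis. (u - l) \<bullet> b)"
      by (rule prod.reindex_bij_betw[OF bij])
    then show ?thesis
      by (simp add: inner_axis)
  qed
  finally show "emeasure (distr (Pi\<^sub>M I (\<lambda>_. lborel)) borel (\<lambda>f. \<chi> i. f (e i))) (box l u)
      = ennreal (\<Prod>b\<in>Basis. (u - l) \<bullet> b)" .
qed simp

lemma measurable_lborel_component:
  "k \<in> I \<Longrightarrow> (\<lambda>f. f k) \<in> borel_measurable (Pi\<^sub>M I (\<lambda>_. lborel :: real measure))"
  using measurable_component_singleton[of k I "\<lambda>_. lborel :: real measure"] by simp

text \<open>The first two coordinates are to be integrated out, the next two carry the density and the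
  remaining ones form the inner integral.\<close>
lemma nn_integral_lborel_iterated:
  fixes F :: "real ^ 'n::finite idx \<Rightarrow> ennreal"
  assumes n: "4 \<le> CARD('n)" and F [measurable]: "F \<in> borel_measurable borel"
  shows "(\<integral>\<^sup>+y. F y \<partial>lborel) = (\<integral>\<^sup>+c. \<integral>\<^sup>+t. \<integral>\<^sup>+a. \<integral>\<^sup>+b. \<integral>\<^sup>+q.
    F (\<chi> i. (q(1 := c, 2 := t, 3 := a, 4 := b)) (rank i))
      \<partial>(\<Pi>\<^sub>M r\<in>{5..CARD('n)}. lborel) \<partial>lborel \<partial>lborel \<partial>lborel \<partial>lborel)"
proof -
  interpret product_sigma_finite "\<lambda>_ :: nat. lborel :: real measure" ..
  let ?n = "CARD('n)"
  let ?v = "\<lambda>f. (\<chi> i. f (rank i)) :: real ^ 'n idx"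
  have v: "?v \<in> Pi\<^sub>M {1..?n} (\<lambda>_. lborel) \<rightarrow>\<^sub>M borel"
  proof (rule borel_measurable_vec_lambda)
    fix i :: "'n idx"
    show "(\<lambda>f. f (rank i) :: real) \<in> borel_measurable (Pi\<^sub>M {1..?n} (\<lambda>_. lborel))"
      by (rule measurable_lborel_component) (rule rank)
  qed
  have Fv: "(\<lambda>f. F (?v f)) \<in> borel_measurable (Pi\<^sub>M {1..?n} (\<lambda>_. lborel))"
    by (rule measurable_compose[OF v F])
  have upd: "(\<lambda>f. g (f(k := c))) \<in> borel_measurable (Pi\<^sub>M {Suc k..?n} (\<lambda>_. lborel))"
    if "g \<in> borel_measurable (Pi\<^sub>M {k..?n} (\<lambda>_. lborel))" "k \<le> ?n" for k c and g :: "(nat \<Rightarrow> real) \<Rightarrow> ennreal"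
  proof (rule measurable_compose[OF _ that(1)])
    have "insert k {Suc k..?n} = {k..?n}"
      using that by auto
    then show "(\<lambda>f. f(k := c)) \<in> Pi\<^sub>M {Suc k..?n} (\<lambda>_. lborel) \<rightarrow>\<^sub>M Pi\<^sub>M {k..?n} (\<lambda>_. lborel)"
      using measurable_fun_upd[of "{k..?n}" "{Suc k..?n}" k "\<lambda>f. f" "Pi\<^sub>M {Suc k..?n} (\<lambda>_. lborel)" "\<lambda>_. lborel" "\<lambda>_. c"] by auto
  qed
  have step: "integral\<^sup>N (Pi\<^sub>M {k..?n} (\<lambda>_. lborel)) g
      = (\<integral>\<^sup>+c. (\<integral>\<^sup>+f. g (f(k := c)) \<partial>(Pi\<^sub>M {Suc k..?n} (\<lambda>_. lborel))) \<partial>lborel)"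
    if "g \<in> borel_measurable (Pi\<^sub>M {k..?n} (\<lambda>_. lborel))" "k \<le> ?n" for k and g :: "(nat \<Rightarrow> real) \<Rightarrow> ennreal"
  proof -
    have "insert k {Suc k..?n} = {k..?n}"
      using that by auto
    then show ?thesis
      using product_nn_integral_insert_rev[of "{Suc k..?n}" k g] that by simp
  qed
  have "(\<integral>\<^sup>+y. F y \<partial>lborel) = (\<integral>\<^sup>+f. F (?v f) \<partial>(Pi\<^sub>M {1..?n} (\<lambda>_. lborel)))"
    by (subst lborel_vec_eq_PiM[OF bij_betw_rank]) (rule nn_integral_distr[OF v], simp add: F)
  also have "\<dots> = (\<integral>\<^sup>+c. \<integral>\<^sup>+t. \<integral>\<^sup>+a. \<integral>\<^sup>+b. \<integral>\<^sup>+q. F (?v (q(4 := b, 3 := a, 2 := t, 1 := c)))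
      \<partial>(Pi\<^sub>M {5..?n} (\<lambda>_. lborel)) \<partial>lborel \<partial>lborel \<partial>lborel \<partial>lborel)"
  proof (subst step[OF Fv], use n in simp, intro nn_integral_cong)
    fix c :: real
    have F1: "(\<lambda>f. F (?v (f(1 := c)))) \<in> borel_measurable (Pi\<^sub>M {2..?n} (\<lambda>_. lborel))"
      using upd[OF Fv, of c] n by (simp add: numeral_2_eq_2)
    show "(\<integral>\<^sup>+f. F (?v (f(1 := c))) \<partial>(Pi\<^sub>M {Suc 1..?n} (\<lambda>_. lborel))) =
      (\<integral>\<^sup>+t. \<integral>\<^sup>+a. \<integral>\<^sup>+b. \<integral>\<^sup>+q. F (?v (q(4 := b, 3 := a, 2 := t, 1 := c)))
      \<partial>(Pi\<^sub>M {5..?n} (\<lambda>_. lborel)) \<partial>lborel \<partial>lborel \<partial>lborel)"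
      unfolding Suc_1
    proof (subst step[OF F1], use n in simp, intro nn_integral_cong)
      fix t :: real
      have F2: "(\<lambda>f. F (?v (f(2 := t, 1 := c)))) \<in> borel_measurable (Pi\<^sub>M {3..?n} (\<lambda>_. lborel))"
        using upd[OF F1, of t] n by (simp add: numeral_3_eq_3 numeral_2_eq_2)
      have S: "Suc 2 = 3" "Suc 3 = 4" "Suc 4 = 5" by simp_all
      show "(\<integral>\<^sup>+f. F (?v (f(2 := t, 1 := c))) \<partial>(Pi\<^sub>M {Suc 2..?n} (\<lambda>_. lborel))) =
        (\<integral>\<^sup>+a. \<integral>\<^sup>+b. \<integral>\<^sup>+q. F (?v (q(4 := b, 3 := a, 2 := t, 1 := c)))
        \<partial>(Pi\<^sub>M {5..?n} (\<lambda>_. lborel)) \<partial>lborel \<partial>lborel)"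
        unfolding S
      proof (subst step[OF F2], use n in simp, intro nn_integral_cong)
        fix a :: real
        have F3: "(\<lambda>f. F (?v (f(3 := a, 2 := t, 1 := c)))) \<in> borel_measurable (Pi\<^sub>M {4..?n} (\<lambda>_. lborel))"
          using upd[OF F2, of a] n unfolding S by simp
        show "(\<integral>\<^sup>+f. F (?v (f(3 := a, 2 := t, 1 := c))) \<partial>(Pi\<^sub>M {Suc 3..?n} (\<lambda>_. lborel))) =
          (\<integral>\<^sup>+b. \<integral>\<^sup>+q. F (?v (q(4 := b, 3 := a, 2 := t, 1 := c)))
          \<partial>(Pi\<^sub>M {5..?n} (\<lambda>_. lborel)) \<partial>lborel)"
          unfolding S using step[OF F3] n unfolding S by simp
      qed
    qed
  qed
  also have "\<dots> = (\<integral>\<^sup>+c. \<integral>\<^sup>+t. \<integral>\<^sup>+a. \<integral>\<^sup>+b. \<integral>\<^sup>+q. F (?v (q(1 := c, 2 := t, 3 := a, 4 := b)))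
      \<partial>(Pi\<^sub>M {5..?n} (\<lambda>_. lborel)) \<partial>lborel \<partial>lborel \<partial>lborel \<partial>lborel)"
  proof -
    have "q(4 := b, 3 := a, 2 := t, 1 := c) = q(1 := c, 2 := t, 3 := a, 4 := b)"
      for q :: "nat \<Rightarrow> real" and a b c t
      by (auto simp: fun_eq_iff)
    then show ?thesis by simp
  qed
  finally show ?thesis .
qed

lemma nn_integral_exp_square:
  assumes "0 < s"
  shows "(\<integral>\<^sup>+c. ennreal (exp (- c\<^sup>2 / (2 * s))) \<partial>lborel) = ennreal (sqrt (2 * pi * s))"
proof -
  have pos: "0 < sqrt (2 * pi * s)" and sq: "(sqrt s)\<^sup>2 = s"
    using assms by simp_all
  have "(\<integral>\<^sup>+c. ennreal (exp (- c\<^sup>2 / (2 * s))) \<partial>lborel)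
      = (\<integral>\<^sup>+c. ennreal (sqrt (2 * pi * s)) * ennreal (normal_density 0 (sqrt s) c) \<partial>lborel)"
  proof (rule nn_integral_cong)
    fix c :: real
    have "exp (- c\<^sup>2 / (2 * s)) = sqrt (2 * pi * s) * normal_density 0 (sqrt s) c"
      using assms pos by (simp add: normal_density_def sq)
    then show "ennreal (exp (- c\<^sup>2 / (2 * s))) = ennreal (sqrt (2 * pi * s)) * ennreal (normal_density 0 (sqrt s) c)"
      using pos by (simp only: ennreal_mult' less_imp_le)
  qed
  also have "\<dots> = ennreal (sqrt (2 * pi * s)) * (\<integral>\<^sup>+c. ennreal (normal_density 0 (sqrt s) c) \<partial>lborel)"
    by (rule nn_integral_cmult) simp
  also have "(\<integral>\<^sup>+c. ennreal (normal_density 0 (sqrt s) c) \<partial>lborel) = 1"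
    using assms by (subst nn_integral_eq_integral) simp_all
  finally show ?thesis by simp
qed

lemma powr_half_mult:
  assumes "0 < x"
  shows "x powr (1 / 2 * real m) = sqrt x ^ m"
proof -
  have "x powr (1 / 2 * real m) = (x powr (1 / 2)) powr real m"
    by (rule powr_powr[symmetric])
  also have "x powr (1 / 2) = sqrt x"
    using assms by (simp add: powr_half_sqrt)
  also have "sqrt x powr real m = sqrt x ^ m"
    by (rule powr_realpow) (use assms in simp)
  finally show ?thesis .
qed

lemma nn_integral_exp_sqrt_power:
  "(\<integral>\<^sup>+t. indicator {0<..} t * ennreal (exp (- t) * sqrt (2 * t) ^ m) \<partial>lborel)
    = ennreal (sqrt 2 ^ m * Gamma ((real m + 2) / 2))"
proof -
  have "(\<integral>\<^sup>+t. indicator {0<..} t * ennreal (exp (- t) * sqrt (2 * t) ^ m) \<partial>lborel)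
      = (\<integral>\<^sup>+t. ennreal (sqrt 2 ^ m) * ennreal (indicator {0..} t * t powr ((real m + 2) / 2 - 1) / exp t) \<partial>lborel)"
  proof (rule nn_integral_cong)
    fix t :: real
    consider "t < 0" | "t = 0" | "0 < t" by linarith
    then show "indicator {0<..} t * ennreal (exp (- t) * sqrt (2 * t) ^ m)
        = ennreal (sqrt 2 ^ m) * ennreal (indicator {0..} t * t powr ((real m + 2) / 2 - 1) / exp t)"
    proof cases
      case 3
      have "(real m + 2) / 2 - 1 = 1 / 2 * real m" by (simp add: field_simps)
      moreover have "t powr (1 / 2 * real m) = sqrt t ^ m"
        using 3 by (rule powr_half_mult)
      ultimately have powr: "t powr ((real m + 2) / 2 - 1) = sqrt t ^ m"
        by (simp only:)
      have E: "exp (- t) * sqrt (2 * t) ^ m = sqrt 2 ^ m * (sqrt t ^ m / exp t)"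
        by (simp only: real_sqrt_mult power_mult_distrib exp_minus divide_inverse mult_ac)
      have "(0 :: real) \<le> sqrt 2 ^ m" by simp
      then have "ennreal (exp (- t) * sqrt (2 * t) ^ m) = ennreal (sqrt 2 ^ m) * ennreal (sqrt t ^ m / exp t)"
        unfolding E by (rule ennreal_mult')
      then show ?thesis
        unfolding powr using 3 by simp
    qed simp_all
  qed
  also have "\<dots> = ennreal (sqrt 2 ^ m) * ennreal (Gamma ((real m + 2) / 2))"
  proof (subst nn_integral_cmult)
    have "(\<integral>\<^sup>+t. ennreal (indicator {0..} t * t powr ((real m + 2) / 2 - 1) / exp t) \<partial>lborel) = ennreal (Gamma ((real m + 2) / 2))"
      by (rule Gamma_conv_nn_integral_real[symmetric]) simp
    then show "ennreal (sqrt 2 ^ m) * (\<integral>\<^sup>+t. ennreal (indicator {0..} t * t powr ((real m + 2) / 2 - 1) / exp t) \<partial>lborel)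
        = ennreal (sqrt 2 ^ m) * ennreal (Gamma ((real m + 2) / 2))"
      by (simp only:)
  qed measurable
  also have "\<dots> = ennreal (sqrt 2 ^ m * Gamma ((real m + 2) / 2))"
    by (rule ennreal_mult'[symmetric]) simp
  finally show ?thesis .
qed

lemma Z_pos: "2 \<le> n \<Longrightarrow> 0 < Z n"
  unfolding Z_def by (intro divide_pos_pos mult_pos_pos Gamma_real_pos) simp_all

text \<open>The factors are, in this order: the one half in the Jacobian determinant, the constant of the
  Gaussian density, the integral over the mean and the integral over the length.\<close>
lemma normalising_constants:
  assumes "3 \<le> n"
  shows "2 * ((1 / sqrt (2 * pi)) ^ n * (sqrt (2 * pi * real n) *
    (sqrt 2 ^ (n - 3) * Gamma ((real (n - 3) + 2) / 2)))) * Z n = 1"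
proof -
  let ?G = "Gamma ((real n - 1) / 2)"
  have G: "(real (n - 3) + 2) / 2 = (real n - 1) / 2"
    using assms by (simp add: of_nat_diff)
  have "0 < ?G"
    using assms by (intro Gamma_real_pos) auto
  obtain m where n: "n = Suc m"
    using assms by (cases n) auto
  have pi_powr: "pi powr ((real n - 1) / 2) = sqrt pi ^ m"
  proof -
    have "(real n - 1) / 2 = 1 / 2 * real m"
      by (simp add: n)
    then show ?thesis
      using powr_half_mult[OF pi_gt_zero, of m] by (simp only:)
  qed
  have two_pow: "sqrt 2 ^ m = sqrt 2 ^ (n - 3) * (2 :: real)"
  proof -
    have "m = (n - 3) + 2" using assms n by simp
    then show ?thesis by (simp only: power_add) simp
  qed
  have cancel: "2 * ((1 / (b * a)) ^ Suc m * ((b * a * c) * (B * g))) * (a ^ m / (c * g)) = 1"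
    if "a \<noteq> 0" "b \<noteq> 0" "c \<noteq> 0" "g \<noteq> 0" "b ^ m = B * 2" for a b c g B :: real
  proof -
    have "B * 2 \<noteq> 0"
      using that by (metis power_not_zero)
    have "(1 / (b * a)) ^ Suc m = 1 / (b * a * (B * 2 * a ^ m))"
      by (simp only: power_one_over power_Suc power_mult_distrib that(5) times_divide_times_eq mult_1_left)
    then show ?thesis
      using that(1-4) \<open>B * 2 \<noteq> 0\<close> by simp
  qed
  have roots: "sqrt (2 * pi * real n) = sqrt 2 * sqrt pi * sqrt (real n)" "sqrt (2 * pi) = sqrt 2 * sqrt pi"
    by (simp_all only: real_sqrt_mult)
  have nz: "sqrt pi \<noteq> 0" "sqrt (2 :: real) \<noteq> 0" "sqrt (real n) \<noteq> 0"
    using assms by auto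
  have "?G \<noteq> 0"
    using \<open>0 < ?G\<close> by (rule less_imp_neq[symmetric])
  then show ?thesis
    unfolding G Z_def roots pi_powr by (rule cancel[OF nz _ two_pow, folded n])
qed

section \<open>Uniqueness of the rotation-invariant law\<close>

definition hyperplane_isometry :: "(real ^ 'm \<Rightarrow> real ^ 'm) \<Rightarrow> bool"
  where "hyperplane_isometry Q \<longleftrightarrow>
    orthogonal_transformation Q \<and> Q ` centred_hyperplane \<subseteq> centred_hyperplane"

definition invariant_law :: "(real ^ 'm) measure \<Rightarrow> bool"
  where "invariant_law N \<longleftrightarrow> prob_space N \<and> sets N = sets borel \<and> (AE x in N. x \<in> Omega) \<and>
    (\<forall>Q. hyperplane_isometry Q \<longrightarrow> distr N borel Q = N)"

lemma inner_1_eq_psum: "x \<bullet> 1 = psum 1 x"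
  by (simp add: inner_vec_def psum_def)

lemma psum_1_diff [simp]: "psum (Suc 0) (x - y) = psum (Suc 0) x - psum (Suc 0) y"
  by (simp add: psum_def sum_subtractf)

lemma psum_1_scaleR [simp]: "psum (Suc 0) (c *\<^sub>R x) = c * psum (Suc 0) x"
  by (simp add: psum_scaleR)

lemma mem_Omega_iff: "x \<in> Omega \<longleftrightarrow> psum 1 x = 0 \<and> norm x = 1"
proof -
  have "(norm x)\<^sup>2 = 1 \<longleftrightarrow> norm x = 1"
    unfolding power2_eq_1_iff using norm_ge_zero[of x] by linarith
  then show ?thesis
    by (simp add: Omega_def psum_2_eq_norm)
qed

lemma compact_Omega: "compact (Omega :: (real ^ 'm) set)"
proof -
  have "Omega = {x :: real ^ 'm. psum 1 x = 0} \<inter> sphere 0 1"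
    by (auto simp: mem_Omega_iff)
  moreover have "closed {x :: real ^ 'm. psum 1 x = 0}"
    by (intro closed_Collect_eq continuous_on_psum continuous_on_const)
  ultimately show ?thesis
    by (metis closed_Int_compact compact_sphere)
qed

text \<open>Reflection in the perpendicular bisector of two points of the sphere.\<close>
lemma hyperplane_isometry_transitive:
  fixes x y :: "real ^ 'm"
  assumes x: "x \<in> Omega" and y: "y \<in> Omega"
  obtains Q where "hyperplane_isometry Q" "Q x = y"
proof (cases "x = y")
  case True
  then show ?thesis
    using that[of "\<lambda>z. z"] by (auto simp: hyperplane_isometry_def)
next
  case False
  (* Q is the reflection along d. *)
  define d where "d = x - y"
  define Q where "Q z = z - (2 * (z \<bullet> d) / (d \<bullet> d)) *\<^sub>R d" for z
  have dd: "d \<bullet> d \<noteq> 0"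
    using False by (simp add: d_def)
  have "Q v \<bullet> Q w = v \<bullet> w" for v w
  proof -
    have "Q v \<bullet> Q w = v \<bullet> w - (2 * (w \<bullet> d) / (d \<bullet> d)) * (v \<bullet> d) - (2 * (v \<bullet> d) / (d \<bullet> d)) * (d \<bullet> w)
        + (2 * (v \<bullet> d) / (d \<bullet> d)) * (2 * (w \<bullet> d) / (d \<bullet> d)) * (d \<bullet> d)"
      by (simp add: Q_def inner_diff_left inner_diff_right algebra_simps)
    also have "\<dots> = v \<bullet> w"
      using dd by (simp add: field_simps inner_commute)
    finally show ?thesis .
  qed
  moreover have "linear Q"
  proof (rule linearI)
    show "Q (v + w) = Q v + Q w" for v w
      by (simp add: Q_def inner_add_left add_divide_distrib distrib_left scaleR_add_left)
    show "Q (c *\<^sub>R v) = c *\<^sub>R Q v" for c v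
      by (simp add: Q_def scaleR_diff_right)
  qed
  ultimately have "orthogonal_transformation Q"
    by (simp add: orthogonal_transformation_def)
  moreover have "psum 1 d = 0"
    using x y by (simp add: d_def mem_Omega_iff)
  then have "Q ` centred_hyperplane \<subseteq> centred_hyperplane"
    by (auto simp: Q_def centred_hyperplane_def)
  moreover have "Q x = y"
  proof -
    have "x \<bullet> x = 1" "y \<bullet> y = 1"
      using x y by (simp_all add: mem_Omega_iff dot_square_norm)
    then have "2 * (x \<bullet> d) = d \<bullet> d"
      by (simp add: d_def inner_diff_left inner_diff_right inner_commute)
    then show ?thesis
      using dd by (simp add: Q_def) (simp add: d_def)
  qed
  ultimately show ?thesis
    using that by (auto simp: hyperplane_isometry_def)
qed

text \<open>The indicator of a ball, written as a function that is symmetric in the centre and the point, as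
  needed for exchanging integrals.\<close>
definition near :: "real \<Rightarrow> 'a::metric_space \<Rightarrow> 'a \<Rightarrow> ennreal"
  where "near r x y = (if dist x y < r then 1 else 0)"

lemma near_commute: "near r x y = near r y x"
  by (simp add: near_def dist_commute)

lemma borel_measurable_near [measurable]:
  fixes M :: "'b measure" and f g :: "'b \<Rightarrow> real ^ 'm"
  assumes [measurable]: "f \<in> borel_measurable M" "g \<in> borel_measurable M"
  shows "(\<lambda>z. near r (f z) (g z)) \<in> borel_measurable M"
  unfolding near_def by measurable

lemma hyperplane_isometry_measurable:
  fixes Q :: "real ^ 'm \<Rightarrow> real ^ 'm"
  assumes "hyperplane_isometry Q"
  shows "Q \<in> borel_measurable borel"
proof -
  have "bounded_linear Q"
    using assms orthogonal_transformation_linear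
    by (auto simp: hyperplane_isometry_def simp flip: linear_conv_bounded_linear)
  then show ?thesis
    by (intro borel_measurable_continuous_onI linear_continuous_on)
qed

text \<open>The isometries act transitively on the sphere, so balls of equal radius have equal mass.\<close>
lemma near_integral_constant:
  fixes N :: "(real ^ 'm) measure"
  assumes N: "invariant_law N" and x: "x \<in> Omega" and y: "y \<in> Omega"
  shows "(\<integral>\<^sup>+z. near r x z \<partial>N) = (\<integral>\<^sup>+z. near r y z \<partial>N)"
proof -
  obtain Q where Q: "hyperplane_isometry Q" "Q y = x"
    using hyperplane_isometry_transitive[OF y x] .
  have sets: "sets N = sets borel" and inv: "distr N borel Q = N"
    using N Q(1) by (auto simp: invariant_law_def)
  have Q_meas: "Q \<in> N \<rightarrow>\<^sub>M borel"
    using hyperplane_isometry_measurable[OF Q(1)] measurable_cong_sets[OF sets refl] by blast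
  have orth: "orthogonal_transformation Q"
    using Q(1) by (simp add: hyperplane_isometry_def)
  have "dist (Q y) (Q z) = dist y z" for z
    using orthogonal_transformation_norm[OF orth] orthogonal_transformation_linear[OF orth]
    by (simp add: dist_norm flip: linear_diff)
  then have near_Q: "near r x (Q z) = near r y z" for z
    by (simp add: near_def flip: Q(2))
  have "(\<integral>\<^sup>+z. near r x z \<partial>N) = (\<integral>\<^sup>+z. near r x z \<partial>distr N borel Q)"
    by (simp add: inv)
  also have "\<dots> = (\<integral>\<^sup>+z. near r x (Q z) \<partial>N)"
    by (rule nn_integral_distr[OF Q_meas]) measurable
  finally show ?thesis
    by (simp add: near_Q)
qed

text \<open>Otherwise all balls of this radius would be null, and finitely many of them cover the compact
  sphere.\<close>
lemma near_integral_pos: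
  fixes N :: "(real ^ 'm) measure"
  assumes N: "invariant_law N" and x: "x \<in> Omega" and r: "0 < r"
  shows "0 < (\<integral>\<^sup>+z. near r x z \<partial>N)"
proof (rule ccontr)
  assume "\<not> 0 < (\<integral>\<^sup>+z. near r x z \<partial>N)"
  then have zero: "(\<integral>\<^sup>+z. near r y z \<partial>N) = 0" if "y \<in> Omega" for y
    using near_integral_constant[OF N x that, of r] by simp
  interpret prob_space N
    using N by (simp add: invariant_law_def)
  have sets [measurable_cong]: "sets N = sets borel" and AE: "AE z in N. z \<in> Omega"
    using N by (auto simp: invariant_law_def)
  obtain C :: "(real ^ 'm) set" where C: "C \<subseteq> Omega" "finite C" "Omega \<subseteq> (\<Union>c\<in>C. ball c r)"
    by (rule compactE_image[OF compact_Omega, of Omega "\<lambda>c. ball c r"]) (use r in auto)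
  have "AE z in N. near r c z = 0" if "c \<in> C" for c
  proof -
    have "(\<integral>\<^sup>+z. near r c z \<partial>N) = 0"
      using zero C(1) that by blast
    then show ?thesis
      by (subst (asm) nn_integral_0_iff_AE) measurable
  qed
  then have "AE z in N. \<forall>c\<in>C. near r c z = 0"
    using C(2) by (simp add: AE_finite_all)
  with AE have "AE z in N. False"
  proof eventually_elim
    case (elim z)
    then obtain c where "c \<in> C" "dist c z < r"
      using C(3) by (auto simp: subset_eq)
    with elim show ?case
      by (auto simp: near_def)
  qed
  then show False by simp
qed

lemma near_integral_swap:
  fixes N1 N2 :: "(real ^ 'm) measure"
  assumes N1: "invariant_law N1" and N2: "invariant_law N2" and g: "g \<in> borel_measurable borel"
  shows "(\<integral>\<^sup>+x. (\<integral>\<^sup>+y. g y * near r x y \<partial>N2) \<partial>N1) = (\<integral>\<^sup>+y. g y * (\<integral>\<^sup>+x. near r y x \<partial>N1) \<partial>N2)"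
proof -
  interpret N1: prob_space N1
    using N1 by (simp add: invariant_law_def)
  interpret N2: prob_space N2
    using N2 by (simp add: invariant_law_def)
  interpret pair_sigma_finite N1 N2 ..
  have [measurable_cong]: "sets N1 = sets borel" "sets N2 = sets borel"
    using N1 N2 by (auto simp: invariant_law_def)
  note g [measurable]
  have "(\<integral>\<^sup>+x. (\<integral>\<^sup>+y. g y * near r x y \<partial>N2) \<partial>N1) = (\<integral>\<^sup>+y. (\<integral>\<^sup>+x. g y * near r x y \<partial>N1) \<partial>N2)"
    by (rule Fubini'[symmetric]) measurable
  also have "\<dots> = (\<integral>\<^sup>+y. g y * (\<integral>\<^sup>+x. near r y x \<partial>N1) \<partial>N2)"
    by (intro nn_integral_cong) (subst nn_integral_cmult, measurable, simp add: near_commute)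
  finally show ?thesis .
qed

text \<open>Integrating the indicator of \<open>dist x y < r\<close> against the product of the two laws gives the
  common mass of the balls of radius \<open>r\<close> under the first law or under the second, depending on the
  order of integration.\<close>
lemma near_integral_unique:
  fixes N1 N2 :: "(real ^ 'm) measure"
  assumes N1: "invariant_law N1" and N2: "invariant_law N2" and x: "x \<in> Omega"
  shows "(\<integral>\<^sup>+z. near r x z \<partial>N1) = (\<integral>\<^sup>+z. near r x z \<partial>N2)"
proof -
  have const: "(\<integral>\<^sup>+y. (\<integral>\<^sup>+z. near r y z \<partial>N) \<partial>N') = (\<integral>\<^sup>+z. near r x z \<partial>N)"
    if N: "invariant_law N" and N': "invariant_law N'" for N N' :: "(real ^ 'm) measure"
  proof -
    interpret N': prob_space N'
      using N' by (simp add: invariant_law_def)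
    have "AE y in N'. y \<in> Omega"
      using N' by (simp add: invariant_law_def)
    then have "AE y in N'. (\<integral>\<^sup>+z. near r y z \<partial>N) = (\<integral>\<^sup>+z. near r x z \<partial>N)"
      by eventually_elim (rule near_integral_constant[OF N _ x])
    then have "(\<integral>\<^sup>+y. (\<integral>\<^sup>+z. near r y z \<partial>N) \<partial>N') = (\<integral>\<^sup>+y. (\<integral>\<^sup>+z. near r x z \<partial>N) \<partial>N')"
      by (rule nn_integral_cong_AE)
    then show ?thesis
      by (simp add: N'.emeasure_space_1)
  qed
  show ?thesis
    using near_integral_swap[OF N1 N2, of "\<lambda>_. 1" r] const[OF N1 N2] const[OF N2 N1] by simp
qed

text \<open>For a point \<open>x\<close> of the sphere in the open set \<open>G\<close>, the proportion of a ball around \<open>x\<close> that lies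
  in \<open>G\<close> is 1 as soon as the radius is small.  By Fatou's lemma the mass of \<open>G\<close> under \<open>N1\<close> is at
  most the limit inferior of the \<open>N1\<close>-integrals of these proportions.  Since both laws give the same
  mass to balls of equal radius, exchanging the integrals shows that each of them is the mass of
  \<open>G\<close> under \<open>N2\<close>.\<close>
lemma invariant_law_open_le:
  fixes N1 N2 :: "(real ^ 'm) measure"
  assumes N1: "invariant_law N1" and N2: "invariant_law N2" and G: "open G"
  shows "emeasure N1 G \<le> emeasure N2 G"
proof -
  interpret N1: prob_space N1
    using N1 by (simp add: invariant_law_def)
  interpret N2: prob_space N2
    using N2 by (simp add: invariant_law_def)
  have sets [measurable_cong]: "sets N1 = sets borel" "sets N2 = sets borel"
    and AE: "AE x in N1. x \<in> Omega" "AE x in N2. x \<in> Omega"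
    using N1 N2 by (auto simp: invariant_law_def)
  have [measurable]: "G \<in> sets borel"
    using G by simp
  have "(Omega :: (real ^ 'm) set) \<noteq> {}"
  proof
    assume "(Omega :: (real ^ 'm) set) = {}"
    with AE(1) show False by simp
  qed
  then obtain x0 :: "real ^ 'm" where x0: "x0 \<in> Omega" by blast
  define r where "r k = 1 / real (Suc k)" for k
  define h where "h k = (\<integral>\<^sup>+z. near (r k) x0 z \<partial>N2)" for k
  (* f k x is the proportion of the ball of radius r k around x that lies in G. *)
  define f where "f k x = (\<integral>\<^sup>+y. indicator G y * near (r k) x y \<partial>N2) / h k" for k x
  have h_pos: "h k \<noteq> 0" for k
    using near_integral_pos[OF N2 x0, of "r k"] by (simp add: h_def r_def)
  have "h k \<le> (\<integral>\<^sup>+z. 1 \<partial>N2)" for k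
    unfolding h_def by (intro nn_integral_mono) (simp add: near_def)
  then have "h k \<le> 1" for k
    by (simp add: N2.emeasure_space_1)
  then have h_fin: "h k \<noteq> \<top>" for k
    by (metis ennreal_one_neq_top top_unique)
  have f_int: "(\<integral>\<^sup>+x. f k x \<partial>N1) = emeasure N2 G" for k
  proof -
    have "(\<integral>\<^sup>+x. f k x \<partial>N1) = (\<integral>\<^sup>+x. (\<integral>\<^sup>+y. indicator G y * near (r k) x y \<partial>N2) \<partial>N1) / h k"
      unfolding f_def by (rule nn_integral_divide) measurable
    also have "(\<integral>\<^sup>+x. (\<integral>\<^sup>+y. indicator G y * near (r k) x y \<partial>N2) \<partial>N1)
        = (\<integral>\<^sup>+y. indicator G y * (\<integral>\<^sup>+x. near (r k) y x \<partial>N1) \<partial>N2)"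
      by (rule near_integral_swap[OF N1 N2]) measurable
    also have "\<dots> = (\<integral>\<^sup>+y. h k * indicator G y \<partial>N2)"
    proof (rule nn_integral_cong_AE)
      show "AE y in N2. indicator G y * (\<integral>\<^sup>+x. near (r k) y x \<partial>N1) = h k * indicator G y"
        using AE(2)
      proof eventually_elim
        case (elim y)
        have "(\<integral>\<^sup>+x. near (r k) y x \<partial>N1) = h k"
          unfolding h_def near_integral_constant[OF N1 elim x0] by (rule near_integral_unique[OF N1 N2 x0])
        then show ?case
          by (simp add: mult.commute)
      qed
    qed
    also have "\<dots> = h k * emeasure N2 G"
      by (subst nn_integral_cmult) (simp_all add: sets)
    finally show ?thesis
      using h_pos h_fin by (simp add: ennreal_mult_divide_eq mult.commute[of "h k"])
  qed
  have "emeasure N1 G = (\<integral>\<^sup>+x. indicator G x \<partial>N1)"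
    by (simp add: sets)
  also have "\<dots> \<le> (\<integral>\<^sup>+x. liminf (\<lambda>k. f k x) \<partial>N1)"
  proof (rule nn_integral_mono_AE)
    show "AE x in N1. indicator G x \<le> liminf (\<lambda>k. f k x)"
      using AE(1)
    proof eventually_elim
      case (elim x)
      show ?case
      proof (cases "x \<in> G")
        case True
        then obtain e where e: "0 < e" "ball x e \<subseteq> G"
          using G open_contains_ball by blast
        have "(\<lambda>k. r k) \<longlonglongrightarrow> 0"
          unfolding r_def by (rule LIMSEQ_Suc[OF lim_1_over_n])
        then have "\<forall>\<^sub>F k in sequentially. r k < e"
          using e(1) by (rule order_tendstoD)
        then have "\<forall>\<^sub>F k in sequentially. 1 \<le> f k x"
        proof eventually_elim
          case (elim k)
          have "indicator G y * near (r k) x y = near (r k) x y" for y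
            using elim e(2) by (auto simp: near_def indicator_def subset_eq)
          then have "f k x = h k / h k"
            using near_integral_constant[OF N2 \<open>x \<in> Omega\<close> x0, of "r k"] by (simp add: f_def h_def)
          also have "\<dots> = 1"
            using h_pos[of k] h_fin[of k] by (simp add: less_top)
          finally show ?case by simp
        qed
        then have "1 \<le> liminf (\<lambda>k. f k x)"
          by (rule Liminf_bounded)
        with True show ?thesis by simp
      qed simp
    qed
  qed
  also have "\<dots> \<le> liminf (\<lambda>k. \<integral>\<^sup>+x. f k x \<partial>N1)"
    unfolding f_def by (rule nn_integral_liminf) measurable
  also have "\<dots> = emeasure N2 G"
    by (simp add: f_int Liminf_const)
  finally show ?thesis .
qed

theorem invariant_law_unique:
  fixes N1 N2 :: "(real ^ 'm) measure"
  assumes N1: "invariant_law N1" and N2: "invariant_law N2"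
  shows "N1 = N2"
proof -
  have sets: "sets N1 = sigma_sets UNIV {G. open G}" "sets N2 = sigma_sets UNIV {G. open G}"
    using N1 N2 by (simp_all add: invariant_law_def borel_def)
  have eq: "emeasure N1 G = emeasure N2 G" if "G \<in> {G. open G}" for G
    using that invariant_law_open_le[OF N1 N2, of G] invariant_law_open_le[OF N2 N1, of G]
    by (simp only: mem_Collect_eq order.eq_iff simp_thms)
  interpret N1: prob_space N1
    using N1 by (simp add: invariant_law_def)
  have fin: "emeasure N1 UNIV \<noteq> \<infinity>" by simp
  have stable: "Int_stable {G :: (real ^ 'm) set. open G}"
    by (auto simp: Int_stable_def)
  show ?thesis
    by (rule measure_eqI_generator_eq[OF stable _ eq sets, of "\<lambda>_. UNIV"]) (use fin in simp_all)
qed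

section \<open>The third and fourth power sums of a Gaussian direction\<close>

text \<open>\<open>f_density\<close> without its normalising constant, as a function on the plane.\<close>
definition slice_integral :: "nat \<Rightarrow> real \<times> real \<Rightarrow> ennreal"
  where "slice_integral n p =
    (\<integral>\<^sup>+q. f_integrand n (q(1 := 0, 2 := 1, 3 := fst p, 4 := snd p)) \<partial>(\<Pi>\<^sub>M r\<in>{5..n}. lborel))"

lemma f_density_eq_slice_integral: "f_density n a b = slice_integral n (a, b) / ennreal (Z n)"
  by (simp add: f_density_def slice_integral_def)

lemma coords_unit_slice:
  fixes q :: "nat \<Rightarrow> real"
  assumes n: "4 \<le> CARD('n)" and q: "q \<in> space (\<Pi>\<^sub>M r\<in>{5..CARD('n)}. lborel)"
  shows "coords (unit_slice (\<chi> i :: 'n::finite idx. (q(1 := c, 2 := t, 3 := a, 4 := b)) (rank i)))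
    = q(1 := 0, 2 := 1, 3 := a, 4 := b)"
proof
  fix r
  show "coords (unit_slice (\<chi> i :: 'n idx. (q(1 := c, 2 := t, 3 := a, 4 := b)) (rank i))) r
    = (q(1 := 0, 2 := 1, 3 := a, 4 := b)) r"
  proof (cases "r \<in> {1..CARD('n)}")
    case True
    then have rank: "rank (Idx r :: 'n idx) = r"
      by (intro rank_Idx) simp_all
    show ?thesis
      unfolding coords_def restrict_apply'[OF True] unit_slice_def vec_lambda_beta rank
      by (simp only: fun_upd_apply) simp
  next
    case False
    then have "q r = undefined"
      using q by (intro extensional_arb[of q "{5..CARD('n)}"]) (auto simp: space_PiM PiE_def)
    with False n show ?thesis
      by (auto simp: coords_def)
  qed
qed

lemma borel_measurable_slice_integral:
  assumes n: "4 \<le> CARD('n::finite)"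
  shows "slice_integral CARD('n) \<in> borel_measurable borel"
proof -
  interpret product_sigma_finite "\<lambda>_ :: nat. lborel :: real measure" ..
  let ?M = "\<Pi>\<^sub>M r\<in>{5..CARD('n)}. (lborel :: real measure)"
  interpret sigma_finite_measure ?M
    by (rule sigma_finite) simp
  let ?v = "\<lambda>p q. (\<chi> i. (q(1 := 0, 2 := 1, 3 := fst p, 4 := snd p)) (rank i)) :: real ^ 'n idx"
  let ?f = "\<lambda>y :: real ^ 'n idx. f_integrand CARD('n) (coords (unit_slice y))"
  have v: "(\<lambda>z. ?v (fst z) (snd z)) \<in> (borel :: (real \<times> real) measure) \<Otimes>\<^sub>M ?M \<rightarrow>\<^sub>M borel"
  proof (rule borel_measurable_vec_lambda)
    fix i :: "'n idx"
    have fs: "(\<lambda>z. fst (fst z)) \<in> borel_measurable ((borel :: (real \<times> real) measure) \<Otimes>\<^sub>M ?M)"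
      "(\<lambda>z. snd (fst z)) \<in> borel_measurable ((borel :: (real \<times> real) measure) \<Otimes>\<^sub>M ?M)"
      by (rule measurable_compose[OF measurable_fst], intro borel_measurable_continuous_onI continuous_intros)+
    consider "rank i = 1" | "rank i = 2" | "rank i = 3" | "rank i = 4" | "rank i \<in> {5..CARD('n)}"
    proof -
      have "rank i = 1 \<or> rank i = 2 \<or> rank i = 3 \<or> rank i = 4 \<or> 5 \<le> rank i"
        using rank_pos[of i] by linarith
      then show ?thesis
        using that rank_bounds(2)[of i] by (metis atLeastAtMost_iff)
    qed
    then show "(\<lambda>z. ((snd z)(1 := 0, 2 := 1, 3 := fst (fst z), 4 := snd (fst z))) (rank i))
        \<in> borel_measurable ((borel :: (real \<times> real) measure) \<Otimes>\<^sub>M ?M)"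
    proof cases
      case 5
      then have "(\<lambda>z :: (real \<times> real) \<times> (nat \<Rightarrow> real). ((snd z)(1 := 0, 2 := 1, 3 := fst (fst z), 4 := snd (fst z))) (rank i))
          = (\<lambda>z. snd z (rank i))"
        by auto
      moreover have "(\<lambda>z. snd z (rank i)) \<in> borel_measurable ((borel :: (real \<times> real) measure) \<Otimes>\<^sub>M ?M)"
        by (rule measurable_compose[OF measurable_snd measurable_lborel_component[OF 5]])
      ultimately show ?thesis by (simp only:)
    qed (simp_all add: fs)
  qed
  have f: "?f \<in> borel_measurable borel"
    by (rule measurable_compose[OF borel_measurable_unit_slice borel_measurable_f_integrand])
  have "(\<lambda>z. ?f (?v (fst z) (snd z))) \<in> borel_measurable ((borel :: (real \<times> real) measure) \<Otimes>\<^sub>M ?M)"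
    by (rule measurable_compose[OF v f])
  then have "(\<lambda>p. \<integral>\<^sup>+q. ?f (?v p q) \<partial>?M) \<in> borel_measurable (borel :: (real \<times> real) measure)"
    by (intro borel_measurable_nn_integral) (simp add: case_prod_beta')
  moreover have "(\<lambda>p. \<integral>\<^sup>+q. ?f (?v p q) \<partial>?M) = slice_integral CARD('n)"
    unfolding slice_integral_def by (intro ext nn_integral_cong) (simp only: coords_unit_slice[OF n])
  ultimately show ?thesis by simp
qed

text \<open>This also holds for constant vectors, whose direction is 0.\<close>
lemma moment_map_direction:
  fixes x :: "real ^ 'n::finite idx"
  assumes "3 \<le> r" "r \<le> CARD('n)"
  shows "moment_map x $ Idx r = psum r (direction x)"
proof (cases "centre x = 0")
  case True
  then have "csum r x = 0"
    using assms by (simp add: csum_def psum_def zero_power)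
  with assms show ?thesis
    by (simp add: moment_map_def rank_Idx psum_direction)
next
  case False
  then have "0 < csum 2 x"
    by (simp add: csum_2_eq_norm)
  then have "psums (direction x) $ Idx r = unit_slice (moment_map x) $ Idx r"
    by (simp only: psums_direction)
  with assms show ?thesis
    by (simp add: psums_def unit_slice_def rank_Idx)
qed

text \<open>In the coordinates of \<open>moment_map\<close> the integrand is a product of a function of the mean, a
  function of the length and the discriminant factor of the remaining coordinates.\<close>
theorem nn_integral_gauss_direction:
  fixes B :: "(real \<times> real) set"
  assumes n: "4 \<le> CARD('n::finite)" and B [measurable]: "B \<in> sets borel"
  shows "(\<integral>\<^sup>+x. ennreal (gauss (x :: real ^ 'n idx)) * indicator B (psum 3 (direction x), psum 4 (direction x)) \<partial>lborel)
    = (\<integral>\<^sup>+p. f_density CARD('n) (fst p) (snd p) * indicator B p \<partial>lborel)"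
proof -
  let ?n = "CARD('n)"
  define K where "K = (1 / sqrt (2 * pi)) ^ ?n"
  define e1 where "e1 c = exp (- c\<^sup>2 / (2 * real ?n))" for c :: real
  define e2 where "e2 t = exp (- t) * sqrt (2 * t) ^ (?n - 3)" for t :: real
  define G :: "real ^ 'n idx \<Rightarrow> real" where "G y = indicator B (y $ Idx 3, y $ Idx 4)" for y
  define J where "J p = indicator B p * slice_integral ?n p" for p
  let ?M = "\<Pi>\<^sub>M r\<in>{5..?n}. (lborel :: real measure)"
  let ?y = "\<lambda>c t a b q. (\<chi> i. (q(1 := c, 2 := t, 3 := a, 4 := b)) (rank i)) :: real ^ 'n idx"
  let ?F = "\<lambda>y :: real ^ 'n idx. indicator {y. 0 < y $ Idx 2} y * ennreal (moment_weight y * G y) *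
        f_integrand ?n (coords (unit_slice y))"
  have n3: "3 \<le> ?n" using n by simp
  have G: "G \<in> borel_measurable borel"
    unfolding G_def by measurable
  have J [measurable]: "J \<in> borel_measurable borel"
    unfolding J_def using borel_measurable_slice_integral[OF n] by measurable
  have K: "0 \<le> K"
    by (simp add: K_def)
  have e [measurable]: "e1 \<in> borel_measurable borel" "e2 \<in> borel_measurable borel"
    unfolding e1_def e2_def by measurable
  have f: "(\<lambda>y :: real ^ 'n idx. f_integrand ?n (coords (unit_slice y))) \<in> borel_measurable borel"
    by (rule measurable_compose[OF borel_measurable_unit_slice borel_measurable_f_integrand])
  have F: "?F \<in> borel_measurable borel"
    using f G by measurable
  have "(\<integral>\<^sup>+x. ennreal (gauss (x :: real ^ 'n idx)) * indicator B (psum 3 (direction x), psum 4 (direction x)) \<partial>lborel)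
      = (\<integral>\<^sup>+x. ennreal (gauss x * G (moment_map x)) \<partial>lborel)"
    using n by (intro nn_integral_cong) (simp add: G_def moment_map_direction indicator_def)
  also have "\<dots> = 2 * (\<integral>\<^sup>+y. ?F y \<partial>lborel)"
    by (rule nn_integral_gauss_moments[OF n3 G]) (simp add: G_def)
  finally have half: "(\<integral>\<^sup>+x. ennreal (gauss (x :: real ^ 'n idx)) * indicator B (psum 3 (direction x), psum 4 (direction x)) \<partial>lborel)
      = 2 * (\<integral>\<^sup>+y. ?F y \<partial>lborel)" .
  have total: "(\<integral>\<^sup>+a. \<integral>\<^sup>+b. J (a, b) \<partial>lborel \<partial>lborel) = (\<integral>\<^sup>+p. J p \<partial>lborel)"
    by (subst lborel.nn_integral_fst) (simp_all add: lborel_prod)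
  have "(\<integral>\<^sup>+y. ?F y \<partial>lborel)
      = (\<integral>\<^sup>+c. \<integral>\<^sup>+t. \<integral>\<^sup>+a. \<integral>\<^sup>+b. \<integral>\<^sup>+q. ?F (?y c t a b q) \<partial>?M \<partial>lborel \<partial>lborel \<partial>lborel \<partial>lborel)"
    by (rule nn_integral_lborel_iterated[OF n F])
  also have "\<dots> = (\<integral>\<^sup>+c. \<integral>\<^sup>+t. ennreal K * ennreal (e1 c) * (indicator {0<..} t * ennreal (e2 t)) *
      (\<integral>\<^sup>+p. J p \<partial>lborel) \<partial>lborel \<partial>lborel)"
  proof (intro nn_integral_cong)
    fix c t :: real
    let ?A = "ennreal K * ennreal (e1 c) * (indicator {0<..} t * ennreal (e2 t))"
    have weight: "?F (?y c t a b q) = ?A * (indicator B (a, b) * f_integrand ?n (q(1 := 0, 2 := 1, 3 := a, 4 := b)))"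
      if q: "q \<in> space ?M" for a b q
    proof (cases "0 < t")
      case True
      have coord: "?y c t a b q $ Idx 1 = c" "?y c t a b q $ Idx 2 = t" "?y c t a b q $ Idx 3 = a" "?y c t a b q $ Idx 4 = b"
        using n by (simp_all add: rank_Idx)
      have "0 \<le> e1 c" "0 \<le> e2 t"
        using True by (simp_all add: e1_def e2_def)
      moreover have "moment_weight (?y c t a b q) = K * (e1 c * e2 t)"
        unfolding moment_weight_def coord K_def e1_def e2_def ..
      ultimately have "ennreal (moment_weight (?y c t a b q) * G (?y c t a b q))
          = ennreal K * ennreal (e1 c) * ennreal (e2 t) * indicator B (a, b)"
        using K unfolding G_def coord by (simp add: ennreal_mult mult.assoc ennreal_indicator)
      then show ?thesis
        unfolding coords_unit_slice[OF n q] using True coord(2) by (simp add: mult.assoc)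
    next
      case False
      have "?y c t a b q $ Idx 2 = t"
        using n by (simp add: rank_Idx)
      with False show ?thesis by simp
    qed
    have "(\<integral>\<^sup>+q. ?F (?y c t a b q) \<partial>?M) = ?A * J (a, b)" for a b
    proof -
      let ?g = "\<lambda>q. f_integrand ?n (q(1 := 0, 2 := 1, 3 := a, 4 := b))"
      have "?g \<in> borel_measurable ?M"
      proof (subst measurable_cong)
        show "?g q = f_integrand ?n (coords (unit_slice (?y 0 1 a b q)))" if "q \<in> space ?M" for q
          by (simp only: coords_unit_slice[OF n that])
        have "(\<lambda>q. ?y 0 1 a b q) \<in> ?M \<rightarrow>\<^sub>M borel"
        proof (rule borel_measurable_vec_lambda)
          fix i :: "'n idx"
          show "(\<lambda>q. (q(1 := 0, 2 := 1, 3 := a, 4 := b)) (rank i)) \<in> borel_measurable ?M"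
          proof (cases "rank i \<in> {5..?n}")
            case True
            then have "(\<lambda>q :: nat \<Rightarrow> real. (q(1 := 0, 2 := 1, 3 := a, 4 := b)) (rank i)) = (\<lambda>q. q (rank i))"
              by auto
            then show ?thesis
              using measurable_lborel_component[OF True] by (simp only:)
          next
            case False
            then have "rank i \<in> {1, 2, 3, 4}"
              using rank_bounds[of i] by auto
            then have "(\<lambda>q :: nat \<Rightarrow> real. (q(1 := 0, 2 := 1, 3 := a, 4 := b)) (rank i))
                = (\<lambda>q. ((\<lambda>_. 0)(1 := 0, 2 := 1, 3 := a, 4 := b)) (rank i))"
              by auto
            then show ?thesis
              by (simp only: measurable_const space_borel UNIV_I)
          qed
        qed
        then show "(\<lambda>q. f_integrand ?n (coords (unit_slice (?y 0 1 a b q)))) \<in> borel_measurable ?M"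
          by (rule measurable_compose[OF _ f])
      qed
      then have "(\<integral>\<^sup>+q. (?A * indicator B (a, b)) * ?g q \<partial>?M) = (?A * indicator B (a, b)) * integral\<^sup>N ?M ?g"
        by (rule nn_integral_cmult)
      moreover have "(\<integral>\<^sup>+q. ?F (?y c t a b q) \<partial>?M) = (\<integral>\<^sup>+q. (?A * indicator B (a, b)) * ?g q \<partial>?M)"
      proof (rule nn_integral_cong)
        fix q assume "q \<in> space ?M"
        then show "?F (?y c t a b q) = (?A * indicator B (a, b)) * ?g q"
          unfolding mult.assoc[of ?A "indicator B (a, b)"] by (rule weight)
      qed
      ultimately show ?thesis
        by (simp only: J_def slice_integral_def fst_conv snd_conv mult.assoc)
    qed
    then have "(\<integral>\<^sup>+a. \<integral>\<^sup>+b. \<integral>\<^sup>+q. ?F (?y c t a b q) \<partial>?M \<partial>lborel \<partial>lborel) = (\<integral>\<^sup>+a. \<integral>\<^sup>+b. ?A * J (a, b) \<partial>lborel \<partial>lborel)"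
      by (simp only:)
    also have "\<dots> = (\<integral>\<^sup>+a. ?A * (\<integral>\<^sup>+b. J (a, b) \<partial>lborel) \<partial>lborel)"
      by (intro nn_integral_cong nn_integral_cmult) measurable
    also have "\<dots> = ?A * (\<integral>\<^sup>+a. \<integral>\<^sup>+b. J (a, b) \<partial>lborel \<partial>lborel)"
      by (rule nn_integral_cmult) measurable
    finally show "(\<integral>\<^sup>+a. \<integral>\<^sup>+b. \<integral>\<^sup>+q. ?F (?y c t a b q) \<partial>?M \<partial>lborel \<partial>lborel)
        = ?A * (\<integral>\<^sup>+p. J p \<partial>lborel)"
      by (simp only: total)
  qed
  also have "\<dots> = ennreal K * (\<integral>\<^sup>+c. ennreal (e1 c) \<partial>lborel) * (\<integral>\<^sup>+t. indicator {0<..} t * ennreal (e2 t) \<partial>lborel) * (\<integral>\<^sup>+p. J p \<partial>lborel)"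
    by (simp add: nn_integral_multc nn_integral_cmult)
  also have "\<dots> = ennreal (K * (sqrt (2 * pi * real ?n) * (sqrt 2 ^ (?n - 3) * Gamma ((real (?n - 3) + 2) / 2)))) * (\<integral>\<^sup>+p. J p \<partial>lborel)"
  proof -
    have "(\<integral>\<^sup>+c. ennreal (e1 c) \<partial>lborel) = ennreal (sqrt (2 * pi * real ?n))"
      unfolding e1_def by (rule nn_integral_exp_square) simp
    moreover have "(\<integral>\<^sup>+t. indicator {0<..} t * ennreal (e2 t) \<partial>lborel) = ennreal (sqrt 2 ^ (?n - 3) * Gamma ((real (?n - 3) + 2) / 2))"
      unfolding e2_def by (rule nn_integral_exp_sqrt_power)
    moreover have "ennreal (K * (sqrt (2 * pi * real ?n) * Y)) = ennreal K * (ennreal (sqrt (2 * pi * real ?n)) * ennreal Y)" for Y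
      by (subst ennreal_mult'[OF K], subst ennreal_mult') simp_all
    ultimately show ?thesis
      by (simp only: mult.assoc)
  qed
  finally have F_J: "(\<integral>\<^sup>+y. ?F y \<partial>lborel) = ennreal (K * (sqrt (2 * pi * real ?n) *
      (sqrt 2 ^ (?n - 3) * Gamma ((real (?n - 3) + 2) / 2)))) * (\<integral>\<^sup>+p. J p \<partial>lborel)" .
  have J_density: "(\<integral>\<^sup>+p. J p \<partial>lborel) = ennreal (Z ?n) * (\<integral>\<^sup>+p. f_density ?n (fst p) (snd p) * indicator B p \<partial>lborel)"
  proof -
    have Z: "0 < Z ?n"
      using n by (intro Z_pos) simp
    have "J p = ennreal (Z ?n) * (f_density ?n (fst p) (snd p) * indicator B p)" for p
    proof -
      have "ennreal (Z ?n) * (slice_integral ?n p / ennreal (Z ?n)) = slice_integral ?n p"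
      proof -
        have "ennreal (Z ?n) * (slice_integral ?n p / ennreal (Z ?n)) = slice_integral ?n p * ennreal (Z ?n) / ennreal (Z ?n)"
          unfolding ennreal_times_divide by (subst mult.commute) (rule refl)
        also have "\<dots> = slice_integral ?n p"
          using Z by (intro ennreal_mult_divide_eq) simp_all
        finally show ?thesis .
      qed
      then show ?thesis
        unfolding J_def f_density_eq_slice_integral prod.collapse by (simp add: mult_ac)
    qed
    moreover have "(\<lambda>p. f_density ?n (fst p) (snd p) * indicator B p) \<in> borel_measurable lborel"
      unfolding f_density_eq_slice_integral prod.collapse using borel_measurable_slice_integral[OF n] by measurable
    ultimately show ?thesis
      by (simp only: nn_integral_cmult)
  qed
  show ?thesis
    unfolding half F_J J_density
  proof -
    let ?c = "K * (sqrt (2 * pi * real ?n) * (sqrt 2 ^ (?n - 3) * Gamma ((real (?n - 3) + 2) / 2)))"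
    have Gam: "0 < Gamma ((real (?n - 3) + 2) / 2)"
      by (intro Gamma_real_pos) simp
    have "0 \<le> ?c"
      using K Gam by simp
    then have "ennreal 2 * ennreal ?c * ennreal (Z ?n) = ennreal (2 * ?c * Z ?n)"
      by (simp only: ennreal_mult' zero_le_numeral zero_le_mult_iff simp_thms mult_nonneg_nonneg)
    also have "2 * ?c * Z ?n = 1"
      unfolding K_def by (rule normalising_constants[OF n3])
    finally have "2 * (ennreal ?c * (ennreal (Z ?n) * D)) = D" for D
      by (simp flip: mult.assoc)
    then show "2 * (ennreal ?c * (ennreal (Z ?n) * (\<integral>\<^sup>+p. f_density ?n (fst p) (snd p) * indicator B p \<partial>lborel)))
        = (\<integral>\<^sup>+p. f_density ?n (fst p) (snd p) * indicator B p \<partial>lborel)" .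
  qed
qed

section \<open>The direction of a Gaussian vector\<close>

definition gauss_measure :: "(real ^ 'm) measure"
  where "gauss_measure = density lborel gauss"

lemma sets_gauss_measure [simp, measurable_cong]: "sets gauss_measure = sets borel"
  by (simp add: gauss_measure_def)

lemma space_gauss_measure [simp]: "space gauss_measure = UNIV"
  by (simp add: gauss_measure_def)

lemma PiM_std_normal_eq_density:
  fixes I :: "'i set"
  assumes fin: "finite I"
  shows "(\<Pi>\<^sub>M k\<in>I. density lborel std_normal_density)
    = density (\<Pi>\<^sub>M k\<in>I. lborel) (\<lambda>f. \<Prod>k\<in>I. ennreal (std_normal_density (f k)))"
proof -
  interpret L: product_sigma_finite "\<lambda>_ :: 'i. lborel :: real measure" ..
  have sf: "sigma_finite_measure (density lborel std_normal_density)"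
    by (intro prob_space_imp_sigma_finite prob_space_normal_density) simp
  interpret D: product_sigma_finite "\<lambda>_ :: 'i. density lborel std_normal_density"
    by (rule product_sigma_finite.intro) (rule sf)
  let ?F = "\<lambda>f :: 'i \<Rightarrow> real. \<Prod>k\<in>I. ennreal (std_normal_density (f k))"
  have F: "?F \<in> borel_measurable (\<Pi>\<^sub>M k\<in>I. lborel)"
  proof (rule borel_measurable_prod_ennreal)
    fix k assume "k \<in> I"
    then show "(\<lambda>f. ennreal (std_normal_density (f k))) \<in> borel_measurable (\<Pi>\<^sub>M k\<in>I. lborel)"
      by (intro measurable_compose[OF measurable_lborel_component]) measurable
  qed
  have "density (\<Pi>\<^sub>M k\<in>I. lborel) ?F = (\<Pi>\<^sub>M k\<in>I. density lborel std_normal_density)"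
  proof (rule D.PiM_eqI[OF fin])
    show "sets (density (\<Pi>\<^sub>M k\<in>I. lborel) ?F) = sets (\<Pi>\<^sub>M k\<in>I. density lborel std_normal_density)"
      unfolding sets_density by (intro sets_PiM_cong) simp_all
    fix A :: "'i \<Rightarrow> real set"
    assume "\<And>k. k \<in> I \<Longrightarrow> A k \<in> sets (density lborel std_normal_density)"
    then have A: "A k \<in> sets borel" if "k \<in> I" for k
      using that by simp
    have "emeasure (density (\<Pi>\<^sub>M k\<in>I. lborel) ?F) (Pi\<^sub>E I A)
        = (\<integral>\<^sup>+f. ?F f * indicator (Pi\<^sub>E I A) f \<partial>(\<Pi>\<^sub>M k\<in>I. lborel))"
      by (rule emeasure_density[OF F]) (intro sets_PiM_I_finite fin, simp add: A)
    also have "\<dots> = (\<integral>\<^sup>+f. (\<Prod>k\<in>I. ennreal (std_normal_density (f k)) * indicator (A k) (f k)) \<partial>(\<Pi>\<^sub>M k\<in>I. lborel))"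
    proof (rule nn_integral_cong)
      fix f assume "f \<in> space (\<Pi>\<^sub>M k\<in>I. (lborel :: real measure))"
      then have ext: "f \<in> extensional I"
        by (simp add: space_PiM PiE_def)
      have "indicator (Pi\<^sub>E I A) f = (\<Prod>k\<in>I. indicator (A k) (f k) :: ennreal)"
      proof (cases "f \<in> Pi\<^sub>E I A")
        case True
        then have "indicator (A k) (f k) = (1 :: ennreal)" if "k \<in> I" for k
          using that by (auto simp: PiE_iff)
        with True show ?thesis by simp
      next
        case False
        then obtain k where "k \<in> I" "f k \<notin> A k"
          using ext by (auto simp: PiE_iff)
        then have "\<exists>k\<in>I. indicator (A k) (f k) = (0 :: ennreal)"
          by (intro bexI[of _ k]) simp_all
        with False fin show ?thesis
          by (simp add: prod_zero)
      qed
      then show "?F f * indicator (Pi\<^sub>E I A) f = (\<Prod>k\<in>I. ennreal (std_normal_density (f k)) * indicator (A k) (f k))"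
        by (simp only: prod.distrib)
    qed
    also have "\<dots> = (\<Prod>k\<in>I. \<integral>\<^sup>+x. ennreal (std_normal_density x) * indicator (A k) x \<partial>lborel)"
    proof (rule L.product_nn_integral_prod[OF fin])
      fix k assume "k \<in> I"
      then show "(\<lambda>x. ennreal (std_normal_density x) * indicator (A k) x) \<in> borel_measurable lborel"
        using A[OF \<open>k \<in> I\<close>] by measurable
    qed
    also have "\<dots> = (\<Prod>k\<in>I. emeasure (density lborel std_normal_density) (A k))"
      using A by (intro prod.cong refl emeasure_density[symmetric]) simp_all
    finally show "emeasure (density (\<Pi>\<^sub>M k\<in>I. lborel) ?F) (Pi\<^sub>E I A)
        = (\<Prod>k\<in>I. emeasure (density lborel std_normal_density) (A k))" .
  qed
  then show ?thesis by simp
qed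

lemma gauss_measure_eq_distr_PiM:
  assumes e: "bij_betw e (UNIV :: 'i::finite set) I"
  shows "(gauss_measure :: (real ^ 'i) measure)
    = distr (\<Pi>\<^sub>M k\<in>I. density lborel std_normal_density) borel (\<lambda>f. \<chi> i. f (e i))"
proof -
  let ?v = "\<lambda>f. (\<chi> i. f (e i)) :: real ^ 'i"
  have fin: "finite I"
    using bij_betw_finite[OF e] by simp
  have v: "?v \<in> (\<Pi>\<^sub>M k\<in>I. lborel) \<rightarrow>\<^sub>M borel"
  proof (rule borel_measurable_vec_lambda)
    fix i :: 'i
    have "e i \<in> I"
      using e by (auto simp: bij_betw_def)
    then show "(\<lambda>f. f (e i) :: real) \<in> borel_measurable (\<Pi>\<^sub>M k\<in>I. lborel)"
      by (rule measurable_lborel_component)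
  qed
  have gauss_v: "ennreal (gauss (?v f)) = (\<Prod>k\<in>I. ennreal (std_normal_density (f k)))" for f
    unfolding gauss_def vec_lambda_beta prod.reindex_bij_betw[OF e, of "\<lambda>k. std_normal_density (f k)"]
    by (rule prod_ennreal[symmetric]) simp
  have "density lborel gauss = density (distr (\<Pi>\<^sub>M k\<in>I. lborel) borel ?v) (\<lambda>x. ennreal (gauss x))"
    using lborel_vec_eq_PiM[OF e] by (simp only:)
  also have "\<dots> = distr (density (\<Pi>\<^sub>M k\<in>I. lborel) (\<lambda>f. ennreal (gauss (?v f)))) borel ?v"
    by (rule density_distr[OF _ v]) measurable
  also have "\<dots> = distr (\<Pi>\<^sub>M k\<in>I. density lborel std_normal_density) borel ?v"
    by (simp only: gauss_v PiM_std_normal_eq_density[OF fin])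
  finally show ?thesis
    by (simp only: gauss_measure_def)
qed

lemma prob_space_gauss_measure: "prob_space (gauss_measure :: (real ^ 'm) measure)"
proof -
  have id: "bij_betw (\<lambda>i. i) (UNIV :: 'm set) UNIV"
    by (simp add: bij_betw_def)
  have "prob_space (\<Pi>\<^sub>M k\<in>(UNIV :: 'm set). density lborel std_normal_density)"
    by (intro prob_space_PiM prob_space_normal_density) simp
  moreover have "(\<lambda>f. (\<chi> i. f i) :: real ^ 'm) \<in> (\<Pi>\<^sub>M k\<in>UNIV. density lborel std_normal_density) \<rightarrow>\<^sub>M borel"
    by (intro borel_measurable_vec_lambda) (simp add: measurable_component_singleton)
  ultimately show ?thesis
    unfolding gauss_measure_eq_distr_PiM[OF id] by (rule prob_space.prob_space_distr)
qed

lemma distr_gauss_measure_orthogonal: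
  fixes Q :: "real ^ 'm::{finite,wellorder} \<Rightarrow> real ^ 'm::_"
  assumes Q: "orthogonal_transformation Q" and meas: "Q \<in> borel_measurable borel"
  shows "distr gauss_measure borel Q = gauss_measure"
proof -
  have Q': "Q \<in> lborel \<rightarrow>\<^sub>M borel"
    using meas by simp
  have "ennreal (gauss (Q x)) = ennreal (gauss x)" for x
    by (simp add: gauss_eq_norm orthogonal_transformation_norm[OF Q])
  then have "distr gauss_measure borel Q = distr (density lborel (\<lambda>x. ennreal (gauss (Q x)))) borel Q"
    by (simp only: gauss_measure_def)
  also have "\<dots> = density (distr lborel borel Q) (\<lambda>x. ennreal (gauss x))"
    by (rule density_distr[OF _ Q', symmetric]) measurable
  also have "\<dots> = gauss_measure"
    by (simp only: distr_lborel_orthogonal[OF Q] gauss_measure_def)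
  finally show ?thesis .
qed

lemma linear_centre: "linear centre"
  by (rule linearI)
    (simp_all add: centre_def vec_eq_iff psum_def sum.distrib add_divide_distrib right_diff_distrib
      flip: sum_distrib_left)

lemma centre_eq_iff_hyperplane: "centre x = x \<longleftrightarrow> x \<in> centred_hyperplane"
  by (simp add: centre_def vec_eq_iff centred_hyperplane_def)

lemma centre_in_hyperplane: "centre x \<in> centred_hyperplane"
  by (simp add: centred_hyperplane_def)

text \<open>An injective linear map of the hyperplane into itself is onto.\<close>
lemma hyperplane_isometry_surj:
  fixes Q :: "real ^ 'm \<Rightarrow> real ^ 'm"
  assumes "hyperplane_isometry Q"
  shows "Q ` centred_hyperplane = centred_hyperplane"
proof -
  have Q: "orthogonal_transformation Q" "Q ` centred_hyperplane \<subseteq> centred_hyperplane"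
    using assms by (auto simp: hyperplane_isometry_def)
  have lin: "linear Q"
    by (rule orthogonal_transformation_linear[OF Q(1)])
  have sub: "subspace (centred_hyperplane :: (real ^ 'm) set)"
    by (auto simp: subspace_def centred_hyperplane_def psum_def sum.distrib simp flip: sum_distrib_left)
  have "inj_on Q (span centred_hyperplane)"
    using orthogonal_transformation_inj[OF Q(1)] by (rule inj_on_subset) simp
  then have "dim (Q ` centred_hyperplane) = dim (centred_hyperplane :: (real ^ 'm) set)"
    by (rule dim_image_eq[OF lin])
  then show ?thesis
    by (intro subspace_dim_equal linear_subspace_image[OF lin] sub Q(2)) simp
qed

text \<open>An isometry of the ambient space that preserves the hyperplane preserves its orthogonal
  complement, the line of constant vectors, so it commutes with the orthogonal projection.\<close>
lemma hyperplane_isometry_centre: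
  fixes Q :: "real ^ 'm \<Rightarrow> real ^ 'm"
  assumes iso: "hyperplane_isometry Q"
  shows "Q (centre x) = centre (Q x)"
proof -
  have Q: "orthogonal_transformation Q" "Q ` centred_hyperplane \<subseteq> centred_hyperplane"
    using iso by (auto simp: hyperplane_isometry_def)
  have lin: "linear Q"
    by (rule orthogonal_transformation_linear[OF Q(1)])
  have decomp: "y = centre y + (psum 1 y / real CARD('m)) *\<^sub>R 1" for y :: "real ^ 'm"
    by (simp add: vec_eq_iff centre_def)
  have "centre (Q 1) = 0"
  proof -
    let ?c = "centre (Q 1)"
    obtain h where h: "h \<in> centred_hyperplane" "?c = Q h"
      using hyperplane_isometry_surj[OF iso] centre_in_hyperplane[of "Q 1"] by auto
    have perp: "v \<bullet> 1 = 0" if "v \<in> centred_hyperplane" for v :: "real ^ 'm"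
      using that by (simp only: inner_1_eq_psum centred_hyperplane_def mem_Collect_eq)
    (* The centred part of Q 1 is the image of some h in the hyperplane, and h is orthogonal to 1. *)
    have "?c \<bullet> ?c = Q 1 \<bullet> ?c"
    proof -
      have "Q 1 \<bullet> ?c = ?c \<bullet> ?c + (psum 1 (Q 1) / real CARD('m)) * (?c \<bullet> 1)"
        by (subst (1) decomp[of "Q 1"]) (simp only: inner_add_left inner_add_right inner_scaleR_left inner_scaleR_right inner_commute)
      then show ?thesis
        using perp[OF centre_in_hyperplane] by simp
    qed
    also have "\<dots> = Q 1 \<bullet> Q h"
      by (simp only: h(2))
    also have "\<dots> = h \<bullet> 1"
      using Q(1) by (simp add: orthogonal_transformation_def inner_commute)
    also have "\<dots> = 0"
      by (rule perp[OF h(1)])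
    finally show ?thesis by simp
  qed
  have "Q x = Q (centre x) + (psum 1 x / real CARD('m)) *\<^sub>R Q 1"
    by (subst decomp[of x]) (simp only: linear_add[OF lin] linear_scale[OF lin])
  then have "centre (Q x) = centre (Q (centre x)) + (psum 1 x / real CARD('m)) *\<^sub>R centre (Q 1)"
    by (simp only: linear_add[OF linear_centre] linear_scale[OF linear_centre])
  moreover have "centre (Q (centre x)) = Q (centre x)"
    using Q(2) centre_in_hyperplane[of x] by (simp only: centre_eq_iff_hyperplane) blast
  ultimately show ?thesis
    using \<open>centre (Q 1) = 0\<close> by simp
qed

lemma hyperplane_isometry_direction:
  assumes "hyperplane_isometry Q"
  shows "Q (direction x) = direction (Q x)"
proof -
  have Q: "orthogonal_transformation Q"
    using assms by (simp add: hyperplane_isometry_def)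
  show ?thesis
    unfolding direction_def hyperplane_isometry_centre[OF assms, symmetric]
    by (simp add: linear_scale[OF orthogonal_transformation_linear[OF Q]] orthogonal_transformation_norm[OF Q])
qed

lemma sets_Omega [measurable]: "Omega \<in> sets borel"
  by (intro borel_closed compact_imp_closed compact_Omega)

text \<open>The Gaussian density depends only on the norm, so it is invariant under all rotations, and
  those that preserve the hyperplane commute with taking directions.\<close>
lemma invariant_law_gauss_direction:
  assumes n: "2 \<le> CARD('n::finite)"
  shows "invariant_law (distr gauss_measure borel (direction :: real ^ 'n idx \<Rightarrow> _))"
proof -
  let ?\<gamma> = "gauss_measure :: (real ^ 'n idx) measure"
  have dir: "direction \<in> ?\<gamma> \<rightarrow>\<^sub>M borel"
    using borel_measurable_direction measurable_cong_sets[OF sets_gauss_measure refl] by blast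
  have "AE x in lborel. direction (x :: real ^ 'n idx) \<in> Omega"
    using AE_inj_coordinates
  proof eventually_elim
    case (elim x)
    have "Idx 1 \<noteq> (Idx 2 :: 'n idx)"
      using n rank_Idx[of 1, where 'n = 'n] rank_Idx[of 2, where 'n = 'n] by auto
    then have "x $ Idx 1 \<noteq> x $ Idx 2"
      using elim by (simp add: inj_eq)
    then have "centre x \<noteq> 0"
      by (auto simp: centre_def vec_eq_iff) metis
    then show ?case
      by (simp add: mem_Omega_iff direction_def)
  qed
  then have AE: "AE x in ?\<gamma>. direction x \<in> Omega"
    unfolding gauss_measure_def by (subst AE_density) (measurable, auto)
  have "distr (distr ?\<gamma> borel direction) borel Q = distr ?\<gamma> borel direction" if iso: "hyperplane_isometry Q" for Q
  proof -
    have Q: "Q \<in> borel_measurable borel"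
      by (rule hyperplane_isometry_measurable[OF iso])
    have Q': "Q \<in> ?\<gamma> \<rightarrow>\<^sub>M borel"
      using Q measurable_cong_sets[OF sets_gauss_measure refl] by blast
    have orth: "orthogonal_transformation Q"
      using iso by (simp add: hyperplane_isometry_def)
    have "distr (distr ?\<gamma> borel direction) borel Q = distr ?\<gamma> borel (\<lambda>x. Q (direction x))"
      by (subst distr_distr[OF Q dir]) (simp add: comp_def)
    also have "\<dots> = distr ?\<gamma> borel (\<lambda>x. direction (Q x))"
      by (simp only: hyperplane_isometry_direction[OF iso])
    also have "\<dots> = distr (distr ?\<gamma> borel Q) borel direction"
      by (subst distr_distr[OF borel_measurable_direction Q']) (simp add: comp_def)
    also have "\<dots> = distr ?\<gamma> borel direction"
      by (simp only: distr_gauss_measure_orthogonal[OF orth Q])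
    finally show ?thesis .
  qed
  moreover have "AE x in distr ?\<gamma> borel direction. x \<in> Omega"
    using AE by (subst AE_distr_iff[OF dir]) simp_all
  moreover have "prob_space (distr ?\<gamma> borel direction)"
    by (rule prob_space.prob_space_distr[OF prob_space_gauss_measure dir])
  ultimately show ?thesis
    by (simp add: invariant_law_def)
qed

lemma borel_measurable_f_density:
  assumes "4 \<le> CARD('n::finite)"
  shows "(\<lambda>(a, b). f_density CARD('n) a b) \<in> borel_measurable lborel"
proof -
  have "(\<lambda>(a, b). f_density CARD('n) a b) = (\<lambda>p. slice_integral CARD('n) p / ennreal (Z CARD('n)))"
    by (auto simp: f_density_eq_slice_integral)
  then show ?thesis
    using borel_measurable_slice_integral[OF assms] by simp
qed

lemma distr_gauss_direction_moments:
  assumes n: "4 \<le> CARD('n::finite)"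
  shows "distr gauss_measure lborel (\<lambda>x :: real ^ 'n idx. (psum 3 (direction x), psum 4 (direction x)))
    = density lborel (\<lambda>(a, b). f_density CARD('n) a b)"
proof (rule measure_eqI)
  let ?g = "\<lambda>x :: real ^ 'n idx. (psum 3 (direction x), psum 4 (direction x))"
  have g: "?g \<in> borel_measurable borel" by measurable
  have g': "?g \<in> gauss_measure \<rightarrow>\<^sub>M lborel"
    using g by (simp add: measurable_cong_sets[OF sets_gauss_measure sets_lborel])
  fix B assume "B \<in> sets (distr gauss_measure lborel ?g)"
  then have B: "B \<in> sets borel" by simp
  have vimage: "?g -` B \<in> sets borel"
    by (rule measurable_sets_borel[OF g B])
  have "emeasure (distr gauss_measure lborel ?g) B = emeasure gauss_measure (?g -` B)"
    using B by (subst emeasure_distr[OF g']) simp_all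
  also have "\<dots> = (\<integral>\<^sup>+x. ennreal (gauss x) * indicator (?g -` B) x \<partial>lborel)"
    unfolding gauss_measure_def using vimage by (intro emeasure_density) simp_all
  also have "\<dots> = (\<integral>\<^sup>+x. ennreal (gauss x) * indicator B (?g x) \<partial>lborel)"
    by (intro nn_integral_cong) (simp add: indicator_def)
  also have "\<dots> = (\<integral>\<^sup>+p. f_density CARD('n) (fst p) (snd p) * indicator B p \<partial>lborel)"
    by (rule nn_integral_gauss_direction[OF n B])
  also have "\<dots> = emeasure (density lborel (\<lambda>(a, b). f_density CARD('n) a b)) B"
    using B by (subst emeasure_density[OF borel_measurable_f_density[OF n]]) (simp_all add: case_prod_beta')
  finally show "emeasure (distr gauss_measure lborel ?g) B = emeasure (density lborel (\<lambda>(a, b). f_density CARD('n) a b)) B" .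
qed simp

section \<open>Relabelling coordinates\<close>

text \<open>The results above concern vectors indexed by \<open>idx\<close>; a bijection of the index types carries them
  over to an arbitrary finite index type of the same size.\<close>
definition relabel :: "('a \<Rightarrow> 'b) \<Rightarrow> real ^ 'b \<Rightarrow> real ^ 'a"
  where "relabel e x = (\<chi> i. x $ e i)"

lemma borel_measurable_relabel [measurable]: "relabel e \<in> borel_measurable borel"
  unfolding relabel_def by measurable

lemma psum_relabel:
  fixes e :: "'a::finite \<Rightarrow> 'b::finite"
  assumes "bij e"
  shows "psum r (relabel e x) = psum r x"
  unfolding psum_def relabel_def vec_lambda_beta by (rule sum.reindex_bij_betw[OF assms])

lemma linear_relabel: "linear (relabel e :: real ^ 'b \<Rightarrow> real ^ 'a)"
  by (rule linearI) (simp_all add: relabel_def vec_eq_iff)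

lemma inner_relabel:
  fixes e :: "'a::finite \<Rightarrow> 'b::finite"
  assumes "bij e"
  shows "relabel e x \<bullet> relabel e y = x \<bullet> y"
  unfolding inner_vec_def relabel_def vec_lambda_beta by (rule sum.reindex_bij_betw[OF assms])

lemma relabel_inv:
  assumes "bij e"
  shows "relabel e (relabel (inv e) y) = y"
  using assms by (simp add: relabel_def vec_eq_iff bij_def)

lemma hyperplane_isometry_relabel:
  fixes e :: "'a::finite \<Rightarrow> 'b::finite"
  assumes e: "bij e" and Q: "hyperplane_isometry Q"
  shows "hyperplane_isometry (\<lambda>x. relabel (inv e) (Q (relabel e x)))"
proof -
  have e': "bij (inv e)"
    by (rule bij_imp_bij_inv[OF e])
  have orth: "orthogonal_transformation Q" and sub: "Q ` centred_hyperplane \<subseteq> centred_hyperplane"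
    using Q by (auto simp: hyperplane_isometry_def)
  have "linear (\<lambda>x. relabel (inv e) (Q (relabel e x)))"
    using linear_compose[OF linear_compose[OF linear_relabel orthogonal_transformation_linear[OF orth]] linear_relabel]
    by (simp add: comp_def)
  moreover have "Q v \<bullet> Q w = v \<bullet> w" for v w
    using orth by (simp add: orthogonal_transformation_def)
  ultimately have "orthogonal_transformation (\<lambda>x. relabel (inv e) (Q (relabel e x)))"
    by (simp add: orthogonal_transformation_def inner_relabel[OF e] inner_relabel[OF e'])
  moreover have "psum 1 (relabel (inv e) (Q (relabel e x))) = 0" if "psum 1 x = 0" for x
  proof -
    have "relabel e x \<in> centred_hyperplane"
      using that unfolding centred_hyperplane_def mem_Collect_eq psum_relabel[OF e] .
    then have "Q (relabel e x) \<in> centred_hyperplane"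
      using sub by blast
    then show ?thesis
      unfolding centred_hyperplane_def mem_Collect_eq psum_relabel[OF e'] .
  qed
  ultimately show ?thesis
    unfolding hyperplane_isometry_def centred_hyperplane_def by blast
qed

text \<open>An isometry after relabelling is an isometry before relabelling, conjugated.\<close>
lemma uniform_on_Omega_relabel:
  fixes e :: "'a::finite \<Rightarrow> 'b::finite" and U :: "'c \<Rightarrow> real ^ 'b"
  assumes M: "prob_space M" and U: "uniform_on_Omega M U" and e: "bij e"
  shows "invariant_law (distr M borel (\<lambda>\<omega>. relabel e (U \<omega>)))"
proof -
  let ?V = "\<lambda>\<omega>. relabel e (U \<omega>)"
  have U_meas: "U \<in> borel_measurable M" and U_AE: "AE \<omega> in M. U \<omega> \<in> Omega"
    and inv: "hyperplane_isometry Q \<Longrightarrow> distr M borel (\<lambda>\<omega>. Q (U \<omega>)) = distr M borel U" for Q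
    using U by (auto simp: uniform_on_Omega_def hyperplane_isometry_def)
  have V: "?V \<in> borel_measurable M"
    by (rule measurable_compose[OF U_meas borel_measurable_relabel])
  have "AE \<omega> in M. ?V \<omega> \<in> Omega"
    using U_AE by eventually_elim (simp add: Omega_def psum_relabel[OF e])
  then have AE: "AE x in distr M borel ?V. x \<in> Omega"
    by (subst AE_distr_iff[OF V]) simp_all
  have "distr (distr M borel ?V) borel Q = distr M borel ?V" if Q: "hyperplane_isometry Q" for Q
  proof -
    let ?Q = "\<lambda>x. relabel (inv e) (Q (relabel e x))"
    have Q': "hyperplane_isometry ?Q"
      by (rule hyperplane_isometry_relabel[OF e Q])
    have QU: "(\<lambda>\<omega>. ?Q (U \<omega>)) \<in> borel_measurable M"
      by (rule measurable_compose[OF U_meas hyperplane_isometry_measurable[OF Q']])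
    have "distr (distr M borel ?V) borel Q = distr M borel (\<lambda>\<omega>. Q (?V \<omega>))"
      by (subst distr_distr[OF hyperplane_isometry_measurable[OF Q] V]) (simp add: comp_def)
    also have "\<dots> = distr M borel (\<lambda>\<omega>. relabel e (?Q (U \<omega>)))"
      by (simp only: relabel_inv[OF e])
    also have "\<dots> = distr (distr M borel (\<lambda>\<omega>. ?Q (U \<omega>))) borel (relabel e)"
      by (subst distr_distr[OF borel_measurable_relabel QU]) (simp add: comp_def)
    also have "\<dots> = distr (distr M borel U) borel (relabel e)"
      by (simp only: inv[OF Q'])
    also have "\<dots> = distr M borel ?V"
      by (subst distr_distr[OF borel_measurable_relabel U_meas]) (simp add: comp_def)
    finally show ?thesis .
  qed
  with AE show ?thesis
    by (simp add: invariant_law_def prob_space.prob_space_distr[OF M V])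
qed

lemma exists_relabelling: "\<exists>e :: 'n::finite idx \<Rightarrow> 'n. bij e"
  using finite_same_card_bij[of "UNIV :: 'n idx set" "UNIV :: 'n set"] by simp

section \<open>The density on the sphere\<close>

lemma distributed_uniform_moments:
  fixes U :: "'a \<Rightarrow> real ^ 'n::finite"
  assumes M: "prob_space M" and U: "uniform_on_Omega M U" and n: "4 \<le> CARD('n)"
  shows "distributed M lborel (\<lambda>\<omega>. (psum 3 (U \<omega>), psum 4 (U \<omega>))) (\<lambda>(a, b). f_density CARD('n) a b)"
proof -
  obtain e :: "'n idx \<Rightarrow> 'n" where e: "bij e"
    using exists_relabelling by blast
  let ?g = "\<lambda>x :: real ^ 'n idx. (psum 3 x, psum 4 x)"
  let ?V = "\<lambda>\<omega>. relabel e (U \<omega>)"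
  have U_meas: "U \<in> borel_measurable M"
    using U by (simp add: uniform_on_Omega_def)
  have V: "?V \<in> borel_measurable M"
    by (rule measurable_compose[OF U_meas borel_measurable_relabel])
  have g: "?g \<in> borel \<rightarrow>\<^sub>M lborel" by measurable
  have dir: "direction \<in> gauss_measure \<rightarrow>\<^sub>M (borel :: (real ^ 'n idx) measure)"
    using borel_measurable_direction measurable_cong_sets[OF sets_gauss_measure refl] by blast
  have UV: "(\<lambda>\<omega>. (psum 3 (U \<omega>), psum 4 (U \<omega>))) = (\<lambda>\<omega>. ?g (?V \<omega>))"
    by (simp only: psum_relabel[OF e])
  have law: "distr M borel ?V = distr gauss_measure borel direction"
    using n by (intro invariant_law_unique uniform_on_Omega_relabel[OF M U e] invariant_law_gauss_direction) simp
  have "distr M lborel (\<lambda>\<omega>. ?g (?V \<omega>)) = distr (distr M borel ?V) lborel ?g"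
    by (subst distr_distr[OF g V]) (simp add: comp_def)
  also have "\<dots> = distr gauss_measure lborel (\<lambda>x. ?g (direction x))"
    unfolding law by (subst distr_distr[OF g dir]) (simp add: comp_def)
  also have "\<dots> = density lborel (\<lambda>(a, b). f_density CARD('n) a b)"
    by (rule distr_gauss_direction_moments[OF n])
  finally have "distr M lborel (\<lambda>\<omega>. ?g (?V \<omega>)) = density lborel (\<lambda>(a, b). f_density CARD('n) a b)" .
  then show ?thesis
    unfolding distributed_def UV
    using borel_measurable_f_density[OF n] measurable_compose[OF V g] by blast
qed

section \<open>Sample skewness and kurtosis\<close>

lemma nn_integral_scale_plane:
  fixes g :: "real \<times> real \<Rightarrow> ennreal"
  assumes g [measurable]: "g \<in> borel_measurable borel" and c: "0 < c" and d: "0 < d"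
  shows "(\<integral>\<^sup>+p. g p \<partial>lborel) = ennreal (c * d) * (\<integral>\<^sup>+p. g (c * fst p, d * snd p) \<partial>lborel)"
proof -
  have fubini: "(\<integral>\<^sup>+p. h p \<partial>lborel) = (\<integral>\<^sup>+a. \<integral>\<^sup>+b. h (a, b) \<partial>lborel \<partial>lborel)"
    if "h \<in> borel_measurable borel" for h :: "real \<times> real \<Rightarrow> ennreal"
    using that by (subst lborel.nn_integral_fst) (simp_all add: lborel_prod)
  have "(\<integral>\<^sup>+p. g p \<partial>lborel) = (\<integral>\<^sup>+a. \<integral>\<^sup>+b. g (a, b) \<partial>lborel \<partial>lborel)"
    by (rule fubini[OF g])
  also have "\<dots> = (\<integral>\<^sup>+a. ennreal d * (\<integral>\<^sup>+b. g (a, d * b) \<partial>lborel) \<partial>lborel)"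
  proof (rule nn_integral_cong)
    fix a
    have "(\<lambda>b. g (a, b)) \<in> borel_measurable borel" by measurable
    from nn_integral_real_affine[OF this, of d 0] d
    show "(\<integral>\<^sup>+b. g (a, b) \<partial>lborel) = ennreal d * (\<integral>\<^sup>+b. g (a, d * b) \<partial>lborel)" by simp
  qed
  also have "\<dots> = ennreal d * (\<integral>\<^sup>+a. \<integral>\<^sup>+b. g (a, d * b) \<partial>lborel \<partial>lborel)"
    by (rule nn_integral_cmult) measurable
  also have "(\<integral>\<^sup>+a. \<integral>\<^sup>+b. g (a, d * b) \<partial>lborel \<partial>lborel) = ennreal c * (\<integral>\<^sup>+a. \<integral>\<^sup>+b. g (c * a, d * b) \<partial>lborel \<partial>lborel)"
  proof -
    have "(\<lambda>a. \<integral>\<^sup>+b. g (a, d * b) \<partial>lborel) \<in> borel_measurable borel" by measurable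
    from nn_integral_real_affine[OF this, of c 0] c show ?thesis by simp
  qed
  also have "(\<integral>\<^sup>+a. \<integral>\<^sup>+b. g (c * a, d * b) \<partial>lborel \<partial>lborel) = (\<integral>\<^sup>+p. g (c * fst p, d * snd p) \<partial>lborel)"
  proof (rule fubini[of "\<lambda>p. g (c * fst p, d * snd p)", symmetric, unfolded fst_conv snd_conv])
    have "(\<lambda>p :: real \<times> real. (c * fst p, d * snd p)) \<in> borel_measurable borel"
      by (intro borel_measurable_continuous_onI continuous_intros)
    then show "(\<lambda>p. g (c * fst p, d * snd p)) \<in> borel_measurable borel"
      by (rule measurable_compose[OF _ g])
  qed
  also have "ennreal d * (ennreal c * (\<integral>\<^sup>+p. g (c * fst p, d * snd p) \<partial>lborel))
      = ennreal (c * d) * (\<integral>\<^sup>+p. g (c * fst p, d * snd p) \<partial>lborel)"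
    using c d by (simp add: ennreal_mult mult_ac)
  finally show ?thesis .
qed

lemma sum_centred_powers:
  fixes x :: "'n::finite \<Rightarrow> real"
  shows "(\<Sum>i\<in>UNIV. (x i - sample_mean x) ^ r) = real CARD('n) * central_moment r x"
  by (simp add: central_moment_def)

text \<open>Both statistics are unchanged by the standardisation \<open>x \<mapsto> (x - \<mu>) / \<sigma>\<close>, and for a constant
  sample both sides are 0.\<close>
lemma skewness_kurtosis_direction:
  fixes x :: "'n::finite \<Rightarrow> real" and e :: "'n idx \<Rightarrow> 'n" and \<mu> \<sigma> :: real
  assumes e: "bij e" and \<sigma>: "0 < \<sigma>"
  defines "v \<equiv> \<chi> i. (x (e i) - \<mu>) / \<sigma>"
  shows "skewness x = sqrt (real CARD('n)) * psum 3 (direction v)"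
    and "kurtosis x = real CARD('n) * psum 4 (direction v)"
proof -
  let ?n = "real CARD('n)"
  have n: "0 < ?n" by simp
  have reindex: "(\<Sum>i\<in>UNIV. f (e i)) = sum f UNIV" for f :: "'n \<Rightarrow> real"
    by (rule sum.reindex_bij_betw[OF e])
  have "sum x UNIV = ?n * sample_mean x"
    by (simp add: sample_mean_def)
  moreover have "psum 1 v = (\<Sum>k\<in>UNIV. (x k - \<mu>) / \<sigma>)"
    unfolding v_def psum_def vec_lambda_beta power_one_right by (rule reindex)
  moreover have "(\<Sum>k\<in>UNIV. (x k - \<mu>) / \<sigma>) = (sum x UNIV - ?n * \<mu>) / \<sigma>"
    by (simp add: sum_subtractf flip: sum_divide_distrib)
  ultimately have "psum 1 v = ?n * ((sample_mean x - \<mu>) / \<sigma>)"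
    by (simp only: right_diff_distrib[symmetric] times_divide_eq_right)
  then have mean: "psum 1 v / ?n = (sample_mean x - \<mu>) / \<sigma>"
    by (simp only: nonzero_mult_div_cancel_left[OF less_imp_neq[OF n, symmetric]])
  have centre: "centre v $ i = (x (e i) - sample_mean x) / \<sigma>" for i
  proof -
    have "centre v $ i = (x (e i) - \<mu>) / \<sigma> - (sample_mean x - \<mu>) / \<sigma>"
      unfolding centre_def card_idx vec_lambda_beta mean unfolding v_def by simp
    then show ?thesis
      by (simp only: diff_divide_distrib[symmetric]) simp
  qed
  have csum: "csum r v = ?n * central_moment r x / \<sigma> ^ r" for r
  proof -
    have "csum r v = (\<Sum>k\<in>UNIV. ((x k - sample_mean x) / \<sigma>) ^ r)"
      unfolding csum_def psum_def centre by (rule reindex)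
    then show ?thesis
      by (simp add: power_divide sum_centred_powers flip: sum_divide_distrib)
  qed
  have m2: "0 \<le> central_moment 2 x"
    unfolding central_moment_def by (intro divide_nonneg_nonneg sum_nonneg) simp_all
  let ?m = "sqrt (central_moment 2 x)"
  have "(sqrt ?n * ?m / \<sigma>)\<^sup>2 = ?n * central_moment 2 x / \<sigma>\<^sup>2"
    using m2 by (simp add: power_mult_distrib power_divide)
  then have "(norm (centre v))\<^sup>2 = (sqrt ?n * ?m / \<sigma>)\<^sup>2"
    by (simp only: csum_2_eq_norm[symmetric] csum)
  then have norm: "norm (centre v) = sqrt ?n * ?m / \<sigma>"
    by (rule power2_eq_imp_eq) (use \<sigma> m2 in simp_all)
  have psum: "psum r (direction v) = ?n * central_moment r x / (sqrt ?n ^ r * ?m ^ r)" for r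
    using \<sigma> by (simp add: psum_direction csum norm power_mult_distrib power_divide)
  have n3: "sqrt ?n ^ 3 = ?n * sqrt ?n" and n4: "sqrt ?n ^ 4 = ?n * ?n"
    by (simp_all add: numeral_eq_Suc)
  have m4: "?m ^ 4 = (central_moment 2 x)\<^sup>2"
    using m2 by (simp add: numeral_eq_Suc)
  have m3: "?m ^ 3 = central_moment 2 x powr (3 / 2)"
  proof (cases "central_moment 2 x = 0")
    case False
    with m2 have "0 < central_moment 2 x" by simp
    from powr_half_mult[OF this, of 3] show ?thesis by simp
  qed simp
  show "skewness x = sqrt ?n * psum 3 (direction v)"
    using n by (simp only: psum n3 m3[symmetric] skewness_def) (simp add: field_simps)
  show "kurtosis x = ?n * psum 4 (direction v)"
    using n by (simp only: psum n4 m4[symmetric] kurtosis_def) (simp add: field_simps)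
qed

lemma distr_standardised_sample:
  fixes X :: "'n::finite \<Rightarrow> 'b \<Rightarrow> real" and e :: "'n idx \<Rightarrow> 'n"
  assumes M: "prob_space M" and \<sigma>: "0 < \<sigma>" and e: "bij e"
    and indep: "prob_space.indep_vars M (\<lambda>_. borel) X UNIV"
    and normal: "\<And>i. distributed M lborel (X i) (normal_density \<mu> \<sigma>)"
  shows "(\<lambda>\<omega>. \<chi> i. (X (e i) \<omega> - \<mu>) / \<sigma>) \<in> borel_measurable M"
    and "distr M borel (\<lambda>\<omega>. \<chi> i. (X (e i) \<omega> - \<mu>) / \<sigma>) = (gauss_measure :: (real ^ 'n idx) measure)"
proof -
  interpret prob_space M by (rule M)
  define Y where "Y k \<omega> = (X k \<omega> - \<mu>) / \<sigma>" for k \<omega>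
  have Y_dist: "distributed M lborel (Y k) std_normal_density" for k
    using normal[of k] unfolding Y_def normal_standard_normal_convert[OF \<sigma>] .
  have Y: "Y k \<in> borel_measurable M" for k
    using Y_dist[of k] by (simp add: distributed_def)
  have "indep_vars (\<lambda>_. borel) (\<lambda>k \<omega>. Y k \<omega>) UNIV"
    unfolding Y_def by (rule indep_vars_compose2[OF indep]) simp
  then have "distr M (\<Pi>\<^sub>M k\<in>UNIV. borel) (\<lambda>\<omega>. \<lambda>k\<in>UNIV. Y k \<omega>) = (\<Pi>\<^sub>M k\<in>UNIV. distr M borel (Y k))"
    using Y by (subst (asm) indep_vars_iff_distr_eq_PiM) simp_all
  moreover have "distr M borel (Y k) = density lborel std_normal_density" for k
  proof -
    have "distr M borel (Y k) = distr M lborel (Y k)"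
      by (rule distr_cong) simp_all
    then show ?thesis
      using Y_dist[of k] by (simp add: distributed_def)
  qed
  ultimately have joint: "distr M (\<Pi>\<^sub>M k\<in>UNIV. borel) (\<lambda>\<omega> k. Y k \<omega>) = (\<Pi>\<^sub>M k\<in>UNIV. density lborel std_normal_density)"
    by (simp only: restrict_UNIV)
  have Y_PiM: "(\<lambda>\<omega> k. Y k \<omega>) \<in> M \<rightarrow>\<^sub>M (\<Pi>\<^sub>M k\<in>UNIV. borel)"
    using Y by (intro measurable_PiM_single') (simp_all add: space_PiM)
  let ?v = "\<lambda>f. (\<chi> i. f (e i)) :: real ^ 'n idx"
  have v: "?v \<in> (\<Pi>\<^sub>M k\<in>UNIV. borel) \<rightarrow>\<^sub>M borel"
    by (intro borel_measurable_vec_lambda measurable_component_singleton) simp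
  have "?v (\<lambda>k. Y k \<omega>) = (\<chi> i. (X (e i) \<omega> - \<mu>) / \<sigma>)" for \<omega>
    by (simp add: Y_def)
  then have eq: "(\<lambda>\<omega>. \<chi> i. (X (e i) \<omega> - \<mu>) / \<sigma>) = (\<lambda>\<omega>. ?v (\<lambda>k. Y k \<omega>))"
    by simp
  show "(\<lambda>\<omega>. \<chi> i. (X (e i) \<omega> - \<mu>) / \<sigma>) \<in> borel_measurable M"
    unfolding eq by (rule measurable_compose[OF Y_PiM v])
  have "distr M borel (\<lambda>\<omega>. ?v (\<lambda>k. Y k \<omega>)) = distr (distr M (\<Pi>\<^sub>M k\<in>UNIV. borel) (\<lambda>\<omega> k. Y k \<omega>)) borel ?v"
    by (subst distr_distr[OF v Y_PiM]) (simp add: comp_def)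
  also have "\<dots> = gauss_measure"
    unfolding joint by (rule gauss_measure_eq_distr_PiM[OF e, symmetric])
  finally show "distr M borel (\<lambda>\<omega>. \<chi> i. (X (e i) \<omega> - \<mu>) / \<sigma>) = gauss_measure"
    unfolding eq .
qed

lemma distributed_skewness_kurtosis:
  fixes X :: "'n::finite \<Rightarrow> 'b \<Rightarrow> real"
  assumes M: "prob_space M" and \<sigma>: "0 < \<sigma>" and n: "4 \<le> CARD('n)"
    and indep: "prob_space.indep_vars M (\<lambda>_. borel) X UNIV"
    and normal: "\<And>i. distributed M lborel (X i) (normal_density \<mu> \<sigma>)"
  shows "distributed M lborel (\<lambda>\<omega>. (skewness (\<lambda>i. X i \<omega>), kurtosis (\<lambda>i. X i \<omega>)))
    (\<lambda>(s, k). h_density CARD('n) s k)"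
proof -
  let ?n = "real CARD('n)"
  obtain e :: "'n idx \<Rightarrow> 'n" where e: "bij e"
    using exists_relabelling by blast
  let ?v = "\<lambda>\<omega>. \<chi> i. (X (e i) \<omega> - \<mu>) / \<sigma>"
  let ?g = "\<lambda>x :: real ^ 'n idx. (psum 3 (direction x), psum 4 (direction x))"
  define T where "T p = (sqrt ?n * fst p, ?n * snd p)" for p :: "real \<times> real"
  define f where "f p = f_density CARD('n) (fst p) (snd p)" for p
  define h where "h p = h_density CARD('n) (fst p) (snd p)" for p
  have fh: "(\<lambda>(a, b). f_density CARD('n) a b) = f" "(\<lambda>(s, k). h_density CARD('n) s k) = h"
    by (auto simp: f_def h_def)
  have f [measurable]: "f \<in> borel_measurable borel"
    using borel_measurable_f_density[OF n] by (simp add: fh)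
  have T [measurable]: "T \<in> borel_measurable borel"
    unfolding T_def by (intro borel_measurable_continuous_onI continuous_intros)
  have h_eq: "h p = ennreal (?n powr (- 3 / 2)) * f (fst p / sqrt ?n, snd p / ?n)" for p
    by (simp add: h_def h_density_def f_def)
  have "(\<lambda>p :: real \<times> real. (fst p / sqrt ?n, snd p / ?n)) \<in> borel_measurable borel"
    by (intro borel_measurable_continuous_onI continuous_intros) simp_all
  from measurable_compose[OF this f] have h [measurable]: "h \<in> borel_measurable borel"
    unfolding h_eq[abs_def] by measurable
  have v: "?v \<in> borel_measurable M" and law: "distr M borel ?v = gauss_measure"
    by (rule distr_standardised_sample[OF M \<sigma> e indep normal])+
  have g: "?g \<in> borel \<rightarrow>\<^sub>M lborel" by measurable
  have gv: "(\<lambda>\<omega>. ?g (?v \<omega>)) \<in> M \<rightarrow>\<^sub>M lborel"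
    by (rule measurable_compose[OF v g])
  have T': "T \<in> lborel \<rightarrow>\<^sub>M lborel" using T by simp
  have stat: "(\<lambda>\<omega>. (skewness (\<lambda>i. X i \<omega>), kurtosis (\<lambda>i. X i \<omega>))) = (\<lambda>\<omega>. T (?g (?v \<omega>)))"
    unfolding T_def fst_conv snd_conv
    by (intro ext) (simp only: skewness_kurtosis_direction[OF e \<sigma>, of _ \<mu>])
  have base: "distr M lborel (\<lambda>\<omega>. ?g (?v \<omega>)) = density lborel f"
  proof -
    have "distr M lborel (\<lambda>\<omega>. ?g (?v \<omega>)) = distr (distr M borel ?v) lborel ?g"
      by (subst distr_distr[OF g v]) (simp add: comp_def)
    then show ?thesis
      unfolding law distr_gauss_direction_moments[OF n] fh .
  qed
  have "distr M lborel (\<lambda>\<omega>. T (?g (?v \<omega>))) = density lborel h"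
  proof (rule measure_eqI)
    fix C assume "C \<in> sets (distr M lborel (\<lambda>\<omega>. T (?g (?v \<omega>))))"
    then have C [measurable]: "C \<in> sets borel" by simp
    have TC: "T -` C \<in> sets borel"
      by (rule measurable_sets_borel[OF T C])
    have root: "0 < sqrt ?n" "0 < ?n" by simp_all
    have scale: "ennreal (sqrt ?n * ?n) * h (T p) = f p" for p
    proof -
      have "sqrt ?n * ?n * ?n powr (- 3 / 2) = ?n powr (1 / 2 + 1 + - 3 / 2)"
        unfolding powr_add by (simp add: powr_half_sqrt)
      then have "ennreal (sqrt ?n * ?n) * ennreal (?n powr (- 3 / 2)) = 1"
        by (subst ennreal_mult[symmetric]) simp_all
      moreover have "h (T p) = ennreal (?n powr (- 3 / 2)) * f p"
        using root by (simp add: h_eq T_def)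
      ultimately show ?thesis
        by (simp flip: mult.assoc)
    qed
    have "emeasure (distr M lborel (\<lambda>\<omega>. T (?g (?v \<omega>)))) C = emeasure (distr (distr M lborel (\<lambda>\<omega>. ?g (?v \<omega>))) lborel T) C"
      using T' by (subst distr_distr[OF _ gv]) (simp_all add: comp_def)
    also have "\<dots> = emeasure (density lborel f) (T -` C)"
      unfolding base using C T by (subst emeasure_distr) simp_all
    also have "\<dots> = (\<integral>\<^sup>+p. f p * indicator (T -` C) p \<partial>lborel)"
      using TC by (intro emeasure_density) simp_all
    also have "\<dots> = (\<integral>\<^sup>+p. ennreal (sqrt ?n * ?n) * (h (T p) * indicator C (T p)) \<partial>lborel)"
      by (intro nn_integral_cong) (simp add: indicator_def flip: scale)
    also have "\<dots> = ennreal (sqrt ?n * ?n) * (\<integral>\<^sup>+p. h (T p) * indicator C (T p) \<partial>lborel)"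
      by (rule nn_integral_cmult) measurable
    also have "\<dots> = (\<integral>\<^sup>+p. h p * indicator C p \<partial>lborel)"
      unfolding T_def by (rule nn_integral_scale_plane[OF _ root, symmetric]) measurable
    also have "\<dots> = emeasure (density lborel h) C"
      using C by (intro emeasure_density[symmetric]) simp_all
    finally show "emeasure (distr M lborel (\<lambda>\<omega>. T (?g (?v \<omega>)))) C = emeasure (density lborel h) C" .
  qed simp
  then show ?thesis
    unfolding distributed_def stat fh using h measurable_compose[OF gv T'] by simp
qed

theorem theorem2:
  fixes n :: nat
  assumes "n = CARD('n::finite)" and "n \<ge> 4"
  shows
    "(\<forall>(M :: 'a measure) (U :: 'a \<Rightarrow> real ^ 'n).
        prob_space M \<and> uniform_on_Omega M U \<longrightarrow>
        distributed M lborel (\<lambda>\<omega>. (psum 3 (U \<omega>), psum 4 (U \<omega>)))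
          (\<lambda>(a, b). f_density n a b))
   \<and> (\<forall>(M :: 'b measure) (X :: 'n \<Rightarrow> 'b \<Rightarrow> real) \<mu> \<sigma>.
        prob_space M \<and> \<sigma> > 0 \<and>
        prob_space.indep_vars M (\<lambda>_. borel) X UNIV \<and>
        (\<forall>i. distributed M lborel (X i) (normal_density \<mu> \<sigma>)) \<longrightarrow>
        distributed M lborel
          (\<lambda>\<omega>. (skewness (\<lambda>i. X i \<omega>), kurtosis (\<lambda>i. X i \<omega>)))
          (\<lambda>(s, k). h_density n s k))"
proof (intro conjI allI impI)
  fix M :: "'a measure" and U :: "'a \<Rightarrow> real ^ 'n"
  assume "prob_space M \<and> uniform_on_Omega M U"
  then show "distributed M lborel (\<lambda>\<omega>. (psum 3 (U \<omega>), psum 4 (U \<omega>))) (\<lambda>(a, b). f_density n a b)"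
    using assms(2) unfolding assms(1) by (intro distributed_uniform_moments) simp_all
next
  fix M :: "'b measure" and X :: "'n \<Rightarrow> 'b \<Rightarrow> real" and \<mu> \<sigma> :: real
  assume "prob_space M \<and> \<sigma> > 0 \<and> prob_space.indep_vars M (\<lambda>_. borel) X UNIV \<and>
    (\<forall>i. distributed M lborel (X i) (normal_density \<mu> \<sigma>))"
  then show "distributed M lborel (\<lambda>\<omega>. (skewness (\<lambda>i. X i \<omega>), kurtosis (\<lambda>i. X i \<omega>))) (\<lambda>(s, k). h_density n s k)"
    using assms(2) unfolding assms(1) by (intro distributed_skewness_kurtosis[of M \<sigma> X \<mu>]) simp_all
qed

end
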